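(* Let $G$ be a finite group and let $(g,h,Q)$ be a triple with $g,h\in G$, $Q\le G$, such that $Q$ is normal in $\langle g,h,Q\rangle$, $[g,h]Q\in \mathcal{Z}(\langle g,h,Q\rangle/Q)$ and $o(hQ)=2$. Let $\mathcal{H}(g,h,Q)$ be the set of all elements $v_{(x_1,x_2,y_1,y_2)}$ with $(x_1,x_2,y_1,y_2)$ admissible for $(g,h,Q)$ (see context). Then: (1) $\mathcal{H}(g,h,Q)$ is a finitely generated subgroup of $\mathrm{SL}_1(\mathbb{Z}G)$ and $v_{(x_1,x_2,y_1,y_2)}^{-1}=v_{(-x_1,-x_2,y_2,y_1)}$ for every admissible quadruple; (2) $\mathcal{H}(g,h,Q)\neq 1$ if and only if $[g,h]\notin\langle g\rangle Q$. Moreover, if $\mathcal{H}(g,h,Q)\neq 1$, then: (3) if $o(gQ)|Q|=2$, then $\mathcal{H}(g,h,Q)\cong F_3\times C_2$; (4) if $o(gQ)|Q|>2$, then $\mathcal{H}(g,h,Q)\cong F_n$ with $n=1+\frac{(o(gQ)|Q|)^3}{6}\prod_p\left(1-\frac{1}{p^2}\right)$, where the product runs over the prime divisors $p$ of $o(gQ)|Q|$.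
   Context: Commutators are $[g,h]=g^{-1}h^{-1}gh$; $o(x)$ is the order of $x$; $F_n$ is the free group of rank $n$. For a finite subgroup $Q$, $\widetilde{Q}=\sum_{q\in Q}q\in\mathbb{Z}G$. Put $\widetilde{(\pm g)}_Q:=\sum_{i=0}^{o(gQ)-1}(\pm g)^i\in \mathbb{Z}G$ (where $(-g)^i=(-1)^ig^i$ and $\widetilde{g}_Q=\widetilde{(+g)}_Q$). For $(x_1,x_2,y_1,y_2)\in\mathbb{Z}^4$ define in $\mathbb{Q}G$ $$v_{(x_1,x_2,y_1,y_2)}:=1+\frac{1}{2|Q|}\widetilde{Q}\,(1-[g,h])\Big(h\,[x_1\,\widetilde{(-g)}_Q+x_2\,\widetilde{g}_Q]+y_1\,\widetilde{(-g)}_Q+y_2\,\widetilde{g}_Q\Big).$$ The quadruple is called admissible for $(g,h,Q)$ if $$y_1+y_2+o(gQ)\,y_1y_2=o(gQ)\,x_1x_2\quad\text{and}\quad x_2\pm x_1\equiv 0\equiv y_2\pm y_1 \pmod{2|Q|}$$ (the congruences being required for both signs). $\mathrm{SL}_1(\mathbb{Z}G)$ is the group of units of $\mathbb{Z}G$ whose projection to every simple component $M_n(D)$ of the Wedderburn decomposition of $\mathbb{Q}G$ has reduced norm $1$ over the centre of $D$. *)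

theory Defs
  imports
    "HOL-Algebra.Algebra"
    "HOL-Number_Theory.Cong"
    "Jordan_Normal_Form.Determinant"
begin

definition commutator :: "('a, 'b) monoid_scheme \<Rightarrow> 'a \<Rightarrow> 'a \<Rightarrow> 'a" where
  "commutator G g h =
     inv\<^bsub>G\<^esub> g \<otimes>\<^bsub>G\<^esub> inv\<^bsub>G\<^esub> h \<otimes>\<^bsub>G\<^esub> g \<otimes>\<^bsub>G\<^esub> h"

text \<open>Used both for groups and for (the multiplicative structure of) rings.\<close>

definition center :: "('a, 'b) monoid_scheme \<Rightarrow> 'a set" where
  "center M = {z \<in> carrier M. \<forall>x \<in> carrier M. z \<otimes>\<^bsub>M\<^esub> x = x \<otimes>\<^bsub>M\<^esub> z}"

definition finitely_generated :: "('a, 'b) monoid_scheme \<Rightarrow> 'a set \<Rightarrow> bool" where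
  "finitely_generated G H \<longleftrightarrow> (\<exists>S. finite S \<and> S \<subseteq> carrier G \<and> generate G S = H)"

definition triple_group :: "('a, 'b) monoid_scheme \<Rightarrow> 'a \<Rightarrow> 'a \<Rightarrow> 'a set \<Rightarrow> ('a, 'b) monoid_scheme"
  where "triple_group G g h Q = G\<lparr>carrier := generate G ({g, h} \<union> Q)\<rparr>"

text \<open>The order of the coset \<open>xQ = Qx\<close> in \<open>\<langle>g,h,Q\<rangle>/Q\<close>, for \<open>Q\<close> normal in \<open>\<langle>g,h,Q\<rangle>\<close>.\<close>

definition coset_order :: "('a, 'b) monoid_scheme \<Rightarrow> 'a \<Rightarrow> 'a \<Rightarrow> 'a set \<Rightarrow> 'a \<Rightarrow> nat" where
  "coset_order G g h Q x = group.ord (triple_group G g h Q Mod Q) (Q #>\<^bsub>G\<^esub> x)"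

text \<open>The free group on the letters \<open>0, \<dots>, n - 1\<close>, realised on reduced words. A pair
  \<open>(b, i)\<close> stands for the generator \<open>i\<close> if \<open>b\<close> holds and for its inverse otherwise.\<close>

type_synonym letter = "bool \<times> nat"

definition inv_letter :: "letter \<Rightarrow> letter" where
  "inv_letter a = (\<not> fst a, snd a)"

definition reduced :: "letter list \<Rightarrow> bool" where
  "reduced w \<longleftrightarrow> (\<forall>i. Suc i < length w \<longrightarrow> w ! Suc i \<noteq> inv_letter (w ! i))"

fun cons_reduce :: "letter \<Rightarrow> letter list \<Rightarrow> letter list" where
  "cons_reduce a [] = [a]"
| "cons_reduce a (b # w) = (if b = inv_letter a then w else a # b # w)"

definition free_group :: "nat \<Rightarrow> letter list monoid" where
  "free_group n =
     \<lparr>carrier = {w. reduced w \<and> set w \<subseteq> UNIV \<times> {..<n}},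
      monoid.mult = (\<lambda>u v. foldr cons_reduce u v),
      one = []\<rparr>"

text \<open>Elements of \<open>\<rat>G\<close> are the coefficient functions of a finite group \<open>G\<close>, extended by
  \<open>undefined\<close> outside the carrier of \<open>G\<close>.\<close>

definition QG :: "('g, 'm) monoid_scheme \<Rightarrow> (rat, 'g \<Rightarrow> rat) module" where
  "QG G =
     \<lparr>carrier = carrier G \<rightarrow>\<^sub>E UNIV,
      monoid.mult = (\<lambda>a b. \<lambda>x\<in>carrier G. \<Sum>y\<in>carrier G. a y * b (inv\<^bsub>G\<^esub> y \<otimes>\<^bsub>G\<^esub> x)),
      one = (\<lambda>x\<in>carrier G. if x = \<one>\<^bsub>G\<^esub> then 1 else 0),
      ring.zero = (\<lambda>x\<in>carrier G. 0),
      add = (\<lambda>a b. \<lambda>x\<in>carrier G. a x + b x),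
      module.smult = (\<lambda>c a. \<lambda>x\<in>carrier G. c * a x)\<rparr>"

definition ZG :: "('g, 'm) monoid_scheme \<Rightarrow> (rat, 'g \<Rightarrow> rat) module" where
  "ZG G = (QG G)\<lparr>carrier := carrier G \<rightarrow>\<^sub>E \<int>\<rparr>"

definition elt :: "('g, 'm) monoid_scheme \<Rightarrow> 'g \<Rightarrow> ('g \<Rightarrow> rat)" where
  "elt G g = (\<lambda>x\<in>carrier G. if x = g then 1 else 0)"

text \<open>The simple components of a semisimple ring \<open>A\<close> are the rings \<open>Ae\<close> with \<open>e\<close> a primitive
  central idempotent, and the projection of \<open>x\<close> to \<open>Ae\<close> is \<open>xe\<close>.\<close>

definition primitive_central_idempotents :: "('a, 'b) ring_scheme \<Rightarrow> 'a set" where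
  "primitive_central_idempotents A =
     {e \<in> center A. e \<otimes>\<^bsub>A\<^esub> e = e \<and> e \<noteq> \<zero>\<^bsub>A\<^esub> \<and>
        (\<forall>f \<in> center A. f \<otimes>\<^bsub>A\<^esub> f = f \<and> f \<otimes>\<^bsub>A\<^esub> e = f \<longrightarrow> f = \<zero>\<^bsub>A\<^esub> \<or> f = e)}"

definition component :: "('a, 'b) ring_scheme \<Rightarrow> 'a \<Rightarrow> ('a, 'b) ring_scheme" where
  "component A e = A\<lparr>carrier := (\<lambda>x. x \<otimes>\<^bsub>A\<^esub> e) ` carrier A, one := e\<rparr>"

text \<open>Let \<open>B\<close> be a simple ring, finite-dimensional over its centre \<open>K\<close>, a number field. The complex
  numbers split \<open>B\<close> along every embedding \<open>K \<rightarrow> \<complex>\<close>. An isomorphism of \<open>\<complex> \<otimes>\<^sub>K B\<close> with the ring of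
  \<open>n \<times> n\<close> matrices amounts to a ring homomorphism \<open>\<phi>\<close> on \<open>B\<close> whose image spans all matrices over
  \<open>\<complex>\<close>: by the spanning property \<open>\<phi>\<close> maps \<open>K\<close> to scalar matrices and thus extends to a surjection
  from \<open>\<complex> \<otimes>\<^sub>K B\<close>, which is injective because \<open>\<complex> \<otimes>\<^sub>K B\<close> is simple.\<close>

definition splitting :: "('a, 'b) ring_scheme \<Rightarrow> nat \<Rightarrow> ('a \<Rightarrow> complex mat) \<Rightarrow> bool" where
  "splitting B n \<phi> \<longleftrightarrow>
     n > 0 \<and> \<phi> \<in> Ring.ring_hom B (ring_mat TYPE(complex) n ()) \<and>
     (\<forall>M \<in> carrier_mat n n. \<exists>S c. finite S \<and> S \<subseteq> carrier B \<and>
        (\<forall>i < n. \<forall>j < n. M $$ (i, j) = (\<Sum>b\<in>S. c b * \<phi> b $$ (i, j))))"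

text \<open>The reduced norm of \<open>b\<close> over the centre \<open>K\<close> of \<open>B\<close> is the element \<open>c\<close> of \<open>K\<close> whose image
  under the embedding of \<open>K\<close> is the determinant of the image of \<open>b\<close> under a splitting.
  It does not depend on the embedding or on the splitting.\<close>

definition is_reduced_norm :: "('a, 'b) ring_scheme \<Rightarrow> 'a \<Rightarrow> 'a \<Rightarrow> bool" where
  "is_reduced_norm B b c \<longleftrightarrow>
     c \<in> center B \<and> (\<forall>n \<phi>. splitting B n \<phi> \<longrightarrow> \<phi> c = det (\<phi> b) \<cdot>\<^sub>m 1\<^sub>m n)"

definition SL1_ZG :: "('g, 'm) monoid_scheme \<Rightarrow> ('g \<Rightarrow> rat) monoid" where
  "SL1_ZG G = (units_of (ZG G))\<lparr>carrier :=
     {u \<in> Units (ZG G). \<forall>e \<in> primitive_central_idempotents (QG G).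
        is_reduced_norm (component (QG G) e) (u \<otimes>\<^bsub>QG G\<^esub> e) (\<one>\<^bsub>component (QG G) e\<^esub>)}\<rparr>"

definition power_sum :: "('a, 'b) ring_scheme \<Rightarrow> 'a \<Rightarrow> nat \<Rightarrow> 'a" where
  "power_sum R a m = (\<Oplus>\<^bsub>R\<^esub>i\<in>{..<m}. a [^]\<^bsub>R\<^esub> i)"

definition v_elt ::
  "('g, 'm) monoid_scheme \<Rightarrow> 'g \<Rightarrow> 'g \<Rightarrow> 'g set \<Rightarrow> int \<times> int \<times> int \<times> int \<Rightarrow> ('g \<Rightarrow> rat)" where
  "v_elt G g h Q = (\<lambda>(x1, x2, y1, y2).
     (let A = QG G;
          m = coset_order G g h Q g;
          sQ = (\<Oplus>\<^bsub>A\<^esub>q\<in>Q. elt G q);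
          gp = power_sum A (elt G g) m;
          gm = power_sum A (\<ominus>\<^bsub>A\<^esub> elt G g) m
      in \<one>\<^bsub>A\<^esub> \<oplus>\<^bsub>A\<^esub> (1 / (2 * of_nat (card Q))) \<odot>\<^bsub>A\<^esub>
           (sQ \<otimes>\<^bsub>A\<^esub> (\<one>\<^bsub>A\<^esub> \<ominus>\<^bsub>A\<^esub> elt G (commutator G g h)) \<otimes>\<^bsub>A\<^esub>
             (elt G h \<otimes>\<^bsub>A\<^esub> (of_int x1 \<odot>\<^bsub>A\<^esub> gm \<oplus>\<^bsub>A\<^esub> of_int x2 \<odot>\<^bsub>A\<^esub> gp)
               \<oplus>\<^bsub>A\<^esub> of_int y1 \<odot>\<^bsub>A\<^esub> gm \<oplus>\<^bsub>A\<^esub> of_int y2 \<odot>\<^bsub>A\<^esub> gp))))"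

definition admissible ::
  "('g, 'm) monoid_scheme \<Rightarrow> 'g \<Rightarrow> 'g \<Rightarrow> 'g set \<Rightarrow> int \<times> int \<times> int \<times> int \<Rightarrow> bool" where
  "admissible G g h Q = (\<lambda>(x1, x2, y1, y2).
     (let m = int (coset_order G g h Q g); k = 2 * int (card Q)
      in y1 + y2 + m * y1 * y2 = m * x1 * x2 \<and>
         [x2 + x1 = 0] (mod k) \<and> [x2 - x1 = 0] (mod k) \<and>
         [y2 + y1 = 0] (mod k) \<and> [y2 - y1 = 0] (mod k)))"

definition HH :: "('g, 'm) monoid_scheme \<Rightarrow> 'g \<Rightarrow> 'g \<Rightarrow> 'g set \<Rightarrow> ('g \<Rightarrow> rat) set" where
  "HH G g h Q = {v_elt G g h Q t | t. admissible G g h Q t}"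

definition HH_group :: "('g, 'm) monoid_scheme \<Rightarrow> 'g \<Rightarrow> 'g \<Rightarrow> 'g set \<Rightarrow> ('g \<Rightarrow> rat) monoid" where
  "HH_group G g h Q = (SL1_ZG G)\<lparr>carrier := HH G g h Q\<rparr>"

end

theory Submission
  imports Defs "HOL-Algebra.Elementary_Groups"
begin

text \<open>
  Let \<open>m = o(gQ)\<close>, \<open>N = m|Q|\<close>, \<open>u = [g,h]\<close>, and let \<open>e = Q~(1 - u)/(2|Q|)\<close>, an idempotent that is central in
  the group ring of \<open>\<langle>g,h,Q\<rangle>\<close>. In the corner cut out by \<open>e\<close> the element \<open>h\<close> is an involution that conjugates \<open>g\<close> to
  \<open>-g\<close>, so the averages \<open>A\<close> and \<open>B\<close> of the powers of \<open>g\<close> and of \<open>-g\<close> are orthogonal idempotents exchanged by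
  \<open>h\<close>, and \<open>B, hA, hB, A\<close> are matrix units. They vanish if \<open>u \<in> \<langle>g\<rangle>Q\<close>. In terms of them, the unit of the
  quadruple \<open>(x1, x2, y1, y2)\<close> is the matrix with rows \<open>(1 + m y1, m x2)\<close> and \<open>(m x1, 1 + m y2)\<close>, and
  admissibility says that this matrix lies in the group \<open>\<Gamma>\<close> of all matrices of determinant 1 of the form
  \<open>1 + N X\<close> whose off-diagonal entries \<open>X12\<close> and \<open>X21\<close> have the same parity. The reduced norms are
  trivial because every character of \<open>SL2\<close> over the rationals is.

  The principal congruence subgroup of level 2 is the product of \<open>\<plusminus>1\<close> and the Sanov subgroup, which is free of
  rank 2. If \<open>N > 2\<close>, then \<open>\<Gamma>\<close> does not contain \<open>-1\<close>, hence it is isomorphic to a subgroup of the Sanov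
  group. Counting bottom rows of matrices modulo \<open>N\<close> gives the index, and then the Nielsen-Schreier formula
  gives the rank. If \<open>N = 2\<close>, then \<open>\<Gamma>\<close> is the product of \<open>\<plusminus>1\<close> and a subgroup of index 2.
\<close>

section \<open>Free groups on reduced words\<close>

text \<open>The reduced norms concern all simple components of the group ring of an arbitrary finite
  group, about which nothing is known. They are accessible because the matrix units have rational
  coefficients: the representation extends from \<open>\<Gamma>\<close> to all rational matrices of
  determinant 1. Working with \<open>\<Gamma>\<close> alone would not do, since a nontrivial free
  group has many characters.

  The parity condition in \<open>\<Gamma>\<close> reflects integrality. In
  \<open>x1 (-g)~ + x2 g~\<close> the even powers of \<open>g\<close> have coefficient
  \<open>x2 + x1\<close> and the odd ones \<open>x2 - x1\<close>, and both must be divisible by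
  \<open>2|Q|\<close>. For \<open>y1, y2\<close> the factor 2 comes from the determinant, because
  \<open>m\<close> is even if \<open>u\<close> is not in \<open>Q\<close>: modulo \<open>Q\<close>
  both the square and the \<open>m\<close>-th power of \<open>u\<close> are trivial.

  The level 2 subgroup contains \<open>-1\<close> and is not free, so the rank formula applies in
  the Sanov group, whereas the rows are counted in the larger group. The two indices are compared by
  carrying coset representatives over, with both signs if \<open>N > 2\<close> and without sign if
  \<open>N = 2\<close>.\<close>

lemma inv_letter_inv_letter [simp]: "inv_letter (inv_letter a) = a"
  by (simp add: inv_letter_def)

lemma snd_inv_letter [simp]: "snd (inv_letter a) = snd a"
  by (simp add: inv_letter_def)

lemma inv_letter_neq [simp]: "inv_letter a \<noteq> a" "a \<noteq> inv_letter a"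
  by (cases a, simp add: inv_letter_def)+

lemma reduced_Nil [simp]: "reduced []"
  by (simp add: reduced_def)

lemma reduced_single [simp]: "reduced [a]"
  by (simp add: reduced_def)

lemma reduced_Cons_Cons [simp]:
  "reduced (a # b # w) \<longleftrightarrow> b \<noteq> inv_letter a \<and> reduced (b # w)"
proof
  assume r: "reduced (a # b # w)"
  have "b \<noteq> inv_letter a"
    using r[unfolded reduced_def, rule_format, of 0] by simp
  moreover have "(b # w) ! Suc i \<noteq> inv_letter ((b # w) ! i)" if "Suc i < length (b # w)" for i
    using r[unfolded reduced_def, rule_format, of "Suc i"] that by simp
  ultimately show "b \<noteq> inv_letter a \<and> reduced (b # w)"
    by (simp add: reduced_def)
next
  assume r: "b \<noteq> inv_letter a \<and> reduced (b # w)"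
  have "(a # b # w) ! Suc i \<noteq> inv_letter ((a # b # w) ! i)" if "Suc i < length (a # b # w)" for i
    using r that by (cases i) (auto simp: reduced_def)
  then show "reduced (a # b # w)"
    by (simp add: reduced_def)
qed

lemma reduced_ConsD: "reduced (a # w) \<Longrightarrow> reduced w"
  by (cases w) auto

lemma reduced_cons_reduce: "reduced w \<Longrightarrow> reduced (cons_reduce a w)"
  by (cases w) (auto dest: reduced_ConsD)

text \<open>If \<open>w\<close> begins with \<open>a\<close>, the inner step deletes this letter and
  the outer step restores it. Reducedness guarantees that the next letter is not
  \<open>inv_letter a\<close>, so the outer step does not cancel a second time.\<close>

lemma cons_reduce_inverse [simp]:
  "reduced w \<Longrightarrow> cons_reduce a (cons_reduce (inv_letter a) w) = w"
proof (cases w)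
  case (Cons b v)
  assume "reduced w"
  with Cons show ?thesis by (cases v) auto
qed simp

lemma cons_reduce_reduced: "reduced (a # w) \<Longrightarrow> cons_reduce a w = a # w"
  by (cases w) auto

lemma reduced_foldr: "reduced v \<Longrightarrow> reduced (foldr cons_reduce u v)"
  by (induction u) (auto intro: reduced_cons_reduce)

lemma foldr_cons_reduce_reduced: "reduced u \<Longrightarrow> foldr cons_reduce u [] = u"
proof (induction u)
  case (Cons a u)
  then show ?case using reduced_ConsD[OF Cons.prems] by (simp add: cons_reduce_reduced)
qed simp

text \<open>Van der Waerden's trick: letters act on reduced words by \<open>cons_reduce\<close>, and
  a letter and its inverse act by inverse permutations, so a cancellation inside the acting word
  does not change its action. Associativity of the product then follows by induction on the first
  factor.\<close>

lemma foldr_cons_reduce_cons_reduce: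
  "reduced v \<Longrightarrow> foldr cons_reduce (cons_reduce a u) v = cons_reduce a (foldr cons_reduce u v)"
proof (cases u)
  case (Cons b w)
  assume "reduced v"
  then show ?thesis
    using Cons by (auto simp: reduced_foldr)
qed simp

lemma foldr_cons_reduce_assoc:
  "reduced w \<Longrightarrow>
    foldr cons_reduce (foldr cons_reduce u v) w = foldr cons_reduce u (foldr cons_reduce v w)"
  by (induction u) (auto simp: foldr_cons_reduce_cons_reduce)

lemma set_cons_reduce: "set (cons_reduce a w) \<subseteq> insert a (set w)"
  by (cases w) auto

lemma set_foldr_cons_reduce: "set (foldr cons_reduce u v) \<subseteq> set u \<union> set v"
proof (induction u)
  case (Cons a u)
  then show ?case using set_cons_reduce[of a "foldr cons_reduce u v"] by auto
qed simp

lemma foldr_cons_reduce_cancel: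
  "reduced v \<Longrightarrow> foldr cons_reduce (rev (map inv_letter u)) (foldr cons_reduce u v) = v"
proof (induction u arbitrary: v)
  case (Cons a u)
  then show ?case
    using cons_reduce_inverse[of "foldr cons_reduce u v" "inv_letter a"] by (simp add: reduced_foldr)
qed simp

lemma carrier_free_group: "carrier (free_group n) = {w. reduced w \<and> set w \<subseteq> UNIV \<times> {..<n}}"
  and mult_free_group: "u \<otimes>\<^bsub>free_group n\<^esub> v = foldr cons_reduce u v"
  and one_free_group: "\<one>\<^bsub>free_group n\<^esub> = []"
  by (simp_all add: free_group_def)

lemma foldr_cons_reduce_closed:
  assumes "set u \<subseteq> UNIV \<times> {..<n}" "v \<in> carrier (free_group n)"
  shows "foldr cons_reduce u v \<in> carrier (free_group n)"
  using assms set_foldr_cons_reduce[of u v] by (auto simp: reduced_foldr carrier_free_group)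

lemma set_rev_map_inv_letter:
  "set u \<subseteq> UNIV \<times> {..<n} \<Longrightarrow> set (rev (map inv_letter u)) \<subseteq> UNIV \<times> {..<n}"
  by (auto simp: inv_letter_def)

lemma group_free_group [simp]: "group (free_group n)"
proof (rule groupI)
  fix x y assume "x \<in> carrier (free_group n)" "y \<in> carrier (free_group n)"
  then show "x \<otimes>\<^bsub>free_group n\<^esub> y \<in> carrier (free_group n)"
    using foldr_cons_reduce_closed[of x n y] by (simp add: carrier_free_group mult_free_group)
next
  fix x assume x: "x \<in> carrier (free_group n)"
  let ?y = "foldr cons_reduce (rev (map inv_letter x)) []"
  have "?y \<in> carrier (free_group n)"
    using x by (intro foldr_cons_reduce_closed set_rev_map_inv_letter) (auto simp: carrier_free_group)
  moreover have "foldr cons_reduce ?y x = []"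
    using x foldr_cons_reduce_cancel[of "[]" x]
    by (simp add: foldr_cons_reduce_assoc foldr_cons_reduce_reduced carrier_free_group)
  ultimately show "\<exists>y\<in>carrier (free_group n). y \<otimes>\<^bsub>free_group n\<^esub> x = \<one>\<^bsub>free_group n\<^esub>"
    by (intro bexI[of _ ?y]) (auto simp: mult_free_group one_free_group)
qed (auto simp: foldr_cons_reduce_assoc carrier_free_group mult_free_group one_free_group)

lemma letter_in_free_group: "[a] \<in> carrier (free_group n) \<longleftrightarrow> snd a < n"
  by (cases a) (auto simp: carrier_free_group)

lemma inv_letter_free_group:
  "snd a < n \<Longrightarrow> inv\<^bsub>free_group n\<^esub> [a] = [inv_letter a]"
  by (rule group.inv_equality) (auto simp: letter_in_free_group mult_free_group one_free_group)

lemma Cons_in_free_groupD: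
  assumes "a # w \<in> carrier (free_group n)"
  shows "snd a < n" "w \<in> carrier (free_group n)" "a # w = [a] \<otimes>\<^bsub>free_group n\<^esub> w"
  using assms by (auto simp: carrier_free_group mult_free_group cons_reduce_reduced dest: reduced_ConsD)

lemma Nil_in_free_group [simp]: "[] \<in> carrier (free_group n)"
  by (simp add: carrier_free_group)

lemma mult_Nil_free_group [simp]:
  "[] \<otimes>\<^bsub>free_group n\<^esub> w = w"
  "w \<in> carrier (free_group n) \<Longrightarrow> w \<otimes>\<^bsub>free_group n\<^esub> [] = w"
  by (auto simp: carrier_free_group mult_free_group foldr_cons_reduce_reduced)

lemma inv_Nil_free_group [simp]: "inv\<^bsub>free_group n\<^esub> [] = []"
  using monoid.inv_one[OF group.is_monoid[OF group_free_group]] by (simp add: one_free_group)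

section \<open>Evaluation of words in a group\<close>

fun letter_val :: "('a, 'b) monoid_scheme \<Rightarrow> (nat \<Rightarrow> 'a) \<Rightarrow> letter \<Rightarrow> 'a" where
  "letter_val K f (b, i) = (if b then f i else inv\<^bsub>K\<^esub> (f i))"

primrec word_val :: "('a, 'b) monoid_scheme \<Rightarrow> (nat \<Rightarrow> 'a) \<Rightarrow> letter list \<Rightarrow> 'a" where
  "word_val K f [] = \<one>\<^bsub>K\<^esub>"
| "word_val K f (a # w) = letter_val K f a \<otimes>\<^bsub>K\<^esub> word_val K f w"

context group begin

lemma letter_val_closed:
  "(\<And>i. i < n \<Longrightarrow> f i \<in> carrier G) \<Longrightarrow> snd a < n \<Longrightarrow> letter_val G f a \<in> carrier G"
  by (cases a) auto

lemma letter_val_inv: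
  "(\<And>i. i < n \<Longrightarrow> f i \<in> carrier G) \<Longrightarrow> snd a < n \<Longrightarrow>
    letter_val G f (inv_letter a) = inv (letter_val G f a)"
  by (cases a) (auto simp: inv_letter_def)

lemma word_val_closed:
  "(\<And>i. i < n \<Longrightarrow> f i \<in> carrier G) \<Longrightarrow> set w \<subseteq> UNIV \<times> {..<n} \<Longrightarrow> word_val G f w \<in> carrier G"
  by (induction w) (auto intro!: letter_val_closed[of n])

lemma word_val_cons_reduce:
  assumes "\<And>i. i < n \<Longrightarrow> f i \<in> carrier G" "snd a < n" "set w \<subseteq> UNIV \<times> {..<n}"
  shows "word_val G f (cons_reduce a w) = letter_val G f a \<otimes> word_val G f w"
proof (cases w)
  case (Cons b v)
  show ?thesis
  proof (cases "b = inv_letter a")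
    case True
    have "word_val G f v \<in> carrier G" "letter_val G f a \<in> carrier G"
      using assms Cons by (auto intro: word_val_closed letter_val_closed)
    with True Cons assms show ?thesis
      by (simp add: letter_val_inv[of n] m_assoc[symmetric])
  qed (simp add: Cons)
qed simp

lemma word_val_foldr_cons_reduce:
  assumes f: "\<And>i. i < n \<Longrightarrow> f i \<in> carrier G"
    and "set u \<subseteq> UNIV \<times> {..<n}" "set v \<subseteq> UNIV \<times> {..<n}"
  shows "word_val G f (foldr cons_reduce u v) = word_val G f u \<otimes> word_val G f v"
  using assms(2)
proof (induction u)
  case Nil
  then show ?case using assms word_val_closed[of n f v] by simp
next
  case (Cons a u)
  have "set (foldr cons_reduce u v) \<subseteq> UNIV \<times> {..<n}"
    using set_foldr_cons_reduce[of u v] Cons.prems assms(3) by auto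
  moreover have "snd a < n" using Cons.prems by auto
  ultimately show ?case
    using Cons assms by (simp add: word_val_cons_reduce[of n] word_val_closed[of n]
        letter_val_closed[of n] m_assoc)
qed

lemma word_val_hom:
  "(\<And>i. i < n \<Longrightarrow> f i \<in> carrier G) \<Longrightarrow> word_val G f \<in> hom (free_group n) G"
  by (auto simp: hom_def carrier_free_group mult_free_group word_val_foldr_cons_reduce[of n]
      word_val_closed[of n])

end

section \<open>The Nielsen-Schreier theorem\<close>

text \<open>\<open>C\<close> is to be thought of as the set of right cosets of a subgroup of finite
  index, with \<open>act a\<close> as right multiplication by the letter \<open>a\<close>; it is the
  vertex set of the Schreier graph. Transitivity is stated for words that need not be reduced, which
  suits the definition of \<open>dist\<close>.\<close>

locale word_action =
  fixes C :: "'c set" and k :: nat and act :: "letter \<Rightarrow> 'c \<Rightarrow> 'c" and c0 :: 'c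
  assumes finite_C: "finite C" and base: "c0 \<in> C"
    and act_closed: "snd a < k \<Longrightarrow> c \<in> C \<Longrightarrow> act a c \<in> C"
    and act_inv: "snd a < k \<Longrightarrow> c \<in> C \<Longrightarrow> act (inv_letter a) (act a c) = c"
    and transitive: "c \<in> C \<Longrightarrow> \<exists>w. set w \<subseteq> UNIV \<times> {..<k} \<and> foldl (\<lambda>c a. act a c) c0 w = c"
begin

abbreviation K where "K \<equiv> free_group k"

definition run :: "'c \<Rightarrow> letter list \<Rightarrow> 'c" where
  "run = foldl (\<lambda>c a. act a c)"

definition stabilizer :: "letter list set" where
  "stabilizer = {w \<in> carrier K. run c0 w = c0}"

lemma run_simps [simp]: "run c [] = c" "run c (a # w) = run (act a c) w"
  "run c (u @ v) = run (run c u) v"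
  by (simp_all add: run_def)

lemma run_closed: "set w \<subseteq> UNIV \<times> {..<k} \<Longrightarrow> c \<in> C \<Longrightarrow> run c w \<in> C"
  by (induction w arbitrary: c) (simp_all add: act_closed mem_Times_iff)

lemma run_closed': "w \<in> carrier K \<Longrightarrow> c \<in> C \<Longrightarrow> run c w \<in> C"
  by (auto simp: carrier_free_group run_closed)

lemma run_cons_reduce: "snd a < k \<Longrightarrow> c \<in> C \<Longrightarrow> run c (cons_reduce a w) = run (act a c) w"
  by (cases w) (auto simp: act_inv)

lemma run_foldr_cons_reduce:
  "set u \<subseteq> UNIV \<times> {..<k} \<Longrightarrow> c \<in> C \<Longrightarrow> run c (foldr cons_reduce u v) = run (run c u) v"
  by (induction u arbitrary: c) (auto simp: run_cons_reduce act_closed)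

lemma run_mult:
  "u \<in> carrier K \<Longrightarrow> c \<in> C \<Longrightarrow> run c (u \<otimes>\<^bsub>K\<^esub> v) = run (run c u) v"
  by (auto simp: carrier_free_group mult_free_group run_foldr_cons_reduce)

lemma run_inv: "u \<in> carrier K \<Longrightarrow> c \<in> C \<Longrightarrow> run (run c u) (inv\<^bsub>K\<^esub> u) = c"
  using run_mult[of u c "inv\<^bsub>K\<^esub> u"] group.r_inv[OF group_free_group, of u k]
  by (simp add: one_free_group)

lemma run_inv': "u \<in> carrier K \<Longrightarrow> c \<in> C \<Longrightarrow> run c u = d \<Longrightarrow> run d (inv\<^bsub>K\<^esub> u) = c"
  using run_inv by blast

section \<open>A spanning tree of shortest paths\<close>

definition dist :: "'c \<Rightarrow> nat" where
  "dist c = (LEAST n. \<exists>w. length w = n \<and> set w \<subseteq> UNIV \<times> {..<k} \<and> run c0 w = c)"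

lemma dist_le: "set w \<subseteq> UNIV \<times> {..<k} \<Longrightarrow> run c0 w = c \<Longrightarrow> dist c \<le> length w"
  unfolding dist_def by (rule Least_le) auto

lemma dist_witness:
  assumes "c \<in> C"
  obtains w where "length w = dist c" "set w \<subseteq> UNIV \<times> {..<k}" "run c0 w = c"
proof -
  have "\<exists>n w. length w = n \<and> set w \<subseteq> UNIV \<times> {..<k} \<and> run c0 w = c"
    using transitive[OF assms] by (auto simp: run_def)
  from LeastI_ex[OF this] show ?thesis
    using that unfolding dist_def by blast
qed

lemma dist_base: "dist c0 = 0"
  using dist_le[of "[]" c0] by simp

text \<open>Cut off the last letter of a shortest word to \<open>c\<close>. The vertex reached
  before is at distance at most \<open>dist c - 1\<close> by the truncated word, and not less, since
  one more letter leads from it to \<open>c\<close>.\<close>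

lemma ex_parent:
  assumes "c \<in> C" "c \<noteq> c0"
  shows "\<exists>p. fst p \<in> C \<and> snd (snd p) < k \<and> act (snd p) (fst p) = c \<and> dist c = Suc (dist (fst p))"
proof -
  obtain w where w: "length w = dist c" "set w \<subseteq> UNIV \<times> {..<k}" "run c0 w = c"
    using dist_witness assms by blast
  with assms obtain v a where va: "w = v @ [a]"
    by (cases w rule: rev_cases) auto
  let ?d = "run c0 v"
  have d: "?d \<in> C" "snd a < k" "act a ?d = c" "set v \<subseteq> UNIV \<times> {..<k}"
    using w va by (auto intro!: run_closed base)
  have "dist ?d \<le> length v" using d by (intro dist_le) auto
  moreover obtain u where u: "length u = dist ?d" "set u \<subseteq> UNIV \<times> {..<k}" "run c0 u = ?d"
    using dist_witness d by blast
  have "dist c \<le> length (u @ [a])"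
    using u d by (intro dist_le) (auto simp: mem_Times_iff)
  ultimately have "dist c = Suc (dist ?d)"
    using w va u by auto
  with d show ?thesis by (intro exI[of _ "(?d, a)"]) auto
qed

definition parent_step :: "'c \<Rightarrow> 'c \<times> letter" where
  "parent_step c = (SOME p. fst p \<in> C \<and> snd (snd p) < k \<and> act (snd p) (fst p) = c \<and>
     dist c = Suc (dist (fst p)))"

abbreviation parent where "parent c \<equiv> fst (parent_step c)"
abbreviation parent_letter where "parent_letter c \<equiv> snd (parent_step c)"

lemma parent:
  assumes "c \<in> C" "c \<noteq> c0"
  shows "parent c \<in> C" "snd (parent_letter c) < k" "act (parent_letter c) (parent c) = c"
    "dist c = Suc (dist (parent c))"
  using someI_ex[OF ex_parent[OF assms]] by (auto simp: parent_step_def)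

lemma act_parent:
  assumes "c \<in> C" "c \<noteq> c0"
  shows "act (inv_letter (parent_letter c)) c = parent c"
  using act_inv[of "parent_letter c" "parent c"] parent[OF assms] by simp

text \<open>The pair \<open>(c, i)\<close> stands for the edge from \<open>c\<close> to its image under the generator \<open>i\<close>.\<close>

definition edge_of :: "letter \<Rightarrow> 'c \<Rightarrow> 'c \<times> nat" where
  "edge_of a c = (if fst a then c else act a c, snd a)"

definition tree :: "('c \<times> nat) set" where
  "tree = (\<lambda>c. edge_of (parent_letter c) (parent c)) ` (C - {c0})"

definition rank :: nat where
  "rank = card (C \<times> {..<k} - tree)"

definition index :: "'c \<times> nat \<Rightarrow> nat" where
  "index = (SOME f. bij_betw f (C \<times> {..<k} - tree) {..<rank})"

abbreviation L where "L \<equiv> free_group rank"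

text \<open>If two vertices choose the same edge with the same orientation, both are its far end.
  With opposite orientations each would be the parent of the other, which is impossible because
  parents are strictly closer to \<open>c0\<close>.\<close>

lemma inj_on_tree: "inj_on (\<lambda>c. edge_of (parent_letter c) (parent c)) (C - {c0})"
proof (rule inj_onI)
  fix c d assume "c \<in> C - {c0}" "d \<in> C - {c0}"
    and eq: "edge_of (parent_letter c) (parent c) = edge_of (parent_letter d) (parent d)"
  then have c: "c \<in> C" "c \<noteq> c0" and d: "d \<in> C" "d \<noteq> c0" by auto
  have crossed: False if "c \<in> C" "c \<noteq> c0" "d \<in> C" "d \<noteq> c0"
    "fst (parent_letter c)" "\<not> fst (parent_letter d)"
    "parent c = d" "snd (parent_letter c) = snd (parent_letter d)" for c d
  proof -
    have "inv_letter (parent_letter d) = parent_letter c"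
      using that by (auto simp: inv_letter_def prod_eq_iff)
    then have "parent d = c"
      using act_parent[of d] parent[of c] that by simp
    then show False using parent(4)[of c] parent(4)[of d] that by simp
  qed
  show "c = d"
  proof (cases "fst (parent_letter c) = fst (parent_letter d)")
    case True
    have "snd (parent_letter c) = snd (parent_letter d)"
      using eq by (simp add: edge_of_def)
    with True have l: "parent_letter c = parent_letter d"
      by (intro prod_eqI)
    have "act (parent_letter c) (parent c) = act (parent_letter d) (parent d)"
    proof (cases "fst (parent_letter d)")
      case True
      with eq l have "parent c = parent d" by (simp add: edge_of_def)
      with l show ?thesis by (simp only:)
    next
      case False
      with eq l show ?thesis by (simp add: edge_of_def)
    qed
    then show ?thesis
      by (simp only: parent(3)[OF c] parent(3)[OF d])
  next
    case False
    have "snd (parent_letter c) = snd (parent_letter d)"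
      using eq by (simp add: edge_of_def)
    moreover have "parent c = d" if "fst (parent_letter c)"
      using eq False that parent(3)[OF d] by (simp add: edge_of_def)
    moreover have "parent d = c" if "fst (parent_letter d)"
      using eq False that parent(3)[OF c] by (simp add: edge_of_def)
    ultimately show ?thesis
      using crossed[OF c d] crossed[OF d c] False by metis
  qed
qed

lemma edge_of_closed: "snd a < k \<Longrightarrow> c \<in> C \<Longrightarrow> edge_of a c \<in> C \<times> {..<k}"
  by (auto simp: edge_of_def act_closed)

lemma edge_of_inv: "snd a < k \<Longrightarrow> c \<in> C \<Longrightarrow> edge_of (inv_letter a) (act a c) = edge_of a c"
  by (auto simp: edge_of_def act_inv) (simp_all add: inv_letter_def)

lemma tree_subset: "tree \<subseteq> C \<times> {..<k}"
proof
  fix e assume "e \<in> tree"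
  then obtain c where "c \<in> C" "c \<noteq> c0" "e = edge_of (parent_letter c) (parent c)"
    by (auto simp: tree_def)
  then show "e \<in> C \<times> {..<k}" using parent edge_of_closed by simp
qed

text \<open>The Schreier graph has \<open>card C * k\<close> edges, and the tree takes one for each
  vertex other than \<open>c0\<close>. The additive form avoids truncated subtraction.\<close>

lemma rank_eq: "rank + card C = card C * k + 1"
proof -
  have "card tree = card C - 1"
    unfolding tree_def by (simp add: card_image inj_on_tree base)
  moreover have "card tree \<le> card (C \<times> {..<k})"
    using tree_subset finite_C by (intro card_mono) auto
  moreover have "card C > 0" using finite_C base card_gt_0_iff by auto
  moreover have "rank = card (C \<times> {..<k}) - card tree"
    unfolding rank_def using tree_subset finite_C
    by (intro card_Diff_subset) (auto intro: finite_subset)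
  ultimately show ?thesis by (simp add: card_cartesian_product)
qed

lemma bij_index: "bij_betw index (C \<times> {..<k} - tree) {..<rank}"
proof -
  have "\<exists>f. bij_betw f (C \<times> {..<k} - tree) {..<rank}"
    using ex_bij_betw_finite_nat[of "C \<times> {..<k} - tree"] finite_C
    by (auto simp: rank_def atLeast0LessThan)
  then show ?thesis unfolding index_def by (rule someI_ex)
qed

text \<open>Contracting the spanning tree turns a walk in the Schreier graph into a word in the
  remaining edges.\<close>

definition label :: "'c \<Rightarrow> letter \<Rightarrow> letter list" where
  "label c a = (if edge_of a c \<in> tree then [] else [(fst a, index (edge_of a c))])"

primrec walk :: "letter list \<Rightarrow> 'c \<Rightarrow> letter list" where
  "walk [] c = []"
| "walk (a # w) c = label c a \<otimes>\<^bsub>L\<^esub> walk w (act a c)"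

lemma label_closed: "snd a < k \<Longrightarrow> c \<in> C \<Longrightarrow> label c a \<in> carrier L"
  using bij_betwE[OF bij_index] edge_of_closed[of a c]
  by (auto simp: label_def letter_in_free_group)

lemma label_inv:
  assumes "snd a < k" "c \<in> C"
  shows "label (act a c) (inv_letter a) = inv\<^bsub>L\<^esub> (label c a)"
proof -
  have "fst (inv_letter a) = (\<not> fst a)" by (simp add: inv_letter_def)
  moreover have "inv_letter (fst a, i) = (\<not> fst a, i)" for i by (simp add: inv_letter_def)
  ultimately show ?thesis
    using label_closed[OF assms] edge_of_inv[OF assms]
    by (auto simp: label_def inv_letter_free_group letter_in_free_group split: if_splits)
qed

lemma walk_closed: "set w \<subseteq> UNIV \<times> {..<k} \<Longrightarrow> c \<in> C \<Longrightarrow> walk w c \<in> carrier L"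
proof (induction w arbitrary: c)
  case Nil then show ?case by (simp add: carrier_free_group)
next
  case (Cons a w)
  interpret group L by simp
  show ?case using Cons by (simp add: label_closed act_closed mem_Times_iff)
qed

lemma walk_closed': "w \<in> carrier K \<Longrightarrow> c \<in> C \<Longrightarrow> walk w c \<in> carrier L"
  by (rule walk_closed) (auto simp: carrier_free_group)

lemma walk_cons_reduce:
  assumes "snd a < k" "c \<in> C" "set w \<subseteq> UNIV \<times> {..<k}"
  shows "walk (cons_reduce a w) c = label c a \<otimes>\<^bsub>L\<^esub> walk w (act a c)"
proof (cases w)
  case (Cons b v)
  interpret group L by simp
  show ?thesis
  proof (cases "b = inv_letter a")
    case True
    have "walk v c \<in> carrier L" "label c a \<in> carrier L"
      using assms Cons by (auto intro: walk_closed label_closed)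
    with True Cons assms show ?thesis
      by (simp add: label_inv act_inv m_assoc[symmetric])
  qed (simp add: Cons)
qed simp

text \<open>A cocycle identity: the second factor is read from the vertex to which the first one
  leads. On words that fix \<open>c0\<close>, reading from \<open>c0\<close> is therefore a
  homomorphism.\<close>

lemma walk_foldr_cons_reduce:
  assumes "set u \<subseteq> UNIV \<times> {..<k}" "set v \<subseteq> UNIV \<times> {..<k}" "c \<in> C"
  shows "walk (foldr cons_reduce u v) c = walk u c \<otimes>\<^bsub>L\<^esub> walk v (run c u)"
  using assms
proof (induction u arbitrary: c)
  case Nil
  then show ?case by simp
next
  case (Cons a u)
  interpret group L by simp
  have "set (foldr cons_reduce u v) \<subseteq> UNIV \<times> {..<k}"
    using set_foldr_cons_reduce[of u v] Cons.prems by auto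
  moreover have "snd a < k" using Cons.prems by auto
  ultimately show ?case
    using Cons by (simp add: walk_cons_reduce walk_closed run_closed label_closed act_closed m_assoc)
qed

lemma walk_mult:
  "u \<in> carrier K \<Longrightarrow> v \<in> carrier K \<Longrightarrow> c \<in> C \<Longrightarrow>
    walk (u \<otimes>\<^bsub>K\<^esub> v) c = walk u c \<otimes>\<^bsub>L\<^esub> walk v (run c u)"
  by (simp add: mult_free_group[where n = k] walk_foldr_cons_reduce carrier_free_group)

lemma walk_inv:
  assumes "u \<in> carrier K" "c \<in> C" "run c u = d"
  shows "walk (inv\<^bsub>K\<^esub> u) d = inv\<^bsub>L\<^esub> (walk u c)"
proof -
  interpret K: group K by simp
  interpret L: group L by simp
  have r: "run d (inv\<^bsub>K\<^esub> u) = c" using run_inv' assms by blast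
  have d: "d \<in> C" using assms run_closed' by blast
  have "walk (inv\<^bsub>K\<^esub> u \<otimes>\<^bsub>K\<^esub> u) d = \<one>\<^bsub>L\<^esub>"
    using assms by (simp add: one_free_group)
  then have "walk (inv\<^bsub>K\<^esub> u) d \<otimes>\<^bsub>L\<^esub> walk u c = \<one>\<^bsub>L\<^esub>"
    using assms d r walk_mult[of "inv\<^bsub>K\<^esub> u" u d] by simp
  then show ?thesis
    using assms d by (intro L.inv_equality[symmetric]) (auto intro: walk_closed')
qed

section \<open>Tree representatives and Schreier generators\<close>

primrec ancestor_word :: "nat \<Rightarrow> 'c \<Rightarrow> letter list" where
  "ancestor_word 0 c = []"
| "ancestor_word (Suc n) c = ancestor_word n (parent c) \<otimes>\<^bsub>K\<^esub> [parent_letter c]"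

definition rep :: "'c \<Rightarrow> letter list" where
  "rep c = ancestor_word (dist c) c"

lemma rep_base: "rep c0 = []"
  by (simp add: rep_def dist_base)

lemma rep_parent: "c \<in> C \<Longrightarrow> c \<noteq> c0 \<Longrightarrow> rep c = rep (parent c) \<otimes>\<^bsub>K\<^esub> [parent_letter c]"
  using parent(4)[of c] by (simp add: rep_def)

text \<open>The representative follows the tree from \<open>c0\<close> to \<open>c\<close>. All of
  its edges are contracted, so its walk is empty.\<close>

lemma rep:
  assumes "c \<in> C"
  shows "rep c \<in> carrier K \<and> run c0 (rep c) = c \<and> walk (rep c) c0 = []"
  using assms
proof (induction "dist c" arbitrary: c rule: less_induct)
  case less
  interpret K: group K by simp
  interpret L: group L by simp
  show ?case
  proof (cases "c = c0")
    case True
    then show ?thesis by (simp add: rep_base carrier_free_group)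
  next
    case False
    note p = parent[OF less.prems False]
    have IH: "rep (parent c) \<in> carrier K" "run c0 (rep (parent c)) = parent c"
      "walk (rep (parent c)) c0 = []"
      using less.hyps[of "parent c"] p by auto
    have "label (parent c) (parent_letter c) = []"
      using less.prems False by (auto simp: label_def tree_def)
    then have "walk (rep c) c0 = []"
      using IH p base less.prems False
      by (simp add: rep_parent walk_mult letter_in_free_group)
    then show ?thesis
      using IH p base less.prems False
      by (simp add: rep_parent run_mult letter_in_free_group)
  qed
qed

lemma rep_closed [simp]: "c \<in> C \<Longrightarrow> rep c \<in> carrier K"
  and run_rep [simp]: "c \<in> C \<Longrightarrow> run c0 (rep c) = c"
  and walk_rep [simp]: "c \<in> C \<Longrightarrow> walk (rep c) c0 = []"
  using rep by auto

text \<open>The classical Schreier elements: go out along the tree, cross one edge and return along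
  the tree.\<close>

definition loop :: "'c \<Rightarrow> letter \<Rightarrow> letter list" where
  "loop c a = rep c \<otimes>\<^bsub>K\<^esub> [a] \<otimes>\<^bsub>K\<^esub> inv\<^bsub>K\<^esub> (rep (act a c))"

lemma loop_closed: "snd a < k \<Longrightarrow> c \<in> C \<Longrightarrow> loop c a \<in> carrier K"
proof -
  interpret K: group K by simp
  show "snd a < k \<Longrightarrow> c \<in> C \<Longrightarrow> loop c a \<in> carrier K"
    by (simp add: loop_def act_closed letter_in_free_group)
qed

lemma run_loop: "snd a < k \<Longrightarrow> c \<in> C \<Longrightarrow> run c0 (loop c a) = c0"
proof -
  interpret K: group K by simp
  show "snd a < k \<Longrightarrow> c \<in> C \<Longrightarrow> run c0 (loop c a) = c0"
    using run_inv'[of "rep (act a c)" c0 "act a c"]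
    by (simp add: loop_def act_closed letter_in_free_group run_mult base)
qed

lemma walk_loop: "snd a < k \<Longrightarrow> c \<in> C \<Longrightarrow> walk (loop c a) c0 = label c a"
proof -
  assume a: "snd a < k" "c \<in> C"
  interpret K: group K by simp
  interpret L: group L by simp
  have "walk (inv\<^bsub>K\<^esub> (rep (act a c))) (act a c) = []"
    using a walk_inv[of "rep (act a c)" c0 "act a c"]
    by (simp add: act_closed base)
  then show "walk (loop c a) c0 = label c a"
    using a by (simp add: loop_def act_closed letter_in_free_group walk_mult run_mult base
        label_closed)
qed

lemma loop_inv:
  assumes "snd a < k" "c \<in> C"
  shows "loop (act a c) (inv_letter a) = inv\<^bsub>K\<^esub> (loop c a)"
proof -
  interpret K: group K by simp
  show ?thesis using assms
    by (simp add: loop_def act_inv act_closed letter_in_free_group K.inv_mult_group K.m_assoc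
        inv_letter_free_group)
qed

lemma loop_parent:
  assumes "c \<in> C" "c \<noteq> c0"
  shows "loop (parent c) (parent_letter c) = \<one>\<^bsub>K\<^esub>"
proof -
  interpret K: group K by simp
  note p = parent[OF assms]
  have "rep (parent c) \<otimes>\<^bsub>K\<^esub> [parent_letter c] = rep c"
    using assms by (simp add: rep_parent)
  then show ?thesis using p assms by (simp add: loop_def)
qed

text \<open>A tree edge is crossed either away from \<open>c0\<close> or towards it. The first case
  is \<open>loop_parent\<close>, and the second gives the inverse of such a loop.\<close>

lemma loop_tree:
  assumes "snd a < k" "c \<in> C" "edge_of a c \<in> tree"
  shows "loop c a = \<one>\<^bsub>K\<^esub>"
proof -
  interpret K: group K by simp
  obtain d where d: "d \<in> C" "d \<noteq> c0" "edge_of a c = edge_of (parent_letter d) (parent d)"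
    using assms by (auto simp: tree_def)
  note p = parent[OF d(1,2)]
  consider "a = parent_letter d" "c = parent d"
    | "a = inv_letter (parent_letter d)" "c = d"
  proof (cases "fst a = fst (parent_letter d)")
    case True
    then have a: "a = parent_letter d" using d by (auto simp: edge_of_def prod_eq_iff)
    have "c = parent d"
    proof (cases "fst a")
      case True
      then show ?thesis using d a by (simp add: edge_of_def)
    next
      case False
      then have "act a c = act a (parent d)" using d a by (simp add: edge_of_def)
      then show ?thesis using act_inv[of a c] act_inv[of a "parent d"] a p assms by simp
    qed
    with a that show ?thesis by blast
  next
    case False
    then have a: "a = inv_letter (parent_letter d)"
      using d by (auto simp: edge_of_def prod_eq_iff inv_letter_def)
    have "c = d"
    proof (cases "fst a")
      case True
      then show ?thesis using False d p by (auto simp: edge_of_def)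
    next
      case f: False
      then have "act a c = parent d" using False d by (auto simp: edge_of_def)
      then show ?thesis using act_inv[of a c] assms a p by auto
    qed
    with a that show ?thesis by blast
  qed
  then show ?thesis
  proof cases
    case 1
    then show ?thesis using loop_parent d by simp
  next
    case 2
    then show ?thesis
      using loop_inv[of "parent_letter d" "parent d"] loop_parent[of d] d p by simp
  qed
qed

definition schreier_gen :: "nat \<Rightarrow> letter list" where
  "schreier_gen i = (case inv_into (C \<times> {..<k} - tree) index i of (c, x) \<Rightarrow> loop c (True, x))"

lemma schreier_gen_index:
  assumes "c \<in> C" "x < k" "(c, x) \<notin> tree"
  shows "schreier_gen (index (c, x)) = loop c (True, x)"
  using assms bij_betw_inv_into_left[OF bij_index, of "(c, x)"] by (simp add: schreier_gen_def)

lemma schreier_gen: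
  assumes "i < rank"
  obtains c x where "c \<in> C" "x < k" "(c, x) \<notin> tree" "index (c, x) = i"
    "schreier_gen i = loop c (True, x)"
proof -
  have "i \<in> index ` (C \<times> {..<k} - tree)"
    using bij_index assms by (simp add: bij_betw_def)
  then obtain e where e: "i = index e" "e \<in> C \<times> {..<k} - tree" by (rule imageE)
  obtain c x where cx: "e = (c, x)" by (cases e)
  show ?thesis
    by (rule that[of c x]) (use e cx in \<open>simp_all add: schreier_gen_index\<close>)
qed

lemma schreier_gen_closed: "i < rank \<Longrightarrow> schreier_gen i \<in> carrier K"
  by (auto elim!: schreier_gen intro!: loop_closed)

lemma word_val_label:
  assumes "snd a < k" "c \<in> C"
  shows "word_val K schreier_gen (label c a) = loop c a"
proof (cases "edge_of a c \<in> tree")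
  case True
  then show ?thesis using assms by (simp add: label_def loop_tree)
next
  case False
  interpret K: group K by simp
  show ?thesis
  proof (cases "fst a")
    case True
    then have a: "a = (True, snd a)" by (simp add: prod_eq_iff)
    have e: "edge_of a c = (c, snd a)" using True by (simp add: edge_of_def)
    have "schreier_gen (index (c, snd a)) = loop c (True, snd a)"
      using assms False e by (intro schreier_gen_index) auto
    then have "schreier_gen (index (c, snd a)) = loop c a" using a by simp
    then show ?thesis using loop_closed[OF assms] False True e by (simp add: label_def)
  next
    case nonpos: False
    then have a: "(True, snd a) = inv_letter a" by (simp add: inv_letter_def)
    have e: "edge_of a c = (act a c, snd a)" using nonpos by (simp add: edge_of_def)
    have "schreier_gen (index (act a c, snd a)) = loop (act a c) (True, snd a)"
      using assms False e act_closed by (intro schreier_gen_index) auto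
    also have "\<dots> = inv\<^bsub>K\<^esub> (loop c a)"
      unfolding a using assms by (rule loop_inv)
    finally show ?thesis using loop_closed[OF assms] False nonpos e by (simp add: label_def)
  qed
qed

text \<open>The loops along \<open>w\<close> telescope: the return path of each cancels against the
  outgoing path of the next. For \<open>c = c0\<close> and \<open>w\<close> in the stabilizer the
  two remaining representatives are empty, so every such \<open>w\<close> is recovered from its
  walk. This is the generation half of the theorem.\<close>

lemma word_val_walk:
  assumes "w \<in> carrier K" "c \<in> C"
  shows "word_val K schreier_gen (walk w c) = rep c \<otimes>\<^bsub>K\<^esub> w \<otimes>\<^bsub>K\<^esub> inv\<^bsub>K\<^esub> (rep (run c w))"
  using assms
proof (induction w arbitrary: c)
  case Nil
  interpret K: group K by simp
  show ?case using Nil by simp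
next
  case (Cons a w)
  interpret K: group K by simp
  note a = Cons_in_free_groupD[OF Cons.prems(1)]
  have "word_val K schreier_gen (walk (a # w) c) =
      word_val K schreier_gen (label c a) \<otimes>\<^bsub>K\<^esub> word_val K schreier_gen (walk w (act a c))"
    using hom_mult[OF K.word_val_hom[of rank schreier_gen, OF schreier_gen_closed],
        of "label c a" "walk w (act a c)"] a(1,2) Cons.prems(2)
    by (simp add: label_closed walk_closed' act_closed)
  also have "\<dots> = loop c a \<otimes>\<^bsub>K\<^esub> (rep (act a c) \<otimes>\<^bsub>K\<^esub> w \<otimes>\<^bsub>K\<^esub> inv\<^bsub>K\<^esub> (rep (run (act a c) w)))"
    using Cons.IH Cons.prems(2) a(1,2) by (simp add: word_val_label act_closed)
  also have "\<dots> = rep c \<otimes>\<^bsub>K\<^esub> ([a] \<otimes>\<^bsub>K\<^esub> w) \<otimes>\<^bsub>K\<^esub> inv\<^bsub>K\<^esub> (rep (run (act a c) w))"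
  proof -
    have cancel: "inv\<^bsub>K\<^esub> y \<otimes>\<^bsub>K\<^esub> (y \<otimes>\<^bsub>K\<^esub> z) = z" if "y \<in> carrier K" "z \<in> carrier K" for y z
      using that by (simp add: K.m_assoc[symmetric])
    show ?thesis
      using a(1,2) Cons.prems(2) by (simp add: loop_def K.m_assoc act_closed run_closed' letter_in_free_group cancel)
  qed
  also have "[a] \<otimes>\<^bsub>K\<^esub> w = a # w" using a(3) by simp
  finally show ?case by simp
qed

lemma subgroup_stabilizer: "subgroup stabilizer K"
proof -
  interpret K: group K by simp
  show ?thesis
  proof (rule K.subgroupI)
    show "stabilizer \<noteq> {}" by (auto simp: stabilizer_def intro!: exI[of _ "[]"])
  qed (use run_inv' base in \<open>auto simp: stabilizer_def run_mult simp del: run_simps\<close>)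
qed

text \<open>The freeness half: a Schreier generator crosses exactly one edge outside the tree, so
  its walk is its own letter, and by the cocycle identity the walk of a product spells out the word
  from which it was formed.\<close>

lemma word_val_in_stabilizer:
  assumes "w \<in> carrier L"
  shows "word_val K schreier_gen w \<in> stabilizer \<and> walk (word_val K schreier_gen w) c0 = w"
  using assms
proof (induction w)
  case Nil
  show ?case by (simp add: stabilizer_def carrier_free_group one_free_group)
next
  case (Cons a w)
  interpret K: group K by simp
  interpret L: group L by simp
  note a = Cons_in_free_groupD[OF Cons.prems(1)]
  obtain c x where cx: "c \<in> C" "x < k" "(c, x) \<notin> tree" "index (c, x) = snd a"
    "schreier_gen (snd a) = loop c (True, x)"
    using schreier_gen a by blast
  let ?g = "schreier_gen (snd a)"
  have g: "?g \<in> stabilizer" "walk ?g c0 = [(True, snd a)]"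
    using cx by (simp_all add: stabilizer_def loop_closed run_loop walk_loop label_def edge_of_def)
  have gK: "?g \<in> carrier K" "run c0 ?g = c0" using g by (auto simp: stabilizer_def)
  have gi: "inv\<^bsub>K\<^esub> ?g \<in> stabilizer" "walk (inv\<^bsub>K\<^esub> ?g) c0 = [(False, snd a)]"
    using g gK a walk_inv[of ?g c0 c0] subgroup.m_inv_closed[OF subgroup_stabilizer] base
    by (auto simp: inv_letter_free_group inv_letter_def)
  have l: "letter_val K schreier_gen a \<in> stabilizer" "walk (letter_val K schreier_gen a) c0 = [a]"
    using g gi by (cases a; auto)+
  then have lK: "letter_val K schreier_gen a \<in> carrier K" "run c0 (letter_val K schreier_gen a) = c0"
    by (auto simp: stabilizer_def)
  show ?case
    using Cons.IH a l lK subgroup.m_closed[OF subgroup_stabilizer, of "letter_val K schreier_gen a"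
        "word_val K schreier_gen w"]
    by (auto simp: walk_mult base stabilizer_def simp flip: a(3))
qed

theorem stabilizer_free: "word_val K schreier_gen \<in> iso L (K\<lparr>carrier := stabilizer\<rparr>)"
proof -
  interpret K: group K by simp
  have "word_val K schreier_gen \<in> hom L (K\<lparr>carrier := stabilizer\<rparr>)"
    using K.word_val_hom[of rank schreier_gen] word_val_in_stabilizer
    by (auto simp: hom_def schreier_gen_closed)
  moreover have "bij_betw (word_val K schreier_gen) (carrier L) stabilizer"
  proof (rule bij_betw_byWitness[where f' = "\<lambda>w. walk w c0"])
    show "\<forall>w\<in>stabilizer. word_val K schreier_gen (walk w c0) = w"
      using word_val_walk[OF _ base]
      by (auto simp: stabilizer_def rep_base)
  qed (use word_val_in_stabilizer base walk_closed' in \<open>auto simp: stabilizer_def\<close>)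
  ultimately show ?thesis by (simp add: iso_def)
qed

end

section \<open>The Sanov subgroup\<close>

type_synonym 'a mat2 = "'a \<times> 'a \<times> 'a \<times> 'a"

text \<open>The quadruple \<open>(a, b, c, d)\<close> is the matrix with rows \<open>(a, b)\<close> and \<open>(c, d)\<close>.\<close>

definition SL2 :: "'a::comm_ring_1 mat2 monoid" where
  "SL2 = \<lparr>carrier = {(a, b, c, d). a * d - b * c = 1},
     monoid.mult = (\<lambda>(a, b, c, d) (a', b', c', d').
       (a * a' + b * c', a * b' + b * d', c * a' + d * c', c * b' + d * d')),
     one = (1, 0, 0, 1)\<rparr>"

lemma carrier_SL2: "(a, b, c, d) \<in> carrier SL2 \<longleftrightarrow> a * d - b * c = 1"
  and mult_SL2: "(a, b, c, d) \<otimes>\<^bsub>SL2\<^esub> (a', b', c', d') =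
    (a * a' + b * c', a * b' + b * d', c * a' + d * c', c * b' + d * d')"
  and one_SL2: "\<one>\<^bsub>SL2\<^esub> = (1, 0, 0, 1)"
  by (simp_all add: SL2_def)

lemma mult_SL2_closed:
  "x \<in> carrier SL2 \<Longrightarrow> y \<in> carrier SL2 \<Longrightarrow> x \<otimes>\<^bsub>SL2\<^esub> y \<in> carrier SL2"
proof (cases x, cases y)
  fix a b c d a' b' c' d' :: 'a
  assume "x \<in> carrier SL2" "y \<in> carrier SL2" and xy: "x = (a, b, c, d)" "y = (a', b', c', d')"
  then have "a * d - b * c = 1" "a' * d' - b' * c' = 1" by (simp_all add: carrier_SL2)
  moreover have "(a * a' + b * c') * (c * b' + d * d') - (a * b' + b * d') * (c * a' + d * c')
      = (a * d - b * c) * (a' * d' - b' * c')"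
    by (simp add: algebra_simps)
  ultimately show ?thesis by (simp add: xy mult_SL2 carrier_SL2)
qed

lemma group_SL2: "group (SL2 :: 'a::comm_ring_1 mat2 monoid)"
proof (rule groupI)
  fix x assume "x \<in> carrier (SL2 :: 'a mat2 monoid)"
  then show "\<exists>y\<in>carrier SL2. y \<otimes>\<^bsub>SL2\<^esub> x = \<one>\<^bsub>SL2\<^esub>"
    by (cases x rule: prod_cases4)
      (auto simp: carrier_SL2 mult_SL2 one_SL2 algebra_simps intro!: bexI[of _ "(snd (snd (snd x)), - fst (snd x), - fst (snd (snd x)), fst x)"])
qed (auto simp: mult_SL2_closed one_SL2 carrier_SL2 mult_SL2 algebra_simps)

lemma inv_SL2: "(a, b, c, d) \<in> carrier SL2 \<Longrightarrow> inv\<^bsub>SL2\<^esub> (a, b, c, d) = (d, - b, - c, a)"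
  by (rule group.inv_equality[OF group_SL2]) (auto simp: carrier_SL2 mult_SL2 one_SL2 algebra_simps)

definition neg_mat2 :: "'a::comm_ring_1 mat2 \<Rightarrow> 'a mat2" where
  "neg_mat2 = (\<lambda>(a, b, c, d). (- a, - b, - c, - d))"

lemma neg_mat2_simps [simp]: "neg_mat2 (a, b, c, d) = (- a, - b, - c, - d)" "neg_mat2 (neg_mat2 x) = x"
  by (auto simp: neg_mat2_def split: prod.splits)

lemma neg_mat2_mult:
  "neg_mat2 x \<otimes>\<^bsub>SL2\<^esub> y = neg_mat2 (x \<otimes>\<^bsub>SL2\<^esub> y)" "x \<otimes>\<^bsub>SL2\<^esub> neg_mat2 y = neg_mat2 (x \<otimes>\<^bsub>SL2\<^esub> y)"
  by (cases x rule: prod_cases4, cases y rule: prod_cases4, simp add: mult_SL2)+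

lemma neg_mat2_closed [simp]: "neg_mat2 x \<in> carrier SL2 \<longleftrightarrow> x \<in> carrier SL2"
  by (cases x rule: prod_cases4) (simp add: carrier_SL2)

section \<open>The level 2 subgroup and its splitting by sign\<close>

definition Gamma2 :: "int mat2 set" where
  "Gamma2 = {(a, b, c, d). a * d - b * c = 1 \<and> odd a \<and> even b \<and> even c \<and> odd d}"

definition sanov :: "int mat2 set" where
  "sanov = {(a, b, c, d). a * d - b * c = 1 \<and> [a = 1] (mod 4) \<and> even b \<and> even c \<and> [d = 1] (mod 4)}"

lemma subgroup_Gamma2: "subgroup Gamma2 SL2"
proof (rule group.subgroupI[OF group_SL2])
  have "(1, 0, 0, 1) \<in> Gamma2" by (simp add: Gamma2_def)
  then show "Gamma2 \<noteq> {}" by blast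
next
  fix x y assume "x \<in> Gamma2" "y \<in> Gamma2"
  then show "x \<otimes>\<^bsub>SL2\<^esub> y \<in> Gamma2"
    using mult_SL2_closed[of x y] by (auto simp: Gamma2_def carrier_SL2 mult_SL2)
qed (auto simp: Gamma2_def carrier_SL2 inv_SL2 algebra_simps)

text \<open>As \<open>b\<close> and \<open>c\<close> are even, \<open>b * c\<close> vanishes modulo
  4. The determinant then makes \<open>a * d\<close> congruent to 1, so the condition on
  \<open>d\<close> follows from that on \<open>a\<close>.\<close>

lemma sanov_iff: "(a, b, c, d) \<in> sanov \<longleftrightarrow> (a, b, c, d) \<in> Gamma2 \<and> [a = 1] (mod 4)"
proof
  assume "(a, b, c, d) \<in> sanov"
  moreover have "odd x" if "[x = 1] (mod 4)" for x :: int
    using that unfolding cong_def by presburger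
  ultimately show "(a, b, c, d) \<in> Gamma2 \<and> [a = 1] (mod 4)"
    by (auto simp: sanov_def Gamma2_def)
next
  assume h: "(a, b, c, d) \<in> Gamma2 \<and> [a = 1] (mod 4)"
  then have e: "a * d = 1 + b * c" "even b" "even c" by (auto simp: Gamma2_def)
  have "[a * d = 1 * d] (mod 4)" using h by (intro cong_mult) auto
  moreover have "[b * c = 0] (mod 4)"
    using e by (auto elim!: evenE simp: cong_0_iff)
  then have "[1 + b * c = 1 + 0] (mod 4)" by (intro cong_add) auto
  ultimately have "[d = 1] (mod 4)" using e by (metis add_0_right cong_sym cong_trans mult_1)
  with h show "(a, b, c, d) \<in> sanov" by (auto simp: sanov_def Gamma2_def)
qed

lemma sanov_subset: "sanov \<subseteq> Gamma2"
  using sanov_iff by auto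

lemma subgroup_sanov: "subgroup sanov SL2"
proof (rule group.subgroupI[OF group_SL2])
  show "sanov \<subseteq> carrier SL2" by (auto simp: sanov_def carrier_SL2)
  have "(1, 0, 0, 1) \<in> sanov" by (simp add: sanov_def)
  then show "sanov \<noteq> {}" by blast
next
  fix x assume "x \<in> sanov"
  then show "inv\<^bsub>SL2\<^esub> x \<in> sanov"
    by (cases x rule: prod_cases4) (simp add: sanov_def inv_SL2 carrier_SL2 algebra_simps)
next
  fix x y assume xy: "x \<in> sanov" "y \<in> sanov"
  obtain a b c d where x: "x = (a, b, c, d)" by (cases x rule: prod_cases4)
  obtain a' b' c' d' where y: "y = (a', b', c', d')" by (cases y rule: prod_cases4)
  have "x \<otimes>\<^bsub>SL2\<^esub> y \<in> Gamma2"
    using xy sanov_subset subgroup.m_closed[OF subgroup_Gamma2] by blast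
  moreover have "[a * a' + b * c' = 1 * 1 + 0] (mod 4)"
    using xy x y by (intro cong_add cong_mult) (auto simp: sanov_def cong_0_iff elim!: evenE)
  ultimately show "x \<otimes>\<^bsub>SL2\<^esub> y \<in> sanov"
    by (simp add: x y mult_SL2 sanov_iff)
qed

lemma neg_mat2_Gamma2 [simp]: "neg_mat2 x \<in> Gamma2 \<longleftrightarrow> x \<in> Gamma2"
  by (cases x rule: prod_cases4) (auto simp: Gamma2_def)

text \<open>An odd \<open>a\<close> is 1 or 3 modulo 4, and negation exchanges the two residues.
  Hence each matrix up to sign has exactly one representative in \<open>sanov\<close>.\<close>

lemma Gamma2_cases:
  assumes "x \<in> Gamma2"
  shows "x \<in> sanov \<longleftrightarrow> neg_mat2 x \<notin> sanov"
proof -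
  obtain a b c d where x: "x = (a, b, c, d)" by (cases x rule: prod_cases4)
  have "odd a" using assms x by (auto simp: Gamma2_def)
  then have "a mod 4 = 1 \<or> a mod 4 = 3" by presburger
  then have "[a = 1] (mod 4) \<longleftrightarrow> \<not> [- a = 1] (mod 4)"
    by (auto simp: cong_def zmod_zminus1_eq_if)
  then show ?thesis using assms x neg_mat2_Gamma2[of x] by (simp add: sanov_iff del: neg_mat2_Gamma2)
qed

text \<open>All indices other than 0 give the lower triangular generator, so the closure lemmas hold
  for every index; only 0 and 1 occur in \<open>free_group 2\<close>.\<close>

definition sanov_gen :: "nat \<Rightarrow> int mat2" where
  "sanov_gen i = (if i = 0 then (1, 2, 0, 1) else (1, 0, 2, 1))"

lemma letter_val_sanov:
  "letter_val SL2 sanov_gen (s, i) = (let t = if s then 2 else - 2 in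
    if i = 0 then (1, t, 0, 1) else (1, 0, t, 1))"
  by (auto simp: sanov_gen_def inv_SL2 carrier_SL2 Let_def)

lemma sanov_gen_closed: "sanov_gen i \<in> carrier SL2"
  by (simp add: sanov_gen_def carrier_SL2)

lemma sanov_gen_in: "sanov_gen i \<in> sanov"
  by (simp add: sanov_gen_def sanov_def)

text \<open>Ping-pong: the first letter of a reduced word can be read off from the columns of its value.\<close>

fun dominates :: "letter \<Rightarrow> int \<times> int \<Rightarrow> bool" where
  "dominates (s, i) (p, q) \<longleftrightarrow> (if i = 0 then \<bar>q\<bar> < \<bar>p\<bar> else \<bar>p\<bar> < \<bar>q\<bar>) \<and>
     (if s then 0 \<le> p \<and> 0 \<le> q \<or> p \<le> 0 \<and> q \<le> 0 else 0 \<le> p \<and> q \<le> 0 \<or> p \<le> 0 \<and> 0 \<le> q)"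

text \<open>If \<open>q\<close> is the larger entry, then \<open>2 * q\<close> outweighs
  \<open>p\<close> and leaves more than \<open>\<bar>q\<bar>\<close>, with the sign of
  \<open>q\<close>. If \<open>p\<close> is larger and has a compatible sign, nothing cancels; this
  case arises when a generator is repeated.\<close>

lemma dominates_add:
  fixes p q :: int
  assumes "\<bar>p\<bar> < \<bar>q\<bar> \<or> \<bar>q\<bar> < \<bar>p\<bar> \<and> (0 \<le> p \<and> 0 \<le> q \<or> p \<le> 0 \<and> q \<le> 0)"
  shows "\<bar>q\<bar> < \<bar>p + 2 * q\<bar> \<and> (0 \<le> p + 2 * q \<and> 0 \<le> q \<or> p + 2 * q \<le> 0 \<and> q \<le> 0)"
  using assms by (smt (verit))

text \<open>Either \<open>b\<close> belongs to the other generator, and then the entry that is added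
  is the larger one, or \<open>b\<close> equals \<open>a\<close>, and then the signs are compatible.
  The excluded case \<open>b = inv_letter a\<close> is the only one in which the entries could
  shrink.\<close>

lemma dominates_step:
  assumes "dominates b (p, q)" "b \<noteq> inv_letter a" "snd a < 2" "snd b < 2"
    "letter_val SL2 sanov_gen a = (x, y, z, w)"
  shows "dominates a (x * p + y * q, z * p + w * q)"
proof -
  obtain s i t j where ab: "a = (s, i)" "b = (t, j)" by (cases a, cases b)
  define r :: int where "r = (if s then 2 else - 2)"
  have val: "(x, y, z, w) = (if i = 0 then (1, r, 0, 1) else (1, 0, r, 1))"
    using assms(5) unfolding ab letter_val_sanov r_def Let_def by (rule sym)
  have ts: "j = i \<Longrightarrow> t = s" using assms(2) by (auto simp: ab inv_letter_def)
  have ij: "i = 0 \<or> i = 1" "j = 0 \<or> j = 1" using assms ab by auto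
  \<comment> \<open>The case \<open>r = - 2\<close> is the case \<open>r = 2\<close> with
    \<open>- q\<close> in place of \<open>q\<close>.\<close>
  have add: "\<bar>q\<bar> < \<bar>p + r * q\<bar> \<and> (if s then 0 \<le> p + r * q \<and> 0 \<le> q \<or> p + r * q \<le> 0 \<and> q \<le> 0
      else 0 \<le> p + r * q \<and> q \<le> 0 \<or> p + r * q \<le> 0 \<and> 0 \<le> q)"
    if "\<bar>p\<bar> < \<bar>q\<bar> \<or> \<bar>q\<bar> < \<bar>p\<bar> \<and> (if s then 0 \<le> p \<and> 0 \<le> q \<or> p \<le> 0 \<and> q \<le> 0
      else 0 \<le> p \<and> q \<le> 0 \<or> p \<le> 0 \<and> 0 \<le> q)" for p q
    using dominates_add[of p q] dominates_add[of p "- q"] that by (cases s) (simp_all add: r_def)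
  show ?thesis
  proof (cases "i = 0")
    case True
    have "\<bar>p\<bar> < \<bar>q\<bar> \<or> \<bar>q\<bar> < \<bar>p\<bar> \<and> (if s then 0 \<le> p \<and> 0 \<le> q \<or> p \<le> 0 \<and> q \<le> 0
      else 0 \<le> p \<and> q \<le> 0 \<or> p \<le> 0 \<and> 0 \<le> q)"
      using assms(1) ts True by (cases "j = 0") (simp_all add: ab)
    from add[OF this] show ?thesis using val True by (simp add: ab)
  next
    case False
    then have "i = 1" using ij by simp
    have "\<bar>q\<bar> < \<bar>p\<bar> \<or> \<bar>p\<bar> < \<bar>q\<bar> \<and> (if s then 0 \<le> q \<and> 0 \<le> p \<or> q \<le> 0 \<and> p \<le> 0
      else 0 \<le> q \<and> p \<le> 0 \<or> q \<le> 0 \<and> 0 \<le> p)"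
      using assms(1) ts ij \<open>i = 1\<close> by (cases "j = 0") (auto simp: ab)
    from add[OF this] show ?thesis using val \<open>i = 1\<close>
      by (simp add: ab add.commute) argo
  qed
qed

lemma word_val_sanov_dominates:
  assumes "reduced (a # w)" "set (a # w) \<subseteq> UNIV \<times> {..<2}"
    "word_val SL2 sanov_gen (a # w) = (p, r, q, s)"
  shows "dominates a (p, q) \<and> dominates a (r, s)"
  using assms
proof (induction w arbitrary: a p q r s)
  case Nil
  obtain t i where "a = (t, i)" by (cases a)
  with Nil show ?case
    by (auto simp: letter_val_sanov mult_SL2 one_SL2 Let_def simp del: letter_val.simps split: if_splits)
next
  case (Cons b w)
  obtain p' r' q' s' where bw: "word_val SL2 sanov_gen (b # w) = (p', r', q', s')"
    by (cases "word_val SL2 sanov_gen (b # w)" rule: prod_cases4)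
  obtain x y z u where a: "letter_val SL2 sanov_gen a = (x, y, z, u)"
    by (cases "letter_val SL2 sanov_gen a" rule: prod_cases4)
  have IH: "dominates b (p', q') \<and> dominates b (r', s')"
    using Cons.IH[of b] Cons.prems bw by auto
  have "p = x * p' + y * q'" "r = x * r' + y * s'" "q = z * p' + u * q'" "s = z * r' + u * s'"
    using Cons.prems(3) bw a by (auto simp: mult_SL2 simp del: word_val.simps(2)
        simp: word_val.simps(2)[of _ _ a])
  moreover have "b \<noteq> inv_letter a" "snd a < 2" "snd b < 2"
    using Cons.prems by (auto simp: mem_Times_iff)
  ultimately show ?case
    using IH dominates_step[of b _ _ a x y z u] a by blast
qed

text \<open>The columns \<open>(1, 0)\<close> and \<open>(0, 1)\<close> of the identity are larger
  in different coordinates, so no single letter dominates both, whereas the first letter of a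
  nonempty reduced word would.\<close>

lemma word_val_sanov_nontrivial:
  assumes "w \<in> carrier (free_group 2)" "word_val SL2 sanov_gen w = \<one>\<^bsub>SL2\<^esub>"
  shows "w = []"
proof (cases w)
  case (Cons a v)
  with assms word_val_sanov_dominates[of a v 1 0 0 1] show ?thesis
    by (cases a) (auto simp: carrier_free_group one_SL2 split: if_splits)
qed

section \<open>Generation up to sign by a Euclidean algorithm\<close>

definition in_sanov_words :: "int mat2 \<Rightarrow> bool" where
  "in_sanov_words x \<longleftrightarrow> (\<exists>w. set w \<subseteq> UNIV \<times> {..<2} \<and>
     (x = word_val SL2 sanov_gen w \<or> x = neg_mat2 (word_val SL2 sanov_gen w)))"

lemma in_sanov_words_step:
  assumes "in_sanov_words (letter_val SL2 sanov_gen (\<not> s, i) \<otimes>\<^bsub>SL2\<^esub> x)" "i < 2" "x \<in> carrier SL2"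
  shows "in_sanov_words x"
proof -
  interpret group "SL2 :: int mat2 monoid" by (rule group_SL2)
  let ?l = "letter_val SL2 sanov_gen (s, i)"
  obtain w where w: "set w \<subseteq> UNIV \<times> {..<2}" and
    "letter_val SL2 sanov_gen (\<not> s, i) \<otimes>\<^bsub>SL2\<^esub> x = word_val SL2 sanov_gen w \<or>
      letter_val SL2 sanov_gen (\<not> s, i) \<otimes>\<^bsub>SL2\<^esub> x = neg_mat2 (word_val SL2 sanov_gen w)"
    using assms by (auto simp: in_sanov_words_def)
  moreover have "?l \<otimes>\<^bsub>SL2\<^esub> (letter_val SL2 sanov_gen (\<not> s, i) \<otimes>\<^bsub>SL2\<^esub> x) = x"
    using assms(3) sanov_gen_closed[of i] by (cases s) (simp_all add: m_assoc[symmetric])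
  ultimately have "x = word_val SL2 sanov_gen ((s, i) # w) \<or>
      x = neg_mat2 (word_val SL2 sanov_gen ((s, i) # w))"
    by (auto simp: neg_mat2_mult simp del: letter_val.simps)
  then show ?thesis
    using w assms(2) unfolding in_sanov_words_def by (intro exI[of _ "(s, i) # w"]) auto
qed

lemma in_sanov_words_upper:
  assumes "(a, b, 0, d) \<in> Gamma2"
  shows "in_sanov_words (a, b, 0, d)"
  using assms
proof (induction "nat \<bar>b\<bar>" arbitrary: b rule: less_induct)
  case less
  have "a * d = 1" "even b" using less.prems by (auto simp: Gamma2_def)
  then have ad: "a = 1 \<and> d = 1 \<or> a = -1 \<and> d = -1" by (simp add: zmult_eq_1_iff)
  show ?case
  proof (cases "b = 0")
    case True
    with ad show ?thesis unfolding in_sanov_words_def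
      by (intro exI[of _ "[]"]) (auto simp: one_SL2)
  next
    case False
    \<comment> \<open>Since \<open>d\<close> is 1 or -1 and \<open>b\<close> is even and nonzero,
      subtracting \<open>2 * d\<close> with the right sign lowers \<open>\<bar>b\<bar>\<close>, or
      replaces \<open>b\<close> by 0.\<close>
    define s where "s \<longleftrightarrow> b * d > 0"
    define b' where "b' = (if s then b - 2 * d else b + 2 * d)"
    have e: "letter_val SL2 sanov_gen (\<not> s, 0) \<otimes>\<^bsub>SL2\<^esub> (a, b, 0, d) = (a, b', 0, d)"
      by (auto simp: letter_val_sanov mult_SL2 b'_def Let_def simp del: letter_val.simps)
    have "nat \<bar>b'\<bar> < nat \<bar>b\<bar>"
      using ad False \<open>even b\<close> by (auto simp: b'_def s_def elim!: evenE)
    moreover have "(a, b', 0, d) \<in> Gamma2" using less.prems by (auto simp: Gamma2_def b'_def)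
    ultimately have "in_sanov_words (a, b', 0, d)" using less.hyps by blast
    then show ?thesis using less.prems in_sanov_words_step[of s 0 "(a, b, 0, d)"] e
      by (auto simp: Gamma2_def carrier_SL2)
  qed
qed

text \<open>A Euclidean algorithm on the first column. Its entries have different parity, hence
  different absolute value, and adding twice the smaller one, up to sign, to the larger one
  decreases \<open>\<bar>a\<bar> + \<bar>c\<bar>\<close> as long as \<open>c\<close> is nonzero. The
  entry \<open>a\<close> stays odd, so the algorithm can only end with \<open>c = 0\<close>.\<close>

lemma in_sanov_words_Gamma2:
  assumes "(a, b, c, d) \<in> Gamma2"
  shows "in_sanov_words (a, b, c, d)"
  using assms
proof (induction "nat (\<bar>a\<bar> + \<bar>c\<bar>)" arbitrary: a b c d rule: less_induct)
  case less
  have par: "odd a" "even c" using less.prems by (auto simp: Gamma2_def)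
  show ?case
  proof (cases "c = 0")
    case True
    with less.prems show ?thesis using in_sanov_words_upper by blast
  next
    case False
    define i :: nat where "i = (if \<bar>c\<bar> < \<bar>a\<bar> then 0 else 1)"
    define s where "s \<longleftrightarrow> (a > 0 \<longleftrightarrow> c > 0)"
    have ac: "\<bar>a\<bar> \<noteq> \<bar>c\<bar>" using par by (auto simp: abs_if split: if_splits)
    obtain a' b' c' d' where e:
      "letter_val SL2 sanov_gen (\<not> s, i) \<otimes>\<^bsub>SL2\<^esub> (a, b, c, d) = (a', b', c', d')"
      by (metis prod_cases4)
    have m: "(a, b, c, d) \<in> carrier SL2"
      using less.prems subgroup.subset[OF subgroup_Gamma2] by blast
    have "letter_val SL2 sanov_gen (\<not> s, i) \<in> Gamma2"
      by (auto simp: letter_val_sanov Gamma2_def Let_def simp del: letter_val.simps)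
    then have g: "(a', b', c', d') \<in> Gamma2"
      using subgroup.m_closed[OF subgroup_Gamma2, of "letter_val SL2 sanov_gen (\<not> s, i)" "(a, b, c, d)"]
        less.prems by (simp only: e)
    have "a' = a + (if i = 0 then if s then - 2 else 2 else 0) * c"
      "c' = c + (if i = 0 then 0 else if s then - 2 else 2) * a"
      using e by (auto simp: letter_val_sanov mult_SL2 Let_def simp del: letter_val.simps split: if_splits)
    then have "\<bar>a'\<bar> + \<bar>c'\<bar> < \<bar>a\<bar> + \<bar>c\<bar>"
      using ac False par(1) unfolding i_def s_def by (cases "a = 0") (auto split: if_splits)
    then have "in_sanov_words (a', b', c', d')"
      using less.hyps g by auto
    then show ?thesis using in_sanov_words_step[of s i "(a, b, c, d)"] e m
      by (auto simp: i_def split: if_splits)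
  qed
qed

lemma word_val_sanov_in:
  assumes "set w \<subseteq> UNIV \<times> {..<n}"
  shows "word_val SL2 sanov_gen w \<in> sanov"
  using assms
proof (induction w)
  case Nil then show ?case using subgroup.one_closed[OF subgroup_sanov] by simp
next
  case (Cons a w)
  have "letter_val SL2 sanov_gen a \<in> sanov"
    by (cases a) (auto simp: letter_val_sanov sanov_def Let_def simp del: letter_val.simps)
  with Cons show ?case using subgroup.m_closed[OF subgroup_sanov] by auto
qed

text \<open>Ping-pong gives injectivity. For surjectivity the Euclidean algorithm leaves a sign
  open; it is settled because values of words lie in \<open>sanov\<close>, which contains only one
  of a matrix and its negative.\<close>

theorem sanov_free: "word_val SL2 sanov_gen \<in> iso (free_group 2) (SL2\<lparr>carrier := sanov\<rparr>)"
proof -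
  interpret SL: group "SL2 :: int mat2 monoid" by (rule group_SL2)
  interpret F: group "free_group 2" by simp
  let ?e = "word_val SL2 sanov_gen"
  have hom: "?e \<in> hom (free_group 2) SL2"
    by (intro SL.word_val_hom sanov_gen_closed)
  have "?e u = ?e v \<longrightarrow> u = v" if uv: "u \<in> carrier (free_group 2)" "v \<in> carrier (free_group 2)" for u v
  proof
    assume eq: "?e u = ?e v"
    interpret h: group_hom "free_group 2" SL2 ?e
      using hom by unfold_locales
    have "?e (inv\<^bsub>free_group 2\<^esub> u \<otimes>\<^bsub>free_group 2\<^esub> v) = \<one>\<^bsub>SL2\<^esub>"
      using uv eq by simp
    then have "inv\<^bsub>free_group 2\<^esub> u \<otimes>\<^bsub>free_group 2\<^esub> v = \<one>\<^bsub>free_group 2\<^esub>"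
      using uv word_val_sanov_nontrivial one_free_group by simp
    then show "u = v" using uv F.inv_equality F.inv_inv by fastforce
  qed
  then have "inj_on ?e (carrier (free_group 2))" by (auto intro: inj_onI)
  moreover have "?e ` carrier (free_group 2) = sanov"
  proof
    show "?e ` carrier (free_group 2) \<subseteq> sanov"
      using word_val_sanov_in by (auto simp: carrier_free_group)
    show "sanov \<subseteq> ?e ` carrier (free_group 2)"
    proof
      fix x assume x: "x \<in> sanov"
      then have "in_sanov_words x"
        using in_sanov_words_Gamma2 sanov_subset by (cases x rule: prod_cases4) auto
      then obtain w where w: "set w \<subseteq> UNIV \<times> {..<2}" "x = ?e w \<or> x = neg_mat2 (?e w)"
        by (auto simp: in_sanov_words_def)
      then have "x = ?e w"
        using x word_val_sanov_in[OF w(1)] Gamma2_cases[of x] sanov_subset by auto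
      moreover have "?e (foldr cons_reduce w []) = ?e w"
        using SL.word_val_foldr_cons_reduce[of 2 sanov_gen w "[]"] w SL.word_val_closed[of 2 sanov_gen w]
        by (simp add: sanov_gen_closed)
      ultimately show "x \<in> ?e ` carrier (free_group 2)"
        using foldr_cons_reduce_closed[OF w(1), of "[]"] by (metis Nil_in_free_group imageI)
    qed
  qed
  ultimately have "bij_betw ?e (carrier (free_group 2)) sanov"
    by (simp add: bij_betw_def)
  then show ?thesis
    using hom by (auto simp: iso_def hom_def bij_betw_def)
qed

section \<open>Counting bottom rows\<close>

text \<open>The bottom rows modulo \<open>N\<close> of the matrices in \<open>Gamma2\<close>, for even \<open>N\<close>, as elements of \<open>[0, K)\<close>
  with \<open>K\<close> a multiple of \<open>N\<close>.\<close>

definition bottom_rows :: "nat \<Rightarrow> nat \<Rightarrow> (nat \<times> nat) set" where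
  "bottom_rows K N = {(c, d). c < K \<and> d < K \<and> even c \<and> odd d \<and> coprime (gcd c d) N}"

lemma finite_bottom_rows [simp]: "finite (bottom_rows K N)"
  by (rule finite_subset[of _ "{..<K} \<times> {..<K}"]) (auto simp: bottom_rows_def)

lemma coprime_gcd_add_mult:
  fixes c d i j N :: nat
  shows "coprime (gcd (c + N * i) (d + N * j)) N \<longleftrightarrow> coprime (gcd c d) N"
proof -
  have split: "gcd (gcd x y) N = gcd (gcd x N) (gcd y N)" for x y
    by (metis gcd.assoc gcd.left_commute gcd.right_idem)
  have red: "gcd (x + N * k) N = gcd x N" for x k
    using gcd_add_mult[of N k x] by (simp add: gcd.commute add.commute mult.commute)
  have "gcd (gcd (c + N * i) (d + N * j)) N = gcd (gcd c N) (gcd d N)"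
    unfolding split[of "c + N * i"] by (simp only: red)
  also have "\<dots> = gcd (gcd c d) N" by (rule split[symmetric])
  finally show ?thesis unfolding coprime_iff_gcd_eq_1 by simp
qed

text \<open>Division with remainder by \<open>N\<close>: the coprimality condition depends only on
  the remainders, and so do the parities because \<open>N\<close> is even. Hence every row has
  \<open>p ^ 2\<close> lifts.\<close>

lemma card_bottom_rows_mult:
  assumes "even N" "N > 0"
  shows "card (bottom_rows (p * N) N) = p ^ 2 * card (bottom_rows N N)"
proof -
  let ?f = "\<lambda>((c, d), (i, j)). (c + N * i, d + N * j)"
  let ?g = "\<lambda>(c, d). ((c mod N, d mod N), (c div N, d div N))"
  have lt: "c + N * i < p * N" if "c < N" "i < p" for c i
  proof -
    have "c + N * i < N * Suc i" using that by simp
    also have "\<dots> \<le> N * p" using that by (intro mult_le_mono2) simp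
    finally show ?thesis by (simp add: mult.commute)
  qed
  have "bij_betw ?f (bottom_rows N N \<times> ({..<p} \<times> {..<p})) (bottom_rows (p * N) N)"
  proof (rule bij_betw_byWitness[where f' = ?g])
    show "?f ` (bottom_rows N N \<times> ({..<p} \<times> {..<p})) \<subseteq> bottom_rows (p * N) N"
      using assms lt by (auto simp: bottom_rows_def coprime_gcd_add_mult)
    show "?g ` bottom_rows (p * N) N \<subseteq> bottom_rows N N \<times> ({..<p} \<times> {..<p})"
    proof -
      have "coprime (gcd (c mod N) (d mod N)) N" if "coprime (gcd c d) N" for c d
        using that coprime_gcd_add_mult[of "c mod N" N "c div N" "d mod N" "d div N"] by simp
      moreover have "even (c mod N) \<longleftrightarrow> even c" for c
        using assms by (simp add: dvd_mod_iff)
      ultimately show ?thesis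
        using assms by (auto simp: bottom_rows_def less_mult_imp_div_less)
    qed
  qed (use assms in \<open>auto simp: bottom_rows_def\<close>)
  from bij_betw_same_card[OF this] show ?thesis
    by (simp add: card_cartesian_product power2_eq_square mult.commute)
qed

text \<open>If \<open>p\<close> divides \<open>N\<close>, coprimality to \<open>p * N\<close> is
  coprimality to \<open>N\<close> and all \<open>p ^ 2\<close> lifts qualify. Otherwise the lifts
  with both entries divisible by \<open>p\<close> drop out. As \<open>p\<close> is then odd and
  coprime to \<open>N\<close>, these are exactly the multiples by \<open>p\<close> of the rows for
  \<open>N\<close>, that is, one in \<open>p ^ 2\<close>.\<close>

lemma card_bottom_rows_prime:
  assumes "even N" "N > 0" "Factorial_Ring.prime p"
  shows "card (bottom_rows (p * N) (p * N)) =
    (if p dvd N then p ^ 2 else p ^ 2 - 1) * card (bottom_rows N N)"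
proof (cases "p dvd N")
  case True
  have "coprime x (p * N) \<longleftrightarrow> coprime x N" for x
    using coprime_divisors[OF dvd_refl True] by (auto simp: coprime_mult_right_iff)
  then have "bottom_rows (p * N) (p * N) = bottom_rows (p * N) N"
    by (simp add: bottom_rows_def)
  with True show ?thesis using card_bottom_rows_mult assms by simp
next
  case False
  have "odd p" using assms False primes_dvd_imp_eq two_is_prime_nat by blast
  have "p > 0" using assms prime_gt_0_nat by blast
  let ?B = "{(c, d) \<in> bottom_rows (p * N) N. p dvd c \<and> p dvd d}"
  have cop: "coprime x p \<longleftrightarrow> \<not> p dvd x" for x
    using assms(3)
    by (metis coprime_absorb_right coprime_commute not_prime_unit prime_imp_coprime)
  have "bottom_rows (p * N) (p * N) = bottom_rows (p * N) N - ?B"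
    by (auto simp: bottom_rows_def cop)
  moreover have "bij_betw (\<lambda>(c, d). (p * c, p * d)) (bottom_rows N N) ?B"
  proof (rule bij_betw_byWitness[where f' = "\<lambda>(c, d). (c div p, d div p)"])
    have "coprime p N" using False assms(3) by (simp add: prime_imp_coprime)
    then have cop': "coprime (gcd (p * c) (p * d)) N \<longleftrightarrow> coprime (gcd c d) N" for c d
      by (simp add: gcd_mult_distrib_nat[symmetric] coprime_mult_left_iff)
    show "(\<lambda>(c, d). (p * c, p * d)) ` bottom_rows N N \<subseteq> ?B"
      using \<open>odd p\<close> \<open>p > 0\<close> by (auto simp: bottom_rows_def cop')
    show "(\<lambda>(c, d). (c div p, d div p)) ` ?B \<subseteq> bottom_rows N N"
    proof (clarify, elim dvdE)
      fix c d c' d' assume "(c, d) \<in> bottom_rows (p * N) N" "c = p * c'" "d = p * d'"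
      then show "(c div p, d div p) \<in> bottom_rows N N"
        using \<open>odd p\<close> \<open>p > 0\<close> by (simp add: bottom_rows_def cop')
    qed
  qed (use \<open>p > 0\<close> in auto)
  then have "card ?B = card (bottom_rows N N)" by (simp add: bij_betw_same_card)
  moreover have "card (bottom_rows (p * N) N - ?B) = card (bottom_rows (p * N) N) - card ?B"
    by (intro card_Diff_subset) (auto intro: finite_subset[OF _ finite_bottom_rows])
  ultimately show ?thesis
    using False card_bottom_rows_mult[OF assms(1,2), of p] by (simp add: diff_mult_distrib)
qed

lemma card_bottom_rows_2: "card (bottom_rows 2 2) = 1"
proof -
  have "bottom_rows 2 2 = {(0, 1)}" by (auto simp: bottom_rows_def less_2_cases_iff)
  then show ?thesis by simp
qed

text \<open>Induction over the prime factors of \<open>N div 2\<close>. The factor 3 on the left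
  comes from the start \<open>N = 2\<close>: there is one row, while the right-hand side is 4 times
  3/4.\<close>

theorem card_bottom_rows:
  assumes "even N" "N > 0"
  shows "3 * real (card (bottom_rows N N)) =
    real N ^ 2 * (\<Prod>p\<in>prime_factors N. 1 - 1 / real p ^ 2)"
proof -
  have "M > 0 \<longrightarrow> 3 * real (card (bottom_rows (2 * M) (2 * M))) =
    real (2 * M) ^ 2 * (\<Prod>p\<in>prime_factors (2 * M). 1 - 1 / real p ^ 2)" for M :: nat
  proof (induction M rule: prime_divisors_induct)
    case (unit M)
    then show ?case
      by (simp add: card_bottom_rows_2 prime_factorization_prime)
  next
    case (factor p M)
    show ?case
    proof
      assume "0 < p * M"
      then have "M > 0" by simp
      let ?P = "\<lambda>N. \<Prod>p\<in>prime_factors N. 1 - 1 / real p ^ 2"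
      note IH = factor.IH[rule_format, OF \<open>M > 0\<close>]
      have "p > 1" using factor.hyps prime_gt_1_nat by blast
      have pf: "prime_factors (p * (2 * M)) = insert p (prime_factors (2 * M))"
        using factor.hyps \<open>M > 0\<close> by (subst prime_factors_product) (auto simp: prime_prime_factors)
      have e: "2 * (p * M) = p * (2 * M)" by simp
      show "3 * real (card (bottom_rows (2 * (p * M)) (2 * (p * M)))) =
        real (2 * (p * M)) ^ 2 * ?P (2 * (p * M))"
      proof (cases "p dvd 2 * M")
        case True
        then have "p \<in> prime_factors (2 * M)"
          using factor.hyps \<open>M > 0\<close> by (simp add: prime_factors_dvd)
        then have "?P (p * (2 * M)) = ?P (2 * M)" using pf by (simp add: insert_absorb)
        moreover have "3 * real (card (bottom_rows (p * (2 * M)) (p * (2 * M)))) =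
            real p ^ 2 * (3 * real (card (bottom_rows (2 * M) (2 * M))))"
          using card_bottom_rows_prime[of "2 * M" p] factor.hyps \<open>M > 0\<close> True by simp
        ultimately show ?thesis using IH unfolding e by (simp add: power_mult_distrib)
      next
        case False
        then have "p \<notin> prime_factors (2 * M)" by auto
        then have P: "?P (p * (2 * M)) = (1 - 1 / real p ^ 2) * ?P (2 * M)" using pf by simp
        have "real (p ^ 2 - 1) = real p ^ 2 - 1"
          using \<open>p > 1\<close> by (simp add: of_nat_diff)
        then have "3 * real (card (bottom_rows (p * (2 * M)) (p * (2 * M)))) =
            (real p ^ 2 - 1) * (3 * real (card (bottom_rows (2 * M) (2 * M))))"
          using card_bottom_rows_prime[of "2 * M" p] factor.hyps \<open>M > 0\<close> False by simp
        also have "\<dots> = real p ^ 2 * (1 - 1 / real p ^ 2) * (real (2 * M) ^ 2 * ?P (2 * M))"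
          using \<open>p > 1\<close> IH by (simp add: right_diff_distrib)
        finally show ?thesis unfolding e P by (simp add: power_mult_distrib)
      qed
    qed
  qed simp
  from this[of "N div 2"] show ?thesis using assms by (auto elim!: evenE)
qed

text \<open>Adding to \<open>c\<close> the multiple of \<open>N\<close> by all primes that divide \<open>d\<close> but not \<open>c\<close>.\<close>

lemma ex_coprime_add_mult:
  fixes c d N :: int
  assumes "d \<noteq> 0" "coprime (gcd c d) N"
  shows "\<exists>t. coprime (c + t * N) d"
proof -
  define t where "t = \<Prod>{p \<in> prime_factors d. \<not> p dvd c}"
  have fin: "finite {p \<in> prime_factors d. \<not> p dvd c}" by simp
  have "coprime (c + t * N) d"
  proof (rule ccontr)
    assume "\<not> coprime (c + t * N) d"
    then have "gcd (c + t * N) d \<noteq> 1" unfolding coprime_iff_gcd_eq_1 .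
    then obtain p where p: "Factorial_Ring.prime p" "p dvd gcd (c + t * N) d"
      using assms(1) prime_factor_int[of "gcd (c + t * N) d"] by auto
    then have pd: "p \<in> prime_factors d" using assms(1) by (auto simp: prime_factors_dvd)
    show False
    proof (cases "p dvd c")
      case True
      then have "p dvd t * N" using p by (simp add: dvd_add_right_iff)
      moreover have "\<not> p dvd N"
      proof
        assume "p dvd N"
        with True p have "p dvd gcd (gcd c d) N" by simp
        then have "is_unit p" using assms(2) coprime_iff_gcd_eq_1 by metis
        then show False using p not_prime_unit by blast
      qed
      ultimately have "p dvd t" using p prime_dvd_mult_iff by blast
      then obtain q where "q \<in> prime_factors d" "\<not> q dvd c" "p dvd q"
        using prime_dvd_prod_iff[OF fin p(1), of "\<lambda>x. x"] unfolding t_def by auto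
      then have "p = q" using p primes_dvd_imp_eq in_prime_factors_imp_prime by blast
      with True \<open>\<not> q dvd c\<close> show False by simp
    next
      case False
      then have "p dvd t" unfolding t_def using pd fin by (intro dvd_prodI[of _ _ "\<lambda>x. x", simplified]) auto
      then have "p dvd c" using p by (simp add: dvd_add_left_iff)
      with False show False by simp
    qed
  qed
  then show ?thesis by blast
qed

text \<open>Once \<open>c\<close> is changed modulo \<open>N\<close> to be coprime to
  \<open>d\<close>, Bezout supplies a top row, which is determined only up to multiples of the
  bottom row.\<close>

lemma ex_Gamma2_bottom_row:
  fixes c d N :: int
  assumes "even c" "odd d" "even N" "coprime (gcd c d) N"
  shows "\<exists>a b c' d'. (a, b, c', d') \<in> Gamma2 \<and> [c' = c] (mod N) \<and> [d' = d] (mod N)"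
proof -
  have "d \<noteq> 0" using assms by auto
  then obtain t where t: "coprime (c + t * N) d" using ex_coprime_add_mult assms by blast
  define c' where "c' = c + t * N"
  obtain x y where xy: "x * c' + y * d = 1"
    using t bezout_int[of c' d] unfolding c'_def coprime_iff_gcd_eq_1 by auto
  \<comment> \<open>Adding the bottom row once changes the parity of the top right entry because
    \<open>d\<close> is odd. The top left entry is then odd by the determinant.\<close>
  define e where "e = (if even x then 0 else 1 :: int)"
  have "(y + e * c') * d - (e * d - x) * c' = 1" using xy by (simp add: algebra_simps)
  moreover have c': "even c'" using assms by (simp add: c'_def)
  moreover have b: "even (e * d - x)" using assms by (simp add: e_def)
  moreover have "odd (y + e * c')"
  proof -
    have "(y + e * c') * d = 1 + (e * d - x) * c'" using calculation(1) by simp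
    then have "odd ((y + e * c') * d)" using c' by simp
    then show ?thesis by simp
  qed
  ultimately have "(y + e * c', e * d - x, c', d) \<in> Gamma2"
    using assms(2) by (simp add: Gamma2_def)
  moreover have "[c' = c] (mod N)" by (simp add: c'_def cong_iff_dvd_diff)
  ultimately show ?thesis using cong_refl by blast
qed

section \<open>Finite index subgroups\<close>

context group begin

lemma rcos_eq_iff:
  assumes "subgroup H G" "x \<in> carrier G" "y \<in> carrier G"
  shows "H #> x = H #> y \<longleftrightarrow> x \<otimes> inv y \<in> H"
proof
  assume "H #> x = H #> y"
  then have "x \<in> H #> y" using assms rcos_self by blast
  then obtain h where "h \<in> H" "x = h \<otimes> y" by (auto simp: r_coset_def)
  moreover from this have "h \<in> carrier G" using subgroup.mem_carrier[OF assms(1)] by simp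
  ultimately show "x \<otimes> inv y \<in> H" using assms by (simp add: m_assoc)
next
  assume h: "x \<otimes> inv y \<in> H"
  have "x = (x \<otimes> inv y) \<otimes> y" using assms by (simp add: m_assoc)
  then have "x \<in> H #> y" using h unfolding r_coset_def by blast
  then show "H #> x = H #> y" using repr_independence assms by blast
qed

text \<open>The index set is arbitrary, so that representatives can be carried from one group to
  another, and the cosets of subgroups of different groups can be compared through their
  indices.\<close>

definition transversal :: "'a set \<Rightarrow> 'i set \<Rightarrow> ('i \<Rightarrow> 'a) \<Rightarrow> bool" where
  "transversal H I r \<longleftrightarrow> r ` I \<subseteq> carrier G \<and> (\<forall>x\<in>carrier G. \<exists>!i. i \<in> I \<and> x \<otimes> inv (r i) \<in> H)"

lemma transversal_bij:
  assumes H: "subgroup H G" and t: "transversal H I r"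
  shows "bij_betw (\<lambda>i. H #> r i) I (rcosets H)"
proof -
  have rc: "r i \<in> carrier G" if "i \<in> I" for i using t that by (auto simp: transversal_def)
  have "inj_on (\<lambda>i. H #> r i) I"
  proof (rule inj_onI)
    fix i j assume ij: "i \<in> I" "j \<in> I" "H #> r i = H #> r j"
    then have "r i \<otimes> inv (r j) \<in> H" using rcos_eq_iff[OF H] rc by blast
    moreover have "r i \<otimes> inv (r i) \<in> H" using rc ij subgroup.one_closed[OF H] by simp
    ultimately show "i = j" using t ij rc unfolding transversal_def by blast
  qed
  moreover have "(\<lambda>i. H #> r i) ` I = rcosets H"
  proof (intro equalityI subsetI)
    fix Z assume "Z \<in> rcosets H"
    then obtain x where x: "x \<in> carrier G" "Z = H #> x" by (auto simp: RCOSETS_def)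
    then obtain i where "i \<in> I" "x \<otimes> inv (r i) \<in> H" using t unfolding transversal_def by blast
    then show "Z \<in> (\<lambda>i. H #> r i) ` I" using rcos_eq_iff[OF H] x rc by blast
  qed (use rc in \<open>auto simp: RCOSETS_def\<close>)
  ultimately show ?thesis by (simp add: bij_betw_def)
qed

lemma transversal_rcosets:
  assumes H: "subgroup H G"
  shows "transversal H (rcosets H) (\<lambda>Z. SOME x. x \<in> carrier G \<and> Z = H #> x)"
proof -
  let ?r = "\<lambda>Z. SOME x. x \<in> carrier G \<and> Z = H #> x"
  have r: "?r Z \<in> carrier G \<and> Z = H #> ?r Z" if "Z \<in> rcosets H" for Z
  proof -
    have "\<exists>x. x \<in> carrier G \<and> Z = H #> x" using that by (auto simp: RCOSETS_def)
    then show ?thesis by (rule someI_ex)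
  qed
  have "\<exists>!Z. Z \<in> rcosets H \<and> x \<otimes> inv (?r Z) \<in> H" if x: "x \<in> carrier G" for x
  proof (rule ex1I[of _ "H #> x"])
    have Z: "H #> x \<in> rcosets H" using x by (auto simp: RCOSETS_def)
    then show "H #> x \<in> rcosets H \<and> x \<otimes> inv (?r (H #> x)) \<in> H"
      using r[OF Z] rcos_eq_iff[OF H x] by blast
    show "Z = H #> x" if "Z \<in> rcosets H \<and> x \<otimes> inv (?r Z) \<in> H" for Z
      using that r[of Z] rcos_eq_iff[OF H x] by auto
  qed
  then show ?thesis using r by (auto simp: transversal_def)
qed

text \<open>A bijection, and not merely an equation between cardinalities, because finiteness of one
  index set will be deduced from that of the other.\<close>

lemma transversal_card_eq:
  assumes "subgroup H G" "transversal H I r" "transversal H J s"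
  shows "\<exists>f. bij_betw f I J"
  using transversal_bij[OF assms(1,2)] transversal_bij[OF assms(1,3)]
    bij_betw_trans[OF _ bij_betw_inv_into] by blast

end

text \<open>The letters act on the right cosets of \<open>H\<close> by right multiplication with
  their values. A word fixes the coset \<open>H\<close> exactly if its value lies in
  \<open>H\<close>, so the stabilizer is carried onto \<open>H\<close> by the evaluation
  isomorphism, and \<open>stabilizer_free\<close> applies.\<close>

lemma (in group) finite_index_free:
  assumes e: "word_val G s \<in> iso (free_group k) G" and s: "\<And>i. i < k \<Longrightarrow> s i \<in> carrier G"
    and H: "subgroup H G" and fin: "finite (rcosets H)"
  shows "\<exists>n. n + card (rcosets H) = card (rcosets H) * k + 1 \<and> free_group n \<cong> G\<lparr>carrier := H\<rparr>"
proof -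
  let ?act = "\<lambda>a Z. Z #> letter_val G s a"
  have lc: "letter_val G s a \<in> carrier G" if "snd a < k" for a
    using letter_val_closed[of k s a] that s by blast
  have HG: "H \<subseteq> carrier G" using H subgroup.subset by blast
  have act: "?act a (H #> x) = H #> (x \<otimes> letter_val G s a)" if "x \<in> carrier G" "snd a < k" for a x
    using that lc HG coset_mult_assoc by blast
  have run: "foldl (\<lambda>Z a. ?act a Z) (H #> x) w = H #> (x \<otimes> word_val G s w)"
    if "x \<in> carrier G" "set w \<subseteq> UNIV \<times> {..<k}" for x w
    using that
  proof (induction w arbitrary: x)
    case (Cons a w)
    then have "snd a < k" "set w \<subseteq> UNIV \<times> {..<k}" by auto
    with Cons show ?case
      using word_val_closed[of k s w] s lc by (simp add: act m_assoc)
  qed simp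
  have H1: "H #> \<one> = H" using HG by (rule coset_mult_one)
  have runH: "foldl (\<lambda>Z a. ?act a Z) H w = H #> word_val G s w" if "set w \<subseteq> UNIV \<times> {..<k}" for w
    using run[of \<one> w] that word_val_closed[of k s w] s H1 by simp
  interpret W: word_action "rcosets H" k ?act H
  proof
    show "H \<in> rcosets H" using H1 unfolding RCOSETS_def by force
    show "?act a Z \<in> rcosets H" if a: "snd a < k" and Z: "Z \<in> rcosets H" for a Z
    proof -
      obtain x where x: "x \<in> carrier G" "Z = H #> x" using Z by (auto simp: RCOSETS_def)
      have "x \<otimes> letter_val G s a \<in> carrier G" using x lc a by blast
      then show ?thesis using act[OF x(1) a] x(2) unfolding RCOSETS_def by blast
    qed
    show "?act (inv_letter a) (?act a Z) = Z" if a: "snd a < k" and Z: "Z \<in> rcosets H" for a Z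
    proof -
      obtain x where x: "x \<in> carrier G" "Z = H #> x" using Z by (auto simp: RCOSETS_def)
      have "letter_val G s (inv_letter a) = inv (letter_val G s a)"
        using letter_val_inv[of k s a] s a by blast
      then show ?thesis using x a lc[OF a] act[OF x(1) a] act[of "x \<otimes> letter_val G s a" "inv_letter a"]
        by (simp add: m_assoc)
    qed
    show "\<exists>w. set w \<subseteq> UNIV \<times> {..<k} \<and> foldl (\<lambda>Z a. ?act a Z) H w = Z" if Z: "Z \<in> rcosets H" for Z
    proof -
      obtain x where x: "x \<in> carrier G" "Z = H #> x" using Z by (auto simp: RCOSETS_def)
      then obtain w where "w \<in> carrier (free_group k)" "x = word_val G s w"
        using e by (auto simp: iso_def bij_betw_def)
      then show ?thesis using x runH by (auto simp: carrier_free_group intro!: exI[of _ w])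
    qed
  qed (rule fin)
  have stab: "w \<in> W.stabilizer \<longleftrightarrow> w \<in> carrier (free_group k) \<and> word_val G s w \<in> H" for w
  proof -
    have "H #> x = H \<longleftrightarrow> x \<in> H" if "x \<in> carrier G" for x
      using that rcos_eq_iff[OF H that one_closed] H1 by simp
    moreover have "word_val G s w \<in> carrier G" "foldl (\<lambda>Z a. ?act a Z) H w = H #> word_val G s w"
      if "w \<in> carrier (free_group k)"
      using that runH[of w] word_val_closed[of k s w] s by (auto simp: carrier_free_group)
    ultimately show ?thesis
      unfolding W.stabilizer_def W.run_def by auto
  qed
  have bij: "bij_betw (word_val G s) W.stabilizer H"
  proof -
    have b: "bij_betw (word_val G s) (carrier (free_group k)) (carrier G)" using e by (simp add: iso_def)
    have "word_val G s ` W.stabilizer = H"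
    proof (intro equalityI subsetI)
      fix x assume x: "x \<in> H"
      then obtain w where "w \<in> carrier (free_group k)" "x = word_val G s w"
        using b HG by (auto simp: bij_betw_def)
      with x show "x \<in> word_val G s ` W.stabilizer" using stab by blast
    qed (use stab in auto)
    moreover have "inj_on (word_val G s) W.stabilizer"
      using b stab by (auto simp: bij_betw_def intro: inj_on_subset)
    ultimately show ?thesis by (simp add: bij_betw_def)
  qed
  have "word_val G s \<in> iso (free_group k\<lparr>carrier := W.stabilizer\<rparr>) (G\<lparr>carrier := H\<rparr>)"
    using e bij stab by (auto simp: iso_def hom_def)
  then have "free_group W.rank \<cong> G\<lparr>carrier := H\<rparr>"
    using W.stabilizer_free iso_set_trans unfolding is_iso_def by blast
  with W.rank_eq show ?thesis by blast
qed

section \<open>The congruence subgroups\<close>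

definition Gamma :: "int \<Rightarrow> int mat2 set" where
  "Gamma N = {(a, b, c, d). a * d - b * c = 1 \<and> N dvd a - 1 \<and> N dvd b \<and> N dvd c \<and> N dvd d - 1 \<and>
     2 * N dvd b - c}"

lemma two_mult_dvd:
  fixes N x y :: int
  assumes "even N" "N dvd x" "N dvd y"
  shows "2 * N dvd x * y"
  using mult_dvd_mono[of 2 x N y] assms dvd_trans by blast

text \<open>Modulo \<open>2 * N\<close> the difference of the off-diagonal entries is additive on
  products: every correction term is a product of two multiples of \<open>N\<close>, and for even
  \<open>N\<close> such a product is a multiple of \<open>2 * N\<close>.\<close>

lemma subgroup_Gamma:
  assumes N: "even N"
  shows "subgroup (Gamma N) SL2"
proof (rule group.subgroupI[OF group_SL2])
  show "Gamma N \<subseteq> carrier SL2" by (auto simp: Gamma_def carrier_SL2)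
  have "(1, 0, 0, 1) \<in> Gamma N" by (simp add: Gamma_def)
  then show "Gamma N \<noteq> {}" by blast
next
  fix x assume "x \<in> Gamma N"
  then show "inv\<^bsub>SL2\<^esub> x \<in> Gamma N"
    by (cases x rule: prod_cases4)
      (simp add: Gamma_def inv_SL2 carrier_SL2 algebra_simps dvd_diff_commute)
next
  fix x y assume xy: "x \<in> Gamma N" "y \<in> Gamma N"
  obtain a b c d where x: "x = (a, b, c, d)" by (cases x rule: prod_cases4)
  obtain a' b' c' d' where y: "y = (a', b', c', d')" by (cases y rule: prod_cases4)
  have dx: "N dvd a - 1" "N dvd b" "N dvd c" "N dvd d - 1" "2 * N dvd b - c"
    and dy: "N dvd a' - 1" "N dvd b'" "N dvd c'" "N dvd d' - 1" "2 * N dvd b' - c'"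
    using xy by (auto simp: x y Gamma_def)
  have e: "a * a' + b * c' - 1 = (a - 1) * a' + (a' - 1) + b * c'"
    "c * b' + d * d' - 1 = (d - 1) * d' + (d' - 1) + c * b'"
    by (simp_all add: algebra_simps)
  have "N dvd a * a' + b * c' - 1" "N dvd c * b' + d * d' - 1"
    "N dvd a * b' + b * d'" "N dvd c * a' + d * c'"
    unfolding e by (intro dvd_add dvd_mult dvd_mult2 dx dy)+
  moreover have "a * b' + b * d' - (c * a' + d * c') = (b - c) + (b' - c') +
      ((a - 1) * b' - (d - 1) * c' + b * (d' - 1) - c * (a' - 1))"
    by (simp add: algebra_simps)
  moreover have "2 * N dvd (b - c) + (b' - c') +
      ((a - 1) * b' - (d - 1) * c' + b * (d' - 1) - c * (a' - 1))"
  proof -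
    have "2 * N dvd (a - 1) * b'" "2 * N dvd (d - 1) * c'" "2 * N dvd b * (d' - 1)" "2 * N dvd c * (a' - 1)"
      using dx dy N two_mult_dvd by blast+
    then have "2 * N dvd (a - 1) * b' - (d - 1) * c' + b * (d' - 1) - c * (a' - 1)"
      by (metis dvd_add dvd_diff)
    then show ?thesis by (rule dvd_add[OF dvd_add[OF dx(5) dy(5)]])
  qed
  ultimately have "2 * N dvd a * b' + b * d' - (c * a' + d * c')" by simp
  moreover have "x \<otimes>\<^bsub>SL2\<^esub> y \<in> carrier SL2"
    using xy by (intro mult_SL2_closed) (auto simp: Gamma_def carrier_SL2)
  ultimately show "x \<otimes>\<^bsub>SL2\<^esub> y \<in> Gamma N"
    using \<open>N dvd a * a' + b * c' - 1\<close> \<open>N dvd c * b' + d * d' - 1\<close> \<open>N dvd a * b' + b * d'\<close>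
      \<open>N dvd c * a' + d * c'\<close>
    by (simp add: x y Gamma_def carrier_SL2 mult_SL2)
qed

lemma Gamma_subset:
  assumes "even N"
  shows "Gamma N \<subseteq> Gamma2"
proof
  fix x assume x: "x \<in> Gamma N"
  obtain a b c d where abcd: "x = (a, b, c, d)" by (cases x rule: prod_cases4)
  have h: "N dvd a - 1" "N dvd b" "N dvd c" "N dvd d - 1" using x by (auto simp: abcd Gamma_def)
  have "2 dvd a - 1" "2 dvd b" "2 dvd c" "2 dvd d - 1"
    using h[THEN dvd_trans[OF assms]] .
  then show "x \<in> Gamma2" using x by (auto simp: abcd Gamma_def Gamma2_def)
qed

section \<open>Bottom rows modulo \<open>N\<close> as coset invariants\<close>

definition same_bottom :: "int \<Rightarrow> int mat2 \<Rightarrow> int mat2 \<Rightarrow> bool" where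
  "same_bottom N = (\<lambda>(a, b, c, d) (a', b', c', d'). [c = c'] (mod N) \<and> [d = d'] (mod N))"

lemma same_bottom_mult:
  assumes "same_bottom N x \<one>\<^bsub>SL2\<^esub>"
  shows "same_bottom N (x \<otimes>\<^bsub>SL2\<^esub> y) y"
proof -
  obtain a b c d where x: "x = (a, b, c, d)" by (cases x rule: prod_cases4)
  obtain a' b' c' d' where y: "y = (a', b', c', d')" by (cases y rule: prod_cases4)
  have cd: "N dvd c" "N dvd d - 1" using assms
    by (simp_all add: x same_bottom_def one_SL2 cong_iff_dvd_diff)
  have "c * a' + d * c' - c' = c * a' + (d - 1) * c'" "c * b' + d * d' - d' = c * b' + (d - 1) * d'"
    by (simp_all add: algebra_simps)
  then have "[c * a' + d * c' = c'] (mod N)" "[c * b' + d * d' = d'] (mod N)"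
    unfolding cong_iff_dvd_diff using cd by (simp_all only: dvd_add dvd_mult2)
  then show ?thesis by (simp add: x y same_bottom_def mult_SL2)
qed

lemma same_bottom_quotient:
  assumes "same_bottom N x y" "x \<in> carrier SL2" "y \<in> carrier SL2"
  shows "same_bottom N (x \<otimes>\<^bsub>SL2\<^esub> inv\<^bsub>SL2\<^esub> y) \<one>\<^bsub>SL2\<^esub>"
proof -
  obtain a b c d where x: "x = (a, b, c, d)" by (cases x rule: prod_cases4)
  obtain a' b' c' d' where y: "y = (a', b', c', d')" by (cases y rule: prod_cases4)
  have cd: "N dvd c - c'" "N dvd d - d'"
    using assms by (auto simp: x y same_bottom_def cong_iff_dvd_diff)
  have det: "a' * d' - b' * c' = 1" using assms(3) by (simp add: y carrier_SL2)
  have "c * d' - d * c' - 0 = (c - c') * d' - (d - d') * c'"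
    "d * a' - c * b' - 1 = (d - d') * a' - (c - c') * b'"
    unfolding det[symmetric] by (simp_all add: algebra_simps)
  then have "[c * d' - d * c' = 0] (mod N)" "[d * a' - c * b' = 1] (mod N)"
    unfolding cong_iff_dvd_diff using cd by (simp_all only: dvd_diff dvd_mult2)
  then show ?thesis using assms(3) by (simp add: x y same_bottom_def mult_SL2 inv_SL2 one_SL2 algebra_simps)
qed

lemma same_bottom_Gamma: "x \<in> Gamma N \<Longrightarrow> same_bottom N x \<one>\<^bsub>SL2\<^esub>"
  by (cases x rule: prod_cases4) (simp add: Gamma_def same_bottom_def one_SL2 cong_iff_dvd_diff)

definition shear :: "int \<Rightarrow> int mat2" where
  "shear s = (1, 2 * s, 0, 1)"

lemma shear_Gamma2: "shear s \<in> Gamma2"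
  by (simp add: shear_def Gamma2_def)

text \<open>With bottom row \<open>(0, 1)\<close> modulo \<open>N\<close>, the determinant forces
  \<open>a\<close> to be 1 modulo \<open>N\<close>. All that remains is the residue of
  \<open>(b - c) / 2\<close> modulo \<open>N\<close>, and dividing by \<open>shear s\<close> lowers
  it by \<open>s\<close>.\<close>

lemma shear_quotient:
  assumes "even N" "N > 0" "x \<in> Gamma2" "same_bottom N x \<one>\<^bsub>SL2\<^esub>"
  shows "\<exists>!s. s \<in> {0..<N} \<and> x \<otimes>\<^bsub>SL2\<^esub> inv\<^bsub>SL2\<^esub> (shear s) \<in> Gamma N"
proof -
  obtain a b c d where x: "x = (a, b, c, d)" by (cases x rule: prod_cases4)
  have N: "N dvd c" "N dvd d - 1"
    using assms(4) by (auto simp: x same_bottom_def one_SL2 cong_iff_dvd_diff)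
  have det: "a * d - b * c = 1" and par: "even b" "even c" using assms(3) by (auto simp: x Gamma2_def)
  have "a - 1 = b * c - a * (d - 1)" using det by (simp add: algebra_simps)
  then have a: "N dvd a - 1" using N by simp
  have "2 dvd b - c" using par by simp
  then obtain e where "b - c = 2 * e" by (rule dvdE)
  then have e: "b = c + 2 * e" by simp
  have iff: "x \<otimes>\<^bsub>SL2\<^esub> inv\<^bsub>SL2\<^esub> (shear s) \<in> Gamma N \<longleftrightarrow> [s = e] (mod N)" for s
  proof -
    have y: "x \<otimes>\<^bsub>SL2\<^esub> inv\<^bsub>SL2\<^esub> (shear s) = (a, b - 2 * s * a, c, d - 2 * s * c)"
      by (simp add: shear_def x inv_SL2 carrier_SL2 mult_SL2)
    have split: "b - 2 * s * a - c = 2 * (e - s - s * (a - 1))"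
      unfolding e by (simp add: algebra_simps)
    have "2 * N dvd b - 2 * s * a - c \<longleftrightarrow> N dvd (e - s) - s * (a - 1)"
      unfolding split by (rule dvd_times_left_cancel_iff) simp
    also have "\<dots> \<longleftrightarrow> N dvd e - s"
      using a dvd_diff_left_iff[of N "s * (a - 1)" "e - s"] by (simp only: dvd_mult)
    also have "\<dots> \<longleftrightarrow> [s = e] (mod N)"
      by (simp add: cong_iff_dvd_diff dvd_diff_commute)
    finally have 1: "2 * N dvd b - 2 * s * a - c \<longleftrightarrow> [s = e] (mod N)" .
    have 2: "N dvd b - 2 * s * a" if "2 * N dvd b - 2 * s * a - c"
    proof -
      have "N dvd b - 2 * s * a - c" using that by (rule dvd_trans[rotated]) simp
      from dvd_add[OF this N(1)] show ?thesis by simp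
    qed
    have "N dvd (d - 1) - 2 * s * c" by (intro dvd_diff dvd_mult N)
    then have 3: "N dvd d - 2 * s * c - 1" by (simp add: algebra_simps)
    have "a * (d - 2 * s * c) - (b - 2 * s * a) * c = 1" using det by (simp add: algebra_simps)
    with 1 2 3 a N show ?thesis unfolding y Gamma_def by auto
  qed
  have "[s = e] (mod N) \<and> s \<in> {0..<N} \<longleftrightarrow> s = e mod N" for s
    using assms(2) by (auto simp: cong_def)
  then show ?thesis unfolding iff by (metis (no_types, lifting))
qed

context fixes N :: nat
  assumes even_N: "even N" and N_pos: "N > 0"
begin

abbreviation G2 :: "int mat2 monoid" where "G2 \<equiv> SL2\<lparr>carrier := Gamma2\<rparr>"

lemma group_G2: "group G2"
  using subgroup.subgroup_is_group[OF subgroup_Gamma2 group_SL2] .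

lemma inv_G2: "x \<in> Gamma2 \<Longrightarrow> inv\<^bsub>G2\<^esub> x = inv\<^bsub>SL2\<^esub> x"
  using group.m_inv_consistent[OF group_SL2 subgroup_Gamma2] .

lemma Gamma2_carrier: "x \<in> Gamma2 \<Longrightarrow> x \<in> carrier SL2"
  using subgroup.subset[OF subgroup_Gamma2] by blast

lemma subgroup_Gamma_G2: "subgroup (Gamma N) G2"
  using group.subgroup_incl[OF group_SL2 subgroup_Gamma subgroup_Gamma2 Gamma_subset] even_N by simp

text \<open>The top row \<open>0, 0\<close> is a mere placeholder, since \<open>same_bottom\<close>
  looks only at bottom rows.\<close>

definition with_bottom :: "nat \<times> nat \<Rightarrow> int mat2" where
  "with_bottom p = (SOME m. m \<in> Gamma2 \<and> same_bottom N m (0, 0, int (fst p), int (snd p)))"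

lemma with_bottom:
  assumes "p \<in> bottom_rows N N"
  shows "with_bottom p \<in> Gamma2" "same_bottom N (with_bottom p) (0, 0, int (fst p), int (snd p))"
proof -
  obtain c d where p: "p = (c, d)" by (cases p)
  have "coprime (int (gcd c d)) (int N)" using assms unfolding p bottom_rows_def coprime_int_iff by simp
  then have "\<exists>m. m \<in> Gamma2 \<and> same_bottom N m (0, 0, int (fst p), int (snd p))"
    using ex_Gamma2_bottom_row[of "int c" "int d" "int N"] assms even_N
    by (auto simp: p bottom_rows_def same_bottom_def)
  from someI_ex[OF this]
  show "with_bottom p \<in> Gamma2" "same_bottom N (with_bottom p) (0, 0, int (fst p), int (snd p))"
    by (simp_all add: with_bottom_def)
qed

lemma same_bottom_sym: "same_bottom k x y \<Longrightarrow> same_bottom k y x"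
  by (auto simp: same_bottom_def cong_sym split: prod.splits)

lemma same_bottom_trans: "same_bottom k x y \<Longrightarrow> same_bottom k y z \<Longrightarrow> same_bottom k x z"
  by (auto simp: same_bottom_def split: prod.splits intro: cong_trans)

lemma ex_bottom:
  assumes "x \<in> Gamma2"
  shows "\<exists>!p. p \<in> bottom_rows N N \<and> same_bottom N x (0, 0, int (fst p), int (snd p))"
proof -
  obtain a b c d where x: "x = (a, b, c, d)" by (cases x rule: prod_cases4)
  have det: "a * d - b * c = 1" and par: "even c" "odd d" using assms by (auto simp: x Gamma2_def)
  define p where "p = (nat (c mod int N), nat (d mod int N))"
  have nonneg: "0 \<le> k mod int N" for k using N_pos by simp
  then have nn: "int (nat (k mod int N)) = k mod int N" for k by simp
  have e: "even (nat (k mod int N)) \<longleftrightarrow> even k" for k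
    using even_N by (simp add: even_nat_iff[OF nonneg] dvd_mod_iff)
  have "coprime (gcd (c mod int N) (d mod int N)) (int N)"
  proof (rule coprimeI)
    fix k assume k: "k dvd gcd (c mod int N) (d mod int N)" "k dvd int N"
    then have "k dvd c" "k dvd d" by (simp_all add: dvd_mod_iff)
    then have "k dvd a * d - b * c" by simp
    then show "is_unit k" using det by simp
  qed
  then have "coprime (int (gcd (nat (c mod int N)) (nat (d mod int N)))) (int N)"
    by (simp add: nonneg gcd_int_int_eq[symmetric] del: gcd_int_int_eq)
  then have "coprime (gcd (nat (c mod int N)) (nat (d mod int N))) N"
    unfolding coprime_int_iff .
  then have "p \<in> bottom_rows N N"
    using par N_pos by (simp add: p_def bottom_rows_def e nat_less_iff)
  moreover have "same_bottom N x (0, 0, int (fst p), int (snd p))"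
    by (simp add: x p_def same_bottom_def nonneg)
  moreover have "q = p" if "q \<in> bottom_rows N N" "same_bottom N x (0, 0, int (fst q), int (snd q))" for q
  proof -
    obtain c' d' where q: "q = (c', d')" by (cases q)
    have "c' < N" "d' < N" using that by (auto simp: q bottom_rows_def)
    then have "int c' = c mod int N" "int d' = d mod int N"
      using that(2) by (auto simp: q x same_bottom_def cong_def)
    then have "c' = nat (c mod int N)" "d' = nat (d mod int N)" by (metis nat_int)+
    then show ?thesis by (simp add: q p_def)
  qed
  ultimately show ?thesis by blast
qed

lemma transversal_G2I:
  assumes r: "\<And>i. i \<in> I \<Longrightarrow> r i \<in> Gamma2"
    and uniq: "\<And>x. x \<in> Gamma2 \<Longrightarrow> \<exists>!i. i \<in> I \<and> x \<otimes>\<^bsub>SL2\<^esub> inv\<^bsub>SL2\<^esub> (r i) \<in> H"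
  shows "group.transversal G2 H I r"
proof -
  interpret G: group G2 by (rule group_G2)
  show ?thesis
    unfolding G.transversal_def
  proof (intro conjI ballI)
    show "r ` I \<subseteq> carrier G2" by (rule image_subsetI) (simp add: r)
    fix x assume x: "x \<in> carrier G2"
    have eq: "i \<in> I \<and> x \<otimes>\<^bsub>G2\<^esub> inv\<^bsub>G2\<^esub> (r i) \<in> H \<longleftrightarrow> i \<in> I \<and> x \<otimes>\<^bsub>SL2\<^esub> inv\<^bsub>SL2\<^esub> (r i) \<in> H" for i
      using inv_G2[OF r[of i]] by (cases "i \<in> I") simp_all
    have "x \<in> Gamma2" using x by simp
    from uniq[OF this] show "\<exists>!i. i \<in> I \<and> x \<otimes>\<^bsub>G2\<^esub> inv\<^bsub>G2\<^esub> (r i) \<in> H"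
      by (simp only: eq)
  qed
qed

text \<open>The bottom row modulo \<open>N\<close> singles out \<open>p\<close>. After division by
  \<open>with_bottom p\<close> the bottom row is \<open>(0, 1)\<close>, and then the shear parameter
  \<open>s\<close> distinguishes the cosets. So the index in \<open>Gamma2\<close> is
  \<open>N\<close> times the number of bottom rows.\<close>

lemma transversal_Gamma:
  "group.transversal G2 (Gamma N) ({0..<int N} \<times> bottom_rows N N)
     (\<lambda>(s, p). shear s \<otimes>\<^bsub>SL2\<^esub> with_bottom p)"
proof -
  interpret SL: group "SL2 :: int mat2 monoid" by (rule group_SL2)
  interpret G: group G2 by (rule group_G2)
  let ?r = "\<lambda>(s, p). shear s \<otimes>\<^bsub>SL2\<^esub> with_bottom p"
  have r: "?r i \<in> Gamma2" if i: "i \<in> {0..<int N} \<times> bottom_rows N N" for i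
  proof -
    obtain s p where "i = (s, p)" "p \<in> bottom_rows N N" using i by blast
    then show ?thesis
      using shear_Gamma2 with_bottom(1) subgroup.m_closed[OF subgroup_Gamma2] by simp
  qed
  have uniq: "\<exists>!i. i \<in> {0..<int N} \<times> bottom_rows N N \<and> x \<otimes>\<^bsub>SL2\<^esub> inv\<^bsub>SL2\<^esub> (?r i) \<in> Gamma N"
    if x: "x \<in> Gamma2" for x
  proof -
    have quot: "x \<otimes>\<^bsub>SL2\<^esub> inv\<^bsub>SL2\<^esub> (?r (s, p)) =
        (x \<otimes>\<^bsub>SL2\<^esub> inv\<^bsub>SL2\<^esub> (with_bottom p)) \<otimes>\<^bsub>SL2\<^esub> inv\<^bsub>SL2\<^esub> (shear s)"
      if "p \<in> bottom_rows N N" for s p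
      using x with_bottom(1)[OF that] shear_Gamma2 Gamma2_carrier
      by (simp add: SL.inv_mult_group SL.m_assoc)
    have quot_in: "x \<otimes>\<^bsub>SL2\<^esub> inv\<^bsub>SL2\<^esub> (with_bottom p) \<in> Gamma2" if "p \<in> bottom_rows N N" for p
      using x with_bottom(1)[OF that] subgroup.m_closed[OF subgroup_Gamma2]
        subgroup.m_inv_closed[OF subgroup_Gamma2] by blast
    obtain p where p: "p \<in> bottom_rows N N" "same_bottom N x (0, 0, int (fst p), int (snd p))"
      and p_uniq: "\<And>q. q \<in> bottom_rows N N \<Longrightarrow> same_bottom N x (0, 0, int (fst q), int (snd q)) \<Longrightarrow> q = p"
      using ex_bottom[OF x] by blast
    have "same_bottom N x (with_bottom p)"
      using p with_bottom(2) same_bottom_sym same_bottom_trans by blast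
    then have "same_bottom N (x \<otimes>\<^bsub>SL2\<^esub> inv\<^bsub>SL2\<^esub> (with_bottom p)) \<one>\<^bsub>SL2\<^esub>"
      using same_bottom_quotient x with_bottom(1)[OF p(1)] Gamma2_carrier by blast
    then obtain s where s: "s \<in> {0..<int N}" "x \<otimes>\<^bsub>SL2\<^esub> inv\<^bsub>SL2\<^esub> (?r (s, p)) \<in> Gamma N"
      and s_uniq: "\<And>t. t \<in> {0..<int N} \<Longrightarrow> x \<otimes>\<^bsub>SL2\<^esub> inv\<^bsub>SL2\<^esub> (?r (t, p)) \<in> Gamma N \<Longrightarrow> t = s"
      using shear_quotient[of "int N" "x \<otimes>\<^bsub>SL2\<^esub> inv\<^bsub>SL2\<^esub> (with_bottom p)"] quot_in[OF p(1)] even_N N_pos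
      unfolding quot[OF p(1)] by auto
    have q: "q = p" if "q \<in> bottom_rows N N" "x \<otimes>\<^bsub>SL2\<^esub> inv\<^bsub>SL2\<^esub> (?r (t, q)) \<in> Gamma N" for q t
    proof -
      have w: "with_bottom q \<in> carrier SL2" "shear t \<in> carrier SL2" "x \<in> carrier SL2"
        using with_bottom(1)[OF that(1)] shear_Gamma2 x Gamma2_carrier by auto
      have "x = (x \<otimes>\<^bsub>SL2\<^esub> inv\<^bsub>SL2\<^esub> (?r (t, q))) \<otimes>\<^bsub>SL2\<^esub> (shear t \<otimes>\<^bsub>SL2\<^esub> with_bottom q)"
        using w by (simp add: SL.m_assoc)
      then have "same_bottom N x (shear t \<otimes>\<^bsub>SL2\<^esub> with_bottom q)"
        using same_bottom_mult same_bottom_Gamma[OF that(2)] by metis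
      moreover have "same_bottom N (shear t \<otimes>\<^bsub>SL2\<^esub> with_bottom q) (with_bottom q)"
        by (intro same_bottom_mult) (simp add: shear_def same_bottom_def one_SL2)
      ultimately show ?thesis
        using p_uniq[OF that(1)] with_bottom(2)[OF that(1)] same_bottom_trans by blast
    qed
    show ?thesis
    proof (rule ex1I[of _ "(s, p)"])
      show "(s, p) \<in> {0..<int N} \<times> bottom_rows N N \<and> x \<otimes>\<^bsub>SL2\<^esub> inv\<^bsub>SL2\<^esub> (?r (s, p)) \<in> Gamma N"
        using s p(1) by simp
      fix i assume i: "i \<in> {0..<int N} \<times> bottom_rows N N \<and> x \<otimes>\<^bsub>SL2\<^esub> inv\<^bsub>SL2\<^esub> (?r i) \<in> Gamma N"
      obtain t u where tu: "i = (t, u)" by (cases i)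
      then have "u = p" using i q[of u t] by simp
      moreover from this have "t = s" using i tu s_uniq[of t] by simp
      ultimately show "i = (s, p)" using tu by simp
    qed
  qed
  show ?thesis
    using r uniq by (rule transversal_G2I)
qed

section \<open>From the level 2 subgroup to the Sanov subgroup\<close>

definition pos :: "int mat2 \<Rightarrow> int mat2" where
  "pos x = (if x \<in> sanov then x else neg_mat2 x)"

lemma pos_sanov: "x \<in> Gamma2 \<Longrightarrow> pos x \<in> sanov"
  using Gamma2_cases[of x] by (auto simp: pos_def)

text \<open>The sign, counted as positive on \<open>sanov\<close>, is multiplicative, because
  \<open>neg_mat2\<close> commutes with products and exactly one of a matrix and its negative lies
  in \<open>sanov\<close>.\<close>

lemma sanov_neg_iff:
  assumes "x \<in> Gamma2" "y \<in> Gamma2"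
  shows "x \<otimes>\<^bsub>SL2\<^esub> y \<in> sanov \<longleftrightarrow> (x \<in> sanov \<longleftrightarrow> y \<in> sanov)"
proof -
  have c: "x \<in> sanov \<Longrightarrow> y \<in> sanov \<Longrightarrow> x \<otimes>\<^bsub>SL2\<^esub> y \<in> sanov" for x y
    using subgroup.m_closed[OF subgroup_sanov] .
  have xy: "x \<otimes>\<^bsub>SL2\<^esub> y \<in> Gamma2" using assms subgroup.m_closed[OF subgroup_Gamma2] by blast
  show ?thesis
    using c[of x y] c[of "neg_mat2 x" "neg_mat2 y"] c[of "neg_mat2 x" y] c[of x "neg_mat2 y"]
      Gamma2_cases[OF assms(1)] Gamma2_cases[OF assms(2)] Gamma2_cases[OF xy]
    by (auto simp: neg_mat2_mult)
qed

lemma pos_mult: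
  "x \<in> Gamma2 \<Longrightarrow> y \<in> Gamma2 \<Longrightarrow> pos (x \<otimes>\<^bsub>SL2\<^esub> y) = pos x \<otimes>\<^bsub>SL2\<^esub> pos y"
  using sanov_neg_iff[of x y] by (auto simp: pos_def neg_mat2_mult)

text \<open>The image of \<open>Gamma N\<close> under \<open>pos\<close>, in other words its image
  modulo \<open>-1\<close> when the quotient of \<open>Gamma2\<close> by the sign is identified with
  \<open>sanov\<close>.\<close>

definition HN :: "int mat2 set" where
  "HN = {x \<in> sanov. x \<in> Gamma N \<or> neg_mat2 x \<in> Gamma N}"

abbreviation S2 :: "int mat2 monoid" where "S2 \<equiv> SL2\<lparr>carrier := sanov\<rparr>"

lemma group_S2: "group S2"
  using subgroup.subgroup_is_group[OF subgroup_sanov group_SL2] .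

lemma inv_S2: "x \<in> sanov \<Longrightarrow> inv\<^bsub>S2\<^esub> x = inv\<^bsub>SL2\<^esub> x"
  using group.m_inv_consistent[OF group_SL2 subgroup_sanov] .

lemma neg_inv: "x \<in> carrier SL2 \<Longrightarrow> inv\<^bsub>SL2\<^esub> (neg_mat2 x) = neg_mat2 (inv\<^bsub>SL2\<^esub> x)"
  by (cases x rule: prod_cases4) (simp add: inv_SL2 carrier_SL2)

lemma subgroup_HN: "subgroup HN S2"
proof (rule group.subgroupI[OF group_S2])
  note G = subgroup.m_closed[OF subgroup_Gamma, of "int N"]
  have N: "even (int N)" using even_N by simp
  show "HN \<noteq> {}"
    using subgroup.one_closed[OF subgroup_Gamma[OF N]] subgroup.one_closed[OF subgroup_sanov]
    unfolding HN_def by blast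
  show "inv\<^bsub>S2\<^esub> x \<in> HN" if "x \<in> HN" for x
  proof -
    have x: "x \<in> sanov" "x \<in> carrier SL2" "x \<in> Gamma N \<or> neg_mat2 x \<in> Gamma N"
      using that sanov_subset Gamma2_carrier unfolding HN_def by blast+
    show ?thesis
      using x subgroup.m_inv_closed[OF subgroup_Gamma[OF N], of x] neg_inv[OF x(2)]
        subgroup.m_inv_closed[OF subgroup_Gamma[OF N], of "neg_mat2 x"]
        subgroup.m_inv_closed[OF subgroup_sanov, of x]
      by (auto simp: HN_def inv_S2)
  qed
  show "x \<otimes>\<^bsub>S2\<^esub> y \<in> HN" if "x \<in> HN" "y \<in> HN" for x y
    using that G[of x y, OF N] G[of "neg_mat2 x" y, OF N] G[of x "neg_mat2 y", OF N]
      G[of "neg_mat2 x" "neg_mat2 y", OF N] subgroup.m_closed[OF subgroup_sanov, of x y]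
    by (auto simp: HN_def neg_mat2_mult)
qed (auto simp: HN_def)

lemma pos_Gamma: "x \<in> Gamma N \<Longrightarrow> pos x \<in> HN"
  using pos_sanov[of x] Gamma_subset[of "int N"] even_N by (cases "x \<in> sanov") (simp_all add: HN_def pos_def subset_iff del: split_paired_All)

lemma HN_Gamma2: "y \<in> Gamma2 \<Longrightarrow> pos y \<in> HN \<longleftrightarrow> y \<in> Gamma N \<or> neg_mat2 y \<in> Gamma N"
  using pos_sanov[of y] by (cases "y \<in> sanov") (auto simp: HN_def pos_def)

lemma pos_of_sanov: "x \<in> sanov \<Longrightarrow> pos x = x"
  by (simp add: pos_def)

lemma pos_neg: "x \<in> sanov \<Longrightarrow> pos (neg_mat2 x) = x"
  using Gamma2_cases[of x] sanov_subset by (auto simp: pos_def)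

text \<open>The conditions on the top left entries of \<open>y\<close> and of its negative add up to
  \<open>N dvd 2\<close>.\<close>

lemma Gamma_neg_disjoint:
  assumes "N > 2" "y \<in> Gamma N"
  shows "neg_mat2 y \<notin> Gamma N"
proof
  obtain a b c d where y: "y = (a, b, c, d)" by (cases y rule: prod_cases4)
  assume "neg_mat2 y \<in> Gamma N"
  then have "int N dvd a - 1" "int N dvd - a - 1" using assms(2) by (auto simp: y Gamma_def)
  then have "int N dvd (a - 1) + (- a - 1)" by (rule dvd_add)
  then have "int N dvd 2" by simp
  then show False using assms(1) zdvd_imp_le[of "int N" 2] by simp
qed

lemma Gamma_neg_2:
  assumes "N = 2"
  shows "neg_mat2 y \<in> Gamma N \<longleftrightarrow> y \<in> Gamma N"
proof -
  have "neg_mat2 y \<in> Gamma N" if y: "y \<in> Gamma N" for y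
  proof -
    obtain a b c d where abcd: "y = (a, b, c, d)" by (cases y rule: prod_cases4)
    have h: "a * d - b * c = 1" "int N dvd a - 1" "int N dvd b" "int N dvd c" "int N dvd d - 1"
      "2 * int N dvd b - c" using y by (simp_all add: abcd Gamma_def)
    have "int N dvd - (a - 1) - 2" "int N dvd - (d - 1) - 2" "2 * int N dvd - (b - c)"
      using h assms by (simp_all only: dvd_minus_iff dvd_diff dvd_refl of_nat_numeral)
    moreover have "- (x - 1) - 2 = - x - 1" "- b - - c = - (b - c)" for x :: int by simp_all
    ultimately have "int N dvd - a - 1" "int N dvd - d - 1" "2 * int N dvd - b - - c"
      by (simp_all only:)
    then show ?thesis using h unfolding abcd neg_mat2_simps Gamma_def
      by (simp only: mem_Collect_eq prod.case dvd_minus_iff minus_mult_minus)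
  qed
  from this[of y] this[of "neg_mat2 y"] show ?thesis by auto
qed

text \<open>Only one of a matrix and its negative can lie in \<open>Gamma N\<close>, so each coset
  of \<open>HN\<close> in \<open>sanov\<close> accounts for two cosets of \<open>Gamma N\<close> in
  \<open>Gamma2\<close>, one for each sign of the representative.\<close>

lemma transversal_HN:
  assumes "group.transversal S2 HN I r" "N > 2"
  shows "group.transversal G2 (Gamma N) (UNIV \<times> I) (\<lambda>(e, i). if e then r i else neg_mat2 (r i))"
proof -
  interpret SL: group "SL2 :: int mat2 monoid" by (rule group_SL2)
  interpret G: group G2 by (rule group_G2)
  interpret S: group S2 by (rule group_S2)
  let ?s = "\<lambda>(e :: bool, i). if e then r i else neg_mat2 (r i)"
  have rs: "r i \<in> sanov" if "i \<in> I" for i using assms(1) that unfolding S.transversal_def by auto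
  then have r2: "r i \<in> Gamma2" if "i \<in> I" for i using that sanov_subset by blast
  show ?thesis
    unfolding G.transversal_def
  proof (intro conjI ballI)
    show "?s ` (UNIV \<times> I) \<subseteq> carrier G2"
      using r2 by (auto simp del: split_paired_All)
    fix x assume "x \<in> carrier G2"
    then have x: "x \<in> Gamma2" by simp
    let ?q = "\<lambda>i. x \<otimes>\<^bsub>SL2\<^esub> inv\<^bsub>SL2\<^esub> (r i)"
    have inv: "x \<otimes>\<^bsub>G2\<^esub> inv\<^bsub>G2\<^esub> (?s (e, i)) = (if e then ?q i else neg_mat2 (?q i))" if "i \<in> I" for e i
      using r2[OF that] inv_G2[of "r i"] inv_G2[of "neg_mat2 (r i)"] neg_inv[of "r i"] Gamma2_carrier
      by (simp add: neg_mat2_mult)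
    have inv2: "inv\<^bsub>SL2\<^esub> (r i) \<in> sanov" if "i \<in> I" for i
      using subgroup.m_inv_closed[OF subgroup_sanov rs[OF that]] .
    have q2: "?q i \<in> Gamma2" if "i \<in> I" for i
      using subgroup.m_closed[OF subgroup_Gamma2 x] inv2[OF that] sanov_subset by blast
    have pq: "pos x \<otimes>\<^bsub>S2\<^esub> inv\<^bsub>S2\<^esub> (r i) = pos (?q i)" if "i \<in> I" for i
      using pos_mult[OF x, of "inv\<^bsub>SL2\<^esub> (r i)"] inv2[OF that] sanov_subset inv_S2[OF rs[OF that]]
        pos_of_sanov by auto
    have mem: "pos x \<otimes>\<^bsub>S2\<^esub> inv\<^bsub>S2\<^esub> (r i) \<in> HN \<longleftrightarrow> ?q i \<in> Gamma N \<or> neg_mat2 (?q i) \<in> Gamma N"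
      if "i \<in> I" for i
      using HN_Gamma2[OF q2[OF that]] pq[OF that] by simp
    have "pos x \<in> carrier S2" using pos_sanov[OF x] by simp
    then obtain i where i: "i \<in> I" "?q i \<in> Gamma N \<or> neg_mat2 (?q i) \<in> Gamma N"
      and i_uniq: "\<And>j. j \<in> I \<Longrightarrow> ?q j \<in> Gamma N \<or> neg_mat2 (?q j) \<in> Gamma N \<Longrightarrow> j = i"
      using assms(1) mem unfolding S.transversal_def by metis
    show "\<exists>!p. p \<in> UNIV \<times> I \<and> x \<otimes>\<^bsub>G2\<^esub> inv\<^bsub>G2\<^esub> (?s p) \<in> Gamma N"
    \<comment> \<open>The sign is positive exactly if the quotient itself, rather than its negative,
      lies in \<open>Gamma N\<close>.\<close>
    proof (rule ex1I[of _ "(?q i \<in> Gamma N, i)"])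
      show "(?q i \<in> Gamma N, i) \<in> UNIV \<times> I \<and> x \<otimes>\<^bsub>G2\<^esub> inv\<^bsub>G2\<^esub> (?s (?q i \<in> Gamma N, i)) \<in> Gamma N"
        using i inv[OF i(1), of True] inv[OF i(1), of False] by (cases "?q i \<in> Gamma N") simp_all
      fix p assume p: "p \<in> UNIV \<times> I \<and> x \<otimes>\<^bsub>G2\<^esub> inv\<^bsub>G2\<^esub> (?s p) \<in> Gamma N"
      obtain e j where ej: "p = (e, j)" by (cases p)
      have j: "j \<in> I" using p ej by simp
      have m: "(if e then ?q j else neg_mat2 (?q j)) \<in> Gamma N"
        using conjunct2[OF p] unfolding ej inv[OF j] .
      then have "j = i" using i_uniq[OF j] by (cases e) simp_all
      moreover have "e = (?q j \<in> Gamma N)"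
        using m Gamma_neg_disjoint[OF assms(2), of "?q j"] by (cases e) auto
      ultimately show "p = (?q i \<in> Gamma N, i)" using ej by simp
    qed
  qed
qed

text \<open>For \<open>N = 2\<close> membership in \<open>Gamma N\<close> does not depend on the
  sign, so a representative and its negative give the same coset.\<close>

lemma transversal_HN_2:
  assumes "group.transversal S2 HN I r" "N = 2"
  shows "group.transversal G2 (Gamma N) I r"
proof -
  interpret SL: group "SL2 :: int mat2 monoid" by (rule group_SL2)
  interpret G: group G2 by (rule group_G2)
  interpret S: group S2 by (rule group_S2)
  have rs: "r i \<in> sanov" if "i \<in> I" for i using assms(1) that unfolding S.transversal_def by auto
  then have r2: "r i \<in> Gamma2" if "i \<in> I" for i using that sanov_subset by blast
  show ?thesis
    unfolding G.transversal_def
  proof (intro conjI ballI)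
    show "r ` I \<subseteq> carrier G2" using r2 by (auto simp del: split_paired_All)
    fix x assume "x \<in> carrier G2"
    then have x: "x \<in> Gamma2" by simp
    let ?q = "\<lambda>i. x \<otimes>\<^bsub>SL2\<^esub> inv\<^bsub>SL2\<^esub> (r i)"
    have inv2: "inv\<^bsub>SL2\<^esub> (r i) \<in> sanov" if "i \<in> I" for i
      using subgroup.m_inv_closed[OF subgroup_sanov rs[OF that]] .
    have q2: "?q i \<in> Gamma2" if "i \<in> I" for i
      using subgroup.m_closed[OF subgroup_Gamma2 x] inv2[OF that] sanov_subset by blast
    have "pos x \<otimes>\<^bsub>S2\<^esub> inv\<^bsub>S2\<^esub> (r i) = pos (?q i)" if "i \<in> I" for i
      using pos_mult[OF x, of "inv\<^bsub>SL2\<^esub> (r i)"] inv2[OF that] sanov_subset inv_S2[OF rs[OF that]]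
        pos_of_sanov by auto
    then have "(i \<in> I \<and> pos x \<otimes>\<^bsub>S2\<^esub> inv\<^bsub>S2\<^esub> (r i) \<in> HN) \<longleftrightarrow>
        (i \<in> I \<and> x \<otimes>\<^bsub>G2\<^esub> inv\<^bsub>G2\<^esub> (r i) \<in> Gamma N)" for i
      using HN_Gamma2[OF q2, of i] Gamma_neg_2[OF assms(2)] inv_G2[OF r2, of i] by auto
    moreover have "\<exists>!i. i \<in> I \<and> pos x \<otimes>\<^bsub>S2\<^esub> inv\<^bsub>S2\<^esub> (r i) \<in> HN"
      using pos_sanov[OF x] assms(1) unfolding S.transversal_def by simp
    ultimately show "\<exists>!i. i \<in> I \<and> x \<otimes>\<^bsub>G2\<^esub> inv\<^bsub>G2\<^esub> (r i) \<in> Gamma N" by simp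
  qed
qed

text \<open>The cosets of \<open>HN\<close> are matched with the explicit representatives of
  \<open>transversal_Gamma\<close>. The value 2 for \<open>N = 2\<close> is the number of shears, as
  there is only one bottom row.\<close>

lemma card_rcosets_HN:
  "finite (rcosets\<^bsub>S2\<^esub> HN) \<and>
    (if N = 2 then card (rcosets\<^bsub>S2\<^esub> HN) = 2
     else 2 * card (rcosets\<^bsub>S2\<^esub> HN) = N * card (bottom_rows N N))"
proof -
  interpret G: group G2 by (rule group_G2)
  interpret S: group S2 by (rule group_S2)
  let ?I = "{0..<int N} \<times> bottom_rows N N"
  have fin: "finite ?I" "card ?I = N * card (bottom_rows N N)" by (simp_all add: card_cartesian_product)
  note T = S.transversal_rcosets[OF subgroup_HN]
  show ?thesis
  proof (cases "N = 2")
    case True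
    obtain f where "bij_betw f (rcosets\<^bsub>S2\<^esub> HN) ?I"
      using G.transversal_card_eq[OF subgroup_Gamma_G2 transversal_HN_2[OF T True] transversal_Gamma] by blast
    then show ?thesis using fin True bij_betw_finite bij_betw_same_card card_bottom_rows_2 by fastforce
  next
    case False
    then have "N > 2" using even_N N_pos by presburger
    then obtain f :: "bool \<times> int mat2 set \<Rightarrow> _" where f: "bij_betw f (UNIV \<times> rcosets\<^bsub>S2\<^esub> HN) ?I"
      using G.transversal_card_eq[OF subgroup_Gamma_G2 transversal_HN[OF T] transversal_Gamma] by blast
    then have "finite ((UNIV :: bool set) \<times> rcosets\<^bsub>S2\<^esub> HN)" using fin(1) bij_betw_finite by blast
    then have "finite (rcosets\<^bsub>S2\<^esub> HN)" using finite_cartesian_productD2 by blast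
    moreover have "card ((UNIV :: bool set) \<times> rcosets\<^bsub>S2\<^esub> HN) = N * card (bottom_rows N N)"
      using bij_betw_same_card[OF f] fin(2) by simp
    ultimately show ?thesis using False by (simp add: card_cartesian_product)
  qed
qed

text \<open>With two generators and index \<open>j\<close>, the rank formula reads
  \<open>n + j = 2 * j + 1\<close>.\<close>

lemma HN_free:
  "\<exists>n. n = card (rcosets\<^bsub>S2\<^esub> HN) + 1 \<and> free_group n \<cong> SL2\<lparr>carrier := HN\<rparr>"
proof -
  interpret S: group S2 by (rule group_S2)
  have gen: "sanov_gen i \<in> carrier S2" for i using sanov_gen_in by simp
  have lv: "letter_val S2 sanov_gen a = letter_val SL2 sanov_gen a" for a
    by (cases a) (simp add: inv_S2[OF sanov_gen_in])
  have "word_val S2 sanov_gen w = word_val SL2 sanov_gen w" for w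
    by (induction w) (simp_all add: lv)
  then have "word_val S2 sanov_gen = word_val SL2 sanov_gen" by (rule ext)
  then have "word_val S2 sanov_gen \<in> iso (free_group 2) S2" using sanov_free by simp
  from S.finite_index_free[OF this gen subgroup_HN] card_rcosets_HN
  show ?thesis by auto
qed

text \<open>\<open>pos\<close> forgets only the sign, and for \<open>N > 2\<close> no two elements
  of \<open>Gamma N\<close> differ by a sign.\<close>

lemma pos_iso:
  assumes "N > 2"
  shows "pos \<in> iso (SL2\<lparr>carrier := Gamma N\<rparr>) (SL2\<lparr>carrier := HN\<rparr>)"
proof -
  have G2: "x \<in> Gamma2" if "x \<in> Gamma N" for x using that Gamma_subset[of "int N"] even_N by auto
  have "pos ` Gamma N = HN"
  proof (intro equalityI subsetI)
    fix y assume "y \<in> HN"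
    then have y: "y \<in> sanov" "y \<in> Gamma N \<or> neg_mat2 y \<in> Gamma N" by (simp_all add: HN_def)
    then have "y = pos y" "y = pos (neg_mat2 y)" using pos_of_sanov pos_neg by simp_all
    with y show "y \<in> pos ` Gamma N" by (metis image_eqI)
  qed (use pos_Gamma in blast)
  moreover have "inj_on pos (Gamma N)"
  proof (rule inj_onI)
    fix x y assume xy: "x \<in> Gamma N" "y \<in> Gamma N" "pos x = pos y"
    then have "x = y \<or> x = neg_mat2 y"
      unfolding pos_def by (metis neg_mat2_simps(2))
    then show "x = y" using xy Gamma_neg_disjoint[OF assms] by blast
  qed
  ultimately show ?thesis using pos_mult[OF G2 G2] pos_Gamma
    by (auto simp: iso_def hom_def bij_betw_def simp del: split_paired_All)
qed

text \<open>The second component records the sign that \<open>pos\<close> forgets. Every combination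
  occurs, because \<open>Gamma N\<close> is closed under negation for \<open>N = 2\<close>.\<close>

lemma pos_sign_iso:
  assumes "N = 2"
  shows "(\<lambda>x. (pos x, if x \<in> sanov then 0 else 1)) \<in>
    iso (SL2\<lparr>carrier := Gamma N\<rparr>) (SL2\<lparr>carrier := HN\<rparr> \<times>\<times> integer_mod_group 2)"
proof -
  let ?f = "\<lambda>x. (pos x, if x \<in> sanov then 0 else 1 :: int)"
  have G2: "x \<in> Gamma2" if "x \<in> Gamma N" for x using that Gamma_subset[of "int N"] even_N by auto
  have Z2: "carrier (integer_mod_group 2) = {0, 1}" by (auto simp: carrier_integer_mod_group)
  have hom: "?f (x \<otimes>\<^bsub>SL2\<^esub> y) = ?f x \<otimes>\<^bsub>SL2\<lparr>carrier := HN\<rparr> \<times>\<times> integer_mod_group 2\<^esub> ?f y"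
    if "x \<in> Gamma N" "y \<in> Gamma N" for x y
    using pos_mult[OF G2 G2, OF that] sanov_neg_iff[OF G2 G2, OF that]
    by (simp add: mult_integer_mod_group)
  have "bij_betw ?f (Gamma N) (HN \<times> {0, 1})"
  proof (rule bij_betw_byWitness[where f' = "\<lambda>(y, s). if s = 0 then y else neg_mat2 y"])
    show "\<forall>x\<in>Gamma N. (case ?f x of (y, s) \<Rightarrow> if s = 0 then y else neg_mat2 y) = x"
      by (simp add: pos_def del: split_paired_All)
    show "\<forall>p\<in>HN \<times> {0, 1}. ?f (case p of (y, s) \<Rightarrow> if s = 0 then y else neg_mat2 y) = p"
    proof
      fix p assume "p \<in> HN \<times> {0, 1 :: int}"
      then obtain y s where p: "p = (y, s)" "y \<in> sanov" "s = 0 \<or> s = 1" unfolding HN_def by blast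
      moreover have "neg_mat2 y \<notin> sanov" using p(2) Gamma2_cases[of y] sanov_subset by blast
      ultimately show "?f (case p of (y, s) \<Rightarrow> if s = 0 then y else neg_mat2 y) = p"
        using pos_of_sanov pos_neg by auto
    qed
    show "?f ` Gamma N \<subseteq> HN \<times> {0, 1}" using pos_Gamma by (auto simp del: split_paired_All)
    show "(\<lambda>(y, s). if s = 0 then y else neg_mat2 y) ` (HN \<times> {0, 1 :: int}) \<subseteq> Gamma N"
    proof (rule image_subsetI)
      fix p assume "p \<in> HN \<times> {0, 1 :: int}"
      then obtain y s where p: "p = (y, s)" "y \<in> Gamma N \<or> neg_mat2 y \<in> Gamma N" "s = 0 \<or> s = 1"
        unfolding HN_def by blast
      then show "(case p of (y, s) \<Rightarrow> if s = 0 then y else neg_mat2 y) \<in> Gamma N"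
        using Gamma_neg_2[OF assms] by auto
    qed
  qed
  then show ?thesis using hom pos_Gamma
    by (simp add: iso_def hom_def Z2 Pi_iff del: split_paired_All)
qed

theorem Gamma_free:
  assumes "N > 2"
  shows "\<exists>n. real n = 1 + real N ^ 3 / 6 * (\<Prod>p\<in>prime_factors N. 1 - 1 / real p ^ 2) \<and>
    SL2\<lparr>carrier := Gamma N\<rparr> \<cong> free_group n"
proof -
  obtain n where n: "n = card (rcosets\<^bsub>S2\<^esub> HN) + 1" "free_group n \<cong> SL2\<lparr>carrier := HN\<rparr>"
    using HN_free by blast
  have "SL2\<lparr>carrier := HN\<rparr> \<cong> free_group n"
    using n(2) group.iso_sym[OF group_free_group] by blast
  then have "SL2\<lparr>carrier := Gamma N\<rparr> \<cong> free_group n"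
    using pos_iso[OF assms] iso_trans unfolding is_iso_def by blast
  moreover have "2 * card (rcosets\<^bsub>S2\<^esub> HN) = N * card (bottom_rows N N)"
    using card_rcosets_HN assms by simp
  \<comment> \<open>The 6 of the rank formula is the 2 from the sign times the 3 from the count of
    bottom rows.\<close>
  then have "6 * real (card (rcosets\<^bsub>S2\<^esub> HN)) = real N * (3 * real (card (bottom_rows N N)))"
    by (simp flip: of_nat_mult)
  then have "real n = 1 + real N ^ 3 / 6 * (\<Prod>p\<in>prime_factors N. 1 - 1 / real p ^ 2)"
    unfolding card_bottom_rows[OF even_N N_pos] using n(1) by (simp add: power3_eq_cube power2_eq_square)
  ultimately show ?thesis by blast
qed

theorem Gamma_2:
  assumes "N = 2"
  shows "SL2\<lparr>carrier := Gamma N\<rparr> \<cong> free_group 3 \<times>\<times> integer_mod_group 2"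
proof -
  have group_HN: "group (SL2\<lparr>carrier := HN\<rparr>)"
    using subgroup.subgroup_is_group[OF subgroup_HN group_S2] by simp
  have "free_group 3 \<cong> SL2\<lparr>carrier := HN\<rparr>"
    using HN_free card_rcosets_HN assms by (auto simp: numeral_3_eq_3)
  then have "SL2\<lparr>carrier := HN\<rparr> \<cong> free_group 3"
    using group.iso_sym[OF group_free_group] by blast
  moreover have "integer_mod_group 2 \<cong> integer_mod_group 2" by (rule iso_refl)
  ultimately have "SL2\<lparr>carrier := HN\<rparr> \<times>\<times> integer_mod_group 2 \<cong> free_group 3 \<times>\<times> integer_mod_group 2"
    using group.DirProd_iso_trans[OF group_HN] by blast
  then show ?thesis using pos_sign_iso[OF assms] iso_trans unfolding is_iso_def by blast
qed

end

section \<open>The rational group ring\<close>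

locale finite_group = group +
  assumes finite_carrier [simp]: "finite (carrier G)"
begin

abbreviation R where "R \<equiv> QG G"

lemma carrier_QG: "carrier R = carrier G \<rightarrow>\<^sub>E UNIV"
  by (simp add: QG_def)

lemma QG_eqI:
  assumes "a \<in> carrier R" "b \<in> carrier R" "\<And>x. x \<in> carrier G \<Longrightarrow> a x = b x"
  shows "a = b"
  using assms unfolding carrier_QG by (rule PiE_ext)

lemma QG_apply:
  assumes "x \<in> carrier G"
  shows "(a \<otimes>\<^bsub>R\<^esub> b) x = (\<Sum>y\<in>carrier G. a y * b (inv y \<otimes> x))"
    "(a \<oplus>\<^bsub>R\<^esub> b) x = a x + b x" "\<zero>\<^bsub>R\<^esub> x = 0" "(c \<odot>\<^bsub>R\<^esub> a) x = c * a x"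
    "\<one>\<^bsub>R\<^esub> x = (if x = \<one> then 1 else 0)" "elt G g x = (if x = g then 1 else 0)"
  using assms by (simp_all add: QG_def elt_def)

lemma QG_closed [simp, intro]:
  "a \<otimes>\<^bsub>R\<^esub> b \<in> carrier R" "a \<oplus>\<^bsub>R\<^esub> b \<in> carrier R" "\<zero>\<^bsub>R\<^esub> \<in> carrier R"
  "c \<odot>\<^bsub>R\<^esub> a \<in> carrier R" "\<one>\<^bsub>R\<^esub> \<in> carrier R" "elt G g \<in> carrier R"
  by (simp_all add: QG_def elt_def)

lemma sum_translate:
  assumes "y \<in> carrier G"
  shows "(\<Sum>z\<in>carrier G. f z) = (\<Sum>w\<in>carrier G. f (y \<otimes> w))"
proof -
  have "bij_betw (\<lambda>w. y \<otimes> w) (carrier G) (carrier G)"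
    by (rule bij_betw_byWitness[where f' = "\<lambda>w. inv y \<otimes> w"])
      (use assms in \<open>auto simp: m_assoc[symmetric]\<close>)
  from sum.reindex_bij_betw[OF this, of f] show ?thesis by simp
qed

lemma inv_mult_eq_iff:
  assumes "x \<in> carrier G" "y \<in> carrier G" "z \<in> carrier G"
  shows "inv y \<otimes> x = z \<longleftrightarrow> x = y \<otimes> z"
  using assms inv_solve_left' by auto

lemma QG_mult_assoc: "a \<otimes>\<^bsub>R\<^esub> b \<otimes>\<^bsub>R\<^esub> c = a \<otimes>\<^bsub>R\<^esub> (b \<otimes>\<^bsub>R\<^esub> c)"
proof (rule QG_eqI)
  fix x assume x: "x \<in> carrier G"
  have "(a \<otimes>\<^bsub>R\<^esub> b \<otimes>\<^bsub>R\<^esub> c) x =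
      (\<Sum>z\<in>carrier G. \<Sum>y\<in>carrier G. a y * (b (inv y \<otimes> z) * c (inv z \<otimes> x)))"
    using x by (simp add: QG_apply sum_distrib_right mult.assoc)
  also have "\<dots> = (\<Sum>y\<in>carrier G. \<Sum>z\<in>carrier G. a y * (b (inv y \<otimes> z) * c (inv z \<otimes> x)))"
    by (rule sum.swap)
  also have "\<dots> = (\<Sum>y\<in>carrier G. \<Sum>w\<in>carrier G. a y * (b w * c (inv w \<otimes> (inv y \<otimes> x))))"
  proof (rule sum.cong[OF refl])
    fix y assume y: "y \<in> carrier G"
    have "(\<Sum>z\<in>carrier G. a y * (b (inv y \<otimes> z) * c (inv z \<otimes> x))) =
        (\<Sum>w\<in>carrier G. a y * (b (inv y \<otimes> (y \<otimes> w)) * c (inv (y \<otimes> w) \<otimes> x)))"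
      using y by (rule sum_translate)
    also have "\<dots> = (\<Sum>w\<in>carrier G. a y * (b w * c (inv w \<otimes> (inv y \<otimes> x))))"
    proof (rule sum.cong[OF refl])
      fix w assume w: "w \<in> carrier G"
      have "inv y \<otimes> (y \<otimes> w) = w" using y w by (simp add: m_assoc[symmetric])
      moreover have "inv (y \<otimes> w) \<otimes> x = inv w \<otimes> (inv y \<otimes> x)"
        using x y w by (simp add: inv_mult_group m_assoc)
      ultimately show "a y * (b (inv y \<otimes> (y \<otimes> w)) * c (inv (y \<otimes> w) \<otimes> x)) =
          a y * (b w * c (inv w \<otimes> (inv y \<otimes> x)))" by simp
    qed
    finally show "(\<Sum>z\<in>carrier G. a y * (b (inv y \<otimes> z) * c (inv z \<otimes> x))) =
        (\<Sum>w\<in>carrier G. a y * (b w * c (inv w \<otimes> (inv y \<otimes> x))))" .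
  qed
  also have "\<dots> = (a \<otimes>\<^bsub>R\<^esub> (b \<otimes>\<^bsub>R\<^esub> c)) x"
    using x by (simp add: QG_apply sum_distrib_left)
  finally show "(a \<otimes>\<^bsub>R\<^esub> b \<otimes>\<^bsub>R\<^esub> c) x = (a \<otimes>\<^bsub>R\<^esub> (b \<otimes>\<^bsub>R\<^esub> c)) x" .
qed auto

lemma elt_mult_apply:
  assumes "g \<in> carrier G" "x \<in> carrier G"
  shows "(elt G g \<otimes>\<^bsub>R\<^esub> a) x = a (inv g \<otimes> x)"
proof -
  have "(elt G g \<otimes>\<^bsub>R\<^esub> a) x = (\<Sum>y\<in>carrier G. if y = g then a (inv y \<otimes> x) else 0)"
    unfolding QG_apply(1)[OF assms(2)] by (rule sum.cong) (auto simp: QG_apply)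
  then show ?thesis using assms by (simp add: sum.delta)
qed

lemma mult_elt_apply:
  assumes "g \<in> carrier G" "x \<in> carrier G"
  shows "(a \<otimes>\<^bsub>R\<^esub> elt G g) x = a (x \<otimes> inv g)"
proof -
  have "(a \<otimes>\<^bsub>R\<^esub> elt G g) x = (\<Sum>y\<in>carrier G. if y = x \<otimes> inv g then a y else 0)"
    unfolding QG_apply(1)[OF assms(2)]
  proof (rule sum.cong)
    fix y assume y: "y \<in> carrier G"
    have "inv y \<otimes> x = g \<longleftrightarrow> y = x \<otimes> inv g"
      using assms y by (metis inv_closed inv_mult_eq_iff inv_solve_right m_closed)
    then show "a y * elt G g (inv y \<otimes> x) = (if y = x \<otimes> inv g then a y else 0)"
      using assms y by (simp add: QG_apply)
  qed simp
  then show ?thesis using assms by (simp add: sum.delta)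
qed

lemma one_QG: "\<one>\<^bsub>R\<^esub> = elt G \<one>"
  by (rule QG_eqI) (auto simp: QG_apply)

lemma ring_QG: "ring R"
proof (rule ringI)
  show "abelian_group R"
  proof (rule abelian_groupI)
    fix a assume a: "a \<in> carrier R"
    show "\<exists>b\<in>carrier R. b \<oplus>\<^bsub>R\<^esub> a = \<zero>\<^bsub>R\<^esub>"
      by (rule bexI[of _ "(- 1) \<odot>\<^bsub>R\<^esub> a"]) (auto intro!: QG_eqI simp: QG_apply)
  qed (auto intro!: QG_eqI simp: QG_apply)
  show "Group.monoid R"
  proof (rule monoidI)
    fix a assume a: "a \<in> carrier R"
    show "\<one>\<^bsub>R\<^esub> \<otimes>\<^bsub>R\<^esub> a = a" "a \<otimes>\<^bsub>R\<^esub> \<one>\<^bsub>R\<^esub> = a"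
      unfolding one_QG using a by (auto intro!: QG_eqI simp: elt_mult_apply mult_elt_apply)
  qed (auto simp: QG_mult_assoc)
qed (auto intro!: QG_eqI simp: QG_apply algebra_simps sum.distrib)

sublocale QG: ring R
  by (rule ring_QG)

lemma elt_mult: "g \<in> carrier G \<Longrightarrow> h \<in> carrier G \<Longrightarrow> elt G g \<otimes>\<^bsub>R\<^esub> elt G h = elt G (g \<otimes> h)"
  by (rule QG_eqI) (auto simp: elt_mult_apply QG_apply(6) inv_mult_eq_iff)

lemma elt_pow: "g \<in> carrier G \<Longrightarrow> elt G g [^]\<^bsub>R\<^esub> (n::nat) = elt G (g [^] n)"
  by (induction n) (auto simp: one_QG elt_mult)

lemma smult_mult:
  "(c \<odot>\<^bsub>R\<^esub> a) \<otimes>\<^bsub>R\<^esub> b = c \<odot>\<^bsub>R\<^esub> (a \<otimes>\<^bsub>R\<^esub> b)"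
  "a \<otimes>\<^bsub>R\<^esub> (c \<odot>\<^bsub>R\<^esub> b) = c \<odot>\<^bsub>R\<^esub> (a \<otimes>\<^bsub>R\<^esub> b)"
  by (rule QG_eqI; simp add: QG_apply sum_distrib_left mult_ac)+

lemma smult_smult: "c \<odot>\<^bsub>R\<^esub> (d \<odot>\<^bsub>R\<^esub> a) = (c * d) \<odot>\<^bsub>R\<^esub> a"
  by (rule QG_eqI) (auto simp: QG_apply)

lemma smult_add: "c \<odot>\<^bsub>R\<^esub> (a \<oplus>\<^bsub>R\<^esub> b) = c \<odot>\<^bsub>R\<^esub> a \<oplus>\<^bsub>R\<^esub> c \<odot>\<^bsub>R\<^esub> b"
  by (rule QG_eqI) (auto simp: QG_apply algebra_simps)

lemma add_smult: "(c + d) \<odot>\<^bsub>R\<^esub> a = c \<odot>\<^bsub>R\<^esub> a \<oplus>\<^bsub>R\<^esub> d \<odot>\<^bsub>R\<^esub> a"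
  by (rule QG_eqI) (auto simp: QG_apply algebra_simps)

lemma smult_one [simp]: "a \<in> carrier R \<Longrightarrow> 1 \<odot>\<^bsub>R\<^esub> a = a"
  by (rule QG_eqI) (auto simp: QG_apply)

lemma smult_zero [simp]: "0 \<odot>\<^bsub>R\<^esub> a = \<zero>\<^bsub>R\<^esub>" "c \<odot>\<^bsub>R\<^esub> \<zero>\<^bsub>R\<^esub> = \<zero>\<^bsub>R\<^esub>"
  by (rule QG_eqI; simp add: QG_apply)+

lemma QG_minus: "a \<in> carrier R \<Longrightarrow> \<ominus>\<^bsub>R\<^esub> a = (- 1) \<odot>\<^bsub>R\<^esub> a"
  by (rule QG.minus_equality) (auto intro!: QG_eqI simp: QG_apply)

lemma QG_minus_apply: "a \<in> carrier R \<Longrightarrow> x \<in> carrier G \<Longrightarrow> (\<ominus>\<^bsub>R\<^esub> a) x = - a x"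
  by (simp add: QG_minus QG_apply)

text \<open>The coefficients have characteristic 0. The vanishing of \<open>e\<close>, of the
  products of \<open>A\<close> and \<open>B\<close>, and of \<open>A\<close> in the degenerate case
  is obtained in this way.\<close>

lemma eq_zero_if_eq_minus:
  assumes "a \<in> carrier R" "a = \<ominus>\<^bsub>R\<^esub> a"
  shows "a = \<zero>\<^bsub>R\<^esub>"
proof (rule QG_eqI)
  fix x assume x: "x \<in> carrier G"
  have "a x = (\<ominus>\<^bsub>R\<^esub> a) x" using assms(2) by simp
  then show "a x = \<zero>\<^bsub>R\<^esub> x" using x assms(1) by (simp add: QG_minus_apply QG_apply)
qed (use assms in auto)

lemma finsum_apply:
  assumes "finite I" "\<And>i. i \<in> I \<Longrightarrow> f i \<in> carrier R" "x \<in> carrier G"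
  shows "(\<Oplus>\<^bsub>R\<^esub>i\<in>I. f i) x = (\<Sum>i\<in>I. f i x)"
  using assms(1,2)
proof (induction I)
  case empty
  then show ?case using assms(3) by (simp add: QG_apply)
next
  case (insert i I)
  have "(\<Oplus>\<^bsub>R\<^esub>i\<in>insert i I. f i) = f i \<oplus>\<^bsub>R\<^esub> (\<Oplus>\<^bsub>R\<^esub>i\<in>I. f i)"
    using insert by (intro QG.finsum_insert) auto
  then show ?case using insert assms(3) by (simp add: QG_apply)
qed

lemma finsum_const:
  assumes "finite I" "a \<in> carrier R"
  shows "(\<Oplus>\<^bsub>R\<^esub>i\<in>I. a) = of_nat (card I) \<odot>\<^bsub>R\<^esub> a"
  using assms by (intro QG_eqI) (auto simp: finsum_apply QG_apply)

lemma power_sum_closed [simp, intro]: "a \<in> carrier R \<Longrightarrow> power_sum R a m \<in> carrier R"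
  unfolding power_sum_def by (intro QG.finsum_closed) auto

end

section \<open>The idempotent of a triple\<close>

text \<open>Moving \<open>b\<close> past \<open>a\<close> costs a factor \<open>c\<close>. Moving it
  past twice gives the second claim, since \<open>b\<close> is an involution, and moving it past
  \<open>a [^] n\<close> costs \<open>c [^] n\<close>, which gives the third. To be applied to the
  cosets of \<open>g\<close>, \<open>h\<close> and their commutator.\<close>

lemma (in group) central_commutator:
  fixes n :: nat
  assumes [simp]: "a \<in> carrier G" "b \<in> carrier G"
    and c: "c = inv a \<otimes> inv b \<otimes> a \<otimes> b" and central: "\<And>x. x \<in> carrier G \<Longrightarrow> c \<otimes> x = x \<otimes> c"
    and bb: "b \<otimes> b = \<one>"
  shows "a \<otimes> b = b \<otimes> a \<otimes> c" "c \<otimes> c = \<one>" "a [^] n = \<one> \<Longrightarrow> c [^] n = \<one>"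
proof -
  have [simp]: "c \<in> carrier G" by (simp add: c)
  have cancel: "y \<otimes> (inv y \<otimes> z) = z" if "y \<in> carrier G" "z \<in> carrier G" for y z
    using that by (simp add: m_assoc[symmetric])
  show ab: "a \<otimes> b = b \<otimes> a \<otimes> c" by (simp add: c m_assoc cancel)
  have "a = a \<otimes> (b \<otimes> b)" by (simp add: bb)
  also have "\<dots> = (a \<otimes> b) \<otimes> b" by (simp add: m_assoc)
  also have "\<dots> = b \<otimes> a \<otimes> (c \<otimes> b)" by (simp add: ab m_assoc)
  also have "\<dots> = b \<otimes> (a \<otimes> b) \<otimes> c" using central[of b] by (simp add: m_assoc)
  also have "\<dots> = (b \<otimes> b) \<otimes> a \<otimes> (c \<otimes> c)" by (simp add: ab m_assoc)
  finally have "a = a \<otimes> (c \<otimes> c)" by (simp add: bb)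
  then have "a \<otimes> (c \<otimes> c) = a \<otimes> \<one>" by (simp only: r_one assms(1))
  then show "c \<otimes> c = \<one>" by (simp only: l_cancel assms(1) m_closed one_closed \<open>c \<in> carrier G\<close>)
  have pow: "a [^] n \<otimes> b = b \<otimes> a [^] n \<otimes> c [^] n" for n :: nat
  proof (induction n)
    case (Suc n)
    have cn: "c [^] n \<otimes> a = a \<otimes> c [^] n"
    proof (induction n)
      case (Suc n)
      have "c [^] Suc n \<otimes> a = c [^] n \<otimes> a \<otimes> c" using central[of a] by (simp add: m_assoc)
      then show ?case using Suc by (simp add: m_assoc)
    qed simp
    have "a [^] Suc n \<otimes> b = a [^] n \<otimes> (a \<otimes> b)" by (simp add: m_assoc)
    also have "\<dots> = (a [^] n \<otimes> b) \<otimes> a \<otimes> c" by (simp add: ab m_assoc)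
    also have "\<dots> = b \<otimes> a [^] n \<otimes> (c [^] n \<otimes> a) \<otimes> c" by (simp add: Suc m_assoc)
    also have "\<dots> = b \<otimes> a [^] Suc n \<otimes> c [^] Suc n" by (simp add: cn m_assoc)
    finally show ?case .
  qed simp
  show "c [^] n = \<one>" if "a [^] n = \<one>"
  proof -
    have "b \<otimes> c [^] n = b \<otimes> \<one>" using pow[of n] that by simp
    then show ?thesis by (simp only: l_cancel assms(2) nat_pow_closed one_closed \<open>c \<in> carrier G\<close>)
  qed
qed

section \<open>The quotient of the triple group by \<open>Q\<close>\<close>

locale unit_triple = finite_group +
  fixes g h :: 'a and Q :: "'a set"
  assumes g_closed [simp]: "g \<in> carrier G" and h_closed [simp]: "h \<in> carrier G"
    and subgroup_Q: "subgroup Q G"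
    and normal_Q: "Q \<lhd> triple_group G g h Q"
    and central_u: "Q #> commutator G g h \<in> center (triple_group G g h Q Mod Q)"
    and order_h: "coset_order G g h Q h = 2"
begin

definition T where "T = generate G ({g, h} \<union> Q)"
definition TG where "TG = triple_group G g h Q"
definition K where "K = TG Mod Q"
abbreviation "u \<equiv> commutator G g h"
abbreviation "m \<equiv> coset_order G g h Q g"

lemma Q_subset: "Q \<subseteq> carrier G"
  using subgroup.subset[OF subgroup_Q] .

lemma finite_Q [simp]: "finite Q"
  using Q_subset finite_carrier finite_subset by blast

lemma card_Q_pos: "card Q > 0"
  using subgroup.one_closed[OF subgroup_Q] by (auto simp: card_gt_0_iff)

lemma Q_nonempty [simp]: "Q \<noteq> {}"
  using card_Q_pos by auto

lemma subgroup_T: "subgroup T G"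
  unfolding T_def using Q_subset by (intro generate_is_subgroup) auto

lemma T_carrier [simp]: "x \<in> T \<Longrightarrow> x \<in> carrier G"
  using subgroup.subset[OF subgroup_T] by blast

lemma T_closed [simp]: "x \<in> T \<Longrightarrow> y \<in> T \<Longrightarrow> x \<otimes> y \<in> T" "x \<in> T \<Longrightarrow> inv x \<in> T" "\<one> \<in> T"
  using subgroup.m_closed[OF subgroup_T] subgroup.m_inv_closed[OF subgroup_T]
    subgroup.one_closed[OF subgroup_T] by auto

lemma T_pow [simp]: "x \<in> T \<Longrightarrow> x [^] (n::nat) \<in> T"
  by (induction n) auto

lemma gh_T [simp]: "g \<in> T" "h \<in> T" "q \<in> Q \<Longrightarrow> q \<in> T"
  by (auto simp: T_def intro: generate.incl)

lemma u_T [simp]: "u \<in> T"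
  by (simp add: commutator_def)

lemma TG_simps [simp]: "carrier TG = T" "monoid.mult TG = monoid.mult G" "one TG = \<one>"
  by (simp_all add: TG_def T_def triple_group_def)

lemma TG_eq: "TG = G\<lparr>carrier := T\<rparr>"
  by (simp add: TG_def T_def triple_group_def)

lemma normal_TG: "Q \<lhd> TG"
  using normal_Q by (simp add: TG_def)

lemma coset_order_eq: "coset_order G g h Q x = group.ord K (Q #> x)"
  by (simp add: coset_order_def K_def TG_def)

lemma group_TG: "group TG"
  unfolding TG_eq using subgroup.subgroup_is_group[OF subgroup_T is_group] .

lemma inv_TG: "x \<in> T \<Longrightarrow> inv\<^bsub>TG\<^esub> x = inv x"
  unfolding TG_eq using m_inv_consistent[OF subgroup_T] .

lemma group_K: "group K"
  unfolding K_def using normal.factorgroup_is_group[OF normal_TG] .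

lemma coset_hom: "group_hom TG K (\<lambda>x. Q #> x)"
proof -
  have "(\<lambda>x. Q #>\<^bsub>TG\<^esub> x) \<in> hom TG K" unfolding K_def using normal.r_coset_hom_Mod[OF normal_TG] .
  moreover have "Q #>\<^bsub>TG\<^esub> x = Q #> x" for x by (simp add: r_coset_def)
  ultimately show ?thesis
    using group_TG group_K by (simp add: group_hom_def group_hom_axioms_def)
qed

lemma one_K: "\<one>\<^bsub>K\<^esub> = Q"
  by (simp add: K_def FactGroup_def)

lemma coset_closed: "x \<in> T \<Longrightarrow> Q #> x \<in> carrier K"
  using group_hom.hom_closed[OF coset_hom] by simp

lemma coset_mult: "x \<in> T \<Longrightarrow> y \<in> T \<Longrightarrow> Q #> (x \<otimes> y) = (Q #> x) \<otimes>\<^bsub>K\<^esub> (Q #> y)"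
  using group_hom.hom_mult[OF coset_hom] by simp

lemma coset_inv: "x \<in> T \<Longrightarrow> Q #> (inv x) = inv\<^bsub>K\<^esub> (Q #> x)"
  using group_hom.hom_inv[OF coset_hom, of x] by (simp add: inv_TG)

lemma coset_pow: "x \<in> T \<Longrightarrow> Q #> (x [^] (n::nat)) = (Q #> x) [^]\<^bsub>K\<^esub> n"
  using group_hom.hom_one[OF coset_hom] by (induction n) (simp_all add: coset_mult)

lemma coset_eq_one_iff: "x \<in> T \<Longrightarrow> Q #> x = \<one>\<^bsub>K\<^esub> \<longleftrightarrow> x \<in> Q"
  using rcos_eq_iff[OF subgroup_Q, of x \<one>] Q_subset by (simp add: one_K)

lemma finite_K: "finite (carrier K)"
proof -
  have "finite T" using finite_subset[OF subgroup.subset[OF subgroup_T] finite_carrier] .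
  then show ?thesis by (simp add: K_def FactGroup_def RCOSETS_def)
qed

lemma m_pos: "m > 0"
  using group.ord_ge_1[OF group_K finite_K, of "Q #> g"] coset_closed by (simp add: coset_order_eq)

lemma g_pow_Q: "g [^] (n::nat) \<in> Q \<longleftrightarrow> m dvd n"
  using coset_eq_one_iff[of "g [^] n"] group.pow_eq_id[OF group_K, of "Q #> g" n] coset_closed
  by (simp add: coset_pow coset_order_eq)

lemma hh_K: "(Q #> h) \<otimes>\<^bsub>K\<^esub> (Q #> h) = \<one>\<^bsub>K\<^esub>"
proof -
  interpret K: group K by (rule group_K)
  have "(Q #> h) [^]\<^bsub>K\<^esub> (2::nat) = \<one>\<^bsub>K\<^esub>"
    using order_h K.pow_ord_eq_1[of "Q #> h"] coset_closed by (simp add: coset_order_eq)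
  then show ?thesis using coset_closed by (simp add: numeral_2_eq_2)
qed

lemma u_K: "Q #> u = inv\<^bsub>K\<^esub> (Q #> g) \<otimes>\<^bsub>K\<^esub> inv\<^bsub>K\<^esub> (Q #> h) \<otimes>\<^bsub>K\<^esub> (Q #> g) \<otimes>\<^bsub>K\<^esub> (Q #> h)"
  by (simp add: commutator_def coset_mult coset_inv)

lemma u_central: "y \<in> carrier K \<Longrightarrow> (Q #> u) \<otimes>\<^bsub>K\<^esub> y = y \<otimes>\<^bsub>K\<^esub> (Q #> u)"
  using central_u unfolding K_def TG_def by (simp add: center_def)

lemmas K_commutator = group.central_commutator[OF group_K coset_closed coset_closed u_K u_central hh_K,
    OF gh_T(1,2)]

lemma gh_K: "Q #> (g \<otimes> h) = Q #> (u \<otimes> (h \<otimes> g))"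
  using K_commutator(1) u_central[OF coset_closed, of "h \<otimes> g"]
  by (simp add: coset_mult[symmetric])

lemma uu_K: "Q #> (u \<otimes> u) = Q #> \<one>"
  using K_commutator(2) group_hom.hom_one[OF coset_hom] by (simp add: coset_mult)

text \<open>In the quotient both the square and the \<open>m\<close>-th power of the coset of
  \<open>u\<close> are trivial, hence so is the coset itself if \<open>m\<close> is odd. This is the
  reason why \<open>m\<close> is even in the nontrivial case.\<close>

lemma u_odd:
  assumes "odd m"
  shows "u \<in> Q"
proof -
  interpret K: group K by (rule group_K)
  have "(Q #> g) [^]\<^bsub>K\<^esub> m = \<one>\<^bsub>K\<^esub>"
    using g_pow_Q[of m] coset_eq_one_iff[of "g [^] m"] by (simp add: coset_pow)
  then have um: "(Q #> u) [^]\<^bsub>K\<^esub> m = \<one>\<^bsub>K\<^esub>" using K_commutator(3)[of m] by simp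
  obtain k where k: "m = Suc (2 * k)" using assms by (elim oddE) simp
  have "(Q #> u) [^]\<^bsub>K\<^esub> (2 * j) = \<one>\<^bsub>K\<^esub>" for j :: nat
  proof (induction j)
    case (Suc j)
    then show ?case using K_commutator(2) coset_closed[OF u_T] by (simp add: K.m_assoc)
  qed simp
  then have "Q #> u = \<one>\<^bsub>K\<^esub>" using um coset_closed[OF u_T] unfolding k by simp
  then show ?thesis using coset_eq_one_iff by simp
qed

section \<open>The idempotents \<open>qh\<close> and \<open>e\<close>\<close>

definition sQ where "sQ = (\<Oplus>\<^bsub>R\<^esub>q\<in>Q. elt G q)"
definition qh where "qh = (1 / of_nat (card Q)) \<odot>\<^bsub>R\<^esub> sQ"
definition e where "e = (1 / (2 * of_nat (card Q))) \<odot>\<^bsub>R\<^esub> (sQ \<otimes>\<^bsub>R\<^esub> (\<one>\<^bsub>R\<^esub> \<ominus>\<^bsub>R\<^esub> elt G u))"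

lemma sQ_closed [simp, intro]: "sQ \<in> carrier R"
  unfolding sQ_def by (intro QG.finsum_closed) auto

lemma qh_closed [simp, intro]: "qh \<in> carrier R" and e_closed [simp, intro]: "e \<in> carrier R"
  by (simp_all add: qh_def e_def)

lemma sQ_apply: "x \<in> carrier G \<Longrightarrow> sQ x = (if x \<in> Q then 1 else 0)"
  by (simp add: sQ_def finsum_apply QG_apply(6) sum.delta)

lemma elt_Q_sQ:
  assumes q: "q \<in> Q"
  shows "elt G q \<otimes>\<^bsub>R\<^esub> sQ = sQ"
proof (rule QG_eqI)
  fix x assume x: "x \<in> carrier G"
  have "q \<in> carrier G" using q Q_subset by auto
  moreover have "inv q \<otimes> x \<in> Q \<longleftrightarrow> x \<in> Q"
  proof
    assume "inv q \<otimes> x \<in> Q"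
    then have "q \<otimes> (inv q \<otimes> x) \<in> Q" using q subgroup.m_closed[OF subgroup_Q] by blast
    then show "x \<in> Q" using x \<open>q \<in> carrier G\<close> by (simp add: m_assoc[symmetric])
  qed (use q subgroup.m_closed[OF subgroup_Q] subgroup.m_inv_closed[OF subgroup_Q] in blast)
  ultimately show "(elt G q \<otimes>\<^bsub>R\<^esub> sQ) x = sQ x"
    using x by (simp add: elt_mult_apply sQ_apply)
qed auto

lemma elt_sQ_commute:
  assumes x: "x \<in> T"
  shows "elt G x \<otimes>\<^bsub>R\<^esub> sQ = sQ \<otimes>\<^bsub>R\<^esub> elt G x"
proof (rule QG_eqI)
  fix z assume z: "z \<in> carrier G"
  have "inv x \<otimes> z \<in> Q \<longleftrightarrow> z \<otimes> inv x \<in> Q"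
  proof
    assume "inv x \<otimes> z \<in> Q"
    then have "x \<otimes> (inv x \<otimes> z) \<otimes> inv x \<in> Q"
      using normal.inv_op_closed2[OF normal_TG, of x] x by (simp add: inv_TG)
    then show "z \<otimes> inv x \<in> Q" using x z by (simp add: m_assoc[symmetric])
  next
    assume "z \<otimes> inv x \<in> Q"
    then have "inv x \<otimes> (z \<otimes> inv x) \<otimes> x \<in> Q"
      using normal.inv_op_closed1[OF normal_TG, of x] x by (simp add: inv_TG)
    then show "inv x \<otimes> z \<in> Q" using x z by (simp add: m_assoc)
  qed
  then show "(elt G x \<otimes>\<^bsub>R\<^esub> sQ) z = (sQ \<otimes>\<^bsub>R\<^esub> elt G x) z"
    using x z by (simp add: elt_mult_apply mult_elt_apply sQ_apply)
qed auto

lemma sQ_sQ: "sQ \<otimes>\<^bsub>R\<^esub> sQ = of_nat (card Q) \<odot>\<^bsub>R\<^esub> sQ"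
proof -
  have "sQ \<otimes>\<^bsub>R\<^esub> sQ = (\<Oplus>\<^bsub>R\<^esub>q\<in>Q. elt G q \<otimes>\<^bsub>R\<^esub> sQ)"
    by (subst (1) sQ_def, rule QG.finsum_ldistr) auto
  also have "\<dots> = (\<Oplus>\<^bsub>R\<^esub>q\<in>Q. sQ)"
    by (rule QG.finsum_cong') (auto simp: elt_Q_sQ)
  finally show ?thesis by (simp add: finsum_const)
qed

lemma qh_qh: "qh \<otimes>\<^bsub>R\<^esub> qh = qh"
  using card_Q_pos by (simp add: qh_def smult_mult smult_smult sQ_sQ)

lemma elt_qh_commute: "x \<in> T \<Longrightarrow> elt G x \<otimes>\<^bsub>R\<^esub> qh = qh \<otimes>\<^bsub>R\<^esub> elt G x"
  by (simp add: qh_def smult_mult elt_sQ_commute)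

text \<open>\<open>Qx \<mapsto> coset_elt x\<close> embeds the group ring of the quotient by \<open>Q\<close>.\<close>

definition coset_elt where "coset_elt x = qh \<otimes>\<^bsub>R\<^esub> elt G x"

lemma coset_elt_closed [simp, intro]: "coset_elt x \<in> carrier R"
  by (simp add: coset_elt_def)

lemma coset_elt_mult:
  assumes "x \<in> T" "y \<in> T"
  shows "coset_elt x \<otimes>\<^bsub>R\<^esub> coset_elt y = coset_elt (x \<otimes> y)"
proof -
  have "coset_elt x \<otimes>\<^bsub>R\<^esub> coset_elt y = qh \<otimes>\<^bsub>R\<^esub> (elt G x \<otimes>\<^bsub>R\<^esub> qh) \<otimes>\<^bsub>R\<^esub> elt G y"
    by (simp add: coset_elt_def QG_mult_assoc)
  also have "\<dots> = (qh \<otimes>\<^bsub>R\<^esub> qh) \<otimes>\<^bsub>R\<^esub> (elt G x \<otimes>\<^bsub>R\<^esub> elt G y)"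
    using assms by (simp only: elt_qh_commute QG_mult_assoc)
  finally show ?thesis using assms by (simp add: qh_qh elt_mult coset_elt_def)
qed

lemma coset_elt_cong:
  assumes "x \<in> T" "y \<in> T" "Q #> x = Q #> y"
  shows "coset_elt x = coset_elt y"
proof -
  let ?q = "x \<otimes> inv y"
  have q: "?q \<in> Q" using assms rcos_eq_iff[OF subgroup_Q] by simp
  have "elt G x = elt G ?q \<otimes>\<^bsub>R\<^esub> elt G y" using assms by (simp add: elt_mult m_assoc)
  then have "coset_elt x = (qh \<otimes>\<^bsub>R\<^esub> elt G ?q) \<otimes>\<^bsub>R\<^esub> elt G y"
    by (simp add: coset_elt_def QG_mult_assoc)
  also have "qh \<otimes>\<^bsub>R\<^esub> elt G ?q = qh"
    unfolding qh_def smult_mult elt_sQ_commute[OF gh_T(3)[OF q], symmetric] elt_Q_sQ[OF q] ..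
  finally show ?thesis by (simp add: coset_elt_def)
qed

lemma coset_elt_one: "coset_elt \<one> = qh"
  by (simp add: coset_elt_def one_QG[symmetric])

lemma e_eq: "e = (1 / 2) \<odot>\<^bsub>R\<^esub> (coset_elt \<one> \<ominus>\<^bsub>R\<^esub> coset_elt u)"
proof -
  have "e = (1 / 2) \<odot>\<^bsub>R\<^esub> (qh \<otimes>\<^bsub>R\<^esub> (\<one>\<^bsub>R\<^esub> \<ominus>\<^bsub>R\<^esub> elt G u))"
    by (simp add: e_def qh_def smult_mult smult_smult)
  also have "qh \<otimes>\<^bsub>R\<^esub> (\<one>\<^bsub>R\<^esub> \<ominus>\<^bsub>R\<^esub> elt G u) = coset_elt \<one> \<ominus>\<^bsub>R\<^esub> coset_elt u"
    unfolding coset_elt_one by (simp add: QG.minus_eq QG.r_distr QG.r_minus coset_elt_def)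
  finally show ?thesis .
qed

lemma e_elt: "x \<in> T \<Longrightarrow> e \<otimes>\<^bsub>R\<^esub> elt G x = (1 / 2) \<odot>\<^bsub>R\<^esub> (coset_elt x \<ominus>\<^bsub>R\<^esub> coset_elt (u \<otimes> x))"
proof -
  assume x: "x \<in> T"
  have c: "coset_elt y \<otimes>\<^bsub>R\<^esub> elt G x = coset_elt (y \<otimes> x)" if "y \<in> T" for y
    using x that by (simp add: coset_elt_def QG_mult_assoc elt_mult)
  show ?thesis using x c[of \<one>] c[of u]
    by (simp add: e_eq smult_mult QG.minus_eq QG.l_distr QG.l_minus)
qed

lemma elt_e: "x \<in> T \<Longrightarrow> elt G x \<otimes>\<^bsub>R\<^esub> e = e \<otimes>\<^bsub>R\<^esub> elt G x"
proof -
  assume x: "x \<in> T"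
  have c: "elt G x \<otimes>\<^bsub>R\<^esub> coset_elt y = coset_elt (x \<otimes> y)" if "y \<in> T" for y
    using x that elt_qh_commute[OF x]
    by (simp add: coset_elt_def elt_mult[symmetric] flip: QG_mult_assoc)
  have "coset_elt (x \<otimes> u) = coset_elt (u \<otimes> x)"
    using x u_central[OF coset_closed[OF x]] by (intro coset_elt_cong) (simp_all add: coset_mult)
  then show ?thesis using x c[of \<one>] c[of u]
    by (simp add: e_elt) (simp add: e_eq smult_mult QG.minus_eq QG.r_distr QG.r_minus)
qed

text \<open>Since \<open>e\<close> absorbs \<open>Q\<close>, products with \<open>e\<close> only see
  cosets. Relations that hold in the quotient group can thus be used in the corner of
  \<open>e\<close>.\<close>

lemma e_elt_cong: "x \<in> T \<Longrightarrow> y \<in> T \<Longrightarrow> Q #> x = Q #> y \<Longrightarrow> e \<otimes>\<^bsub>R\<^esub> elt G x = e \<otimes>\<^bsub>R\<^esub> elt G y"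
  using coset_elt_cong[of x y] coset_elt_cong[of "u \<otimes> x" "u \<otimes> y"]
  by (simp add: e_elt coset_mult)

text \<open>In the quotient \<open>u\<close> squares to 1, and \<open>e\<close> is the half
  difference of 1 and \<open>u\<close>, so multiplication by \<open>u\<close> reverses its sign.
  This is what makes \<open>g\<close> and \<open>h\<close> anticommute in the corner.\<close>

lemma e_u: "e \<otimes>\<^bsub>R\<^esub> elt G u = \<ominus>\<^bsub>R\<^esub> e"
proof -
  have "coset_elt (u \<otimes> u) = coset_elt \<one>" using uu_K by (intro coset_elt_cong) auto
  then have "e \<otimes>\<^bsub>R\<^esub> elt G u = (1 / 2) \<odot>\<^bsub>R\<^esub> (coset_elt u \<ominus>\<^bsub>R\<^esub> coset_elt \<one>)"
    using e_elt[OF u_T] by simp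
  also have "\<dots> = \<ominus>\<^bsub>R\<^esub> e"
    unfolding e_eq by (intro QG_eqI) (auto simp: QG_apply(2,4) QG_minus_apply QG.minus_eq field_simps)
  finally show ?thesis .
qed

lemma e_e: "e \<otimes>\<^bsub>R\<^esub> e = e"
proof -
  have e1: "e \<otimes>\<^bsub>R\<^esub> coset_elt y = e \<otimes>\<^bsub>R\<^esub> elt G y" if "y \<in> T" for y
  proof -
    have "coset_elt u \<otimes>\<^bsub>R\<^esub> coset_elt y = coset_elt u \<otimes>\<^bsub>R\<^esub> elt G y"
      "coset_elt \<one> \<otimes>\<^bsub>R\<^esub> coset_elt y = coset_elt \<one> \<otimes>\<^bsub>R\<^esub> elt G y"
      using that by (simp_all add: coset_elt_mult) (simp_all add: coset_elt_def QG_mult_assoc elt_mult)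
    then show ?thesis by (simp add: e_eq smult_mult QG.minus_eq QG.l_distr QG.l_minus)
  qed
  have "e \<otimes>\<^bsub>R\<^esub> e = (1 / 2) \<odot>\<^bsub>R\<^esub> (e \<otimes>\<^bsub>R\<^esub> coset_elt \<one> \<ominus>\<^bsub>R\<^esub> e \<otimes>\<^bsub>R\<^esub> coset_elt u)"
    by (subst (2) e_eq) (simp add: smult_mult QG.minus_eq QG.r_distr QG.r_minus)
  also have "\<dots> = (1 / 2) \<odot>\<^bsub>R\<^esub> (e \<ominus>\<^bsub>R\<^esub> (\<ominus>\<^bsub>R\<^esub> e))"
    by (simp add: e1 e_u) (simp add: one_QG[symmetric])
  also have "\<dots> = e"
    by (intro QG_eqI) (auto simp: QG_apply(2,4) QG_minus_apply QG.minus_eq)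
  finally show ?thesis .
qed

lemma e_Q: "q \<in> Q \<Longrightarrow> e \<otimes>\<^bsub>R\<^esub> elt G q = e"
  using e_elt_cong[of q \<one>] coset_eq_one_iff[of q] group_hom.hom_one[OF coset_hom]
  by (simp add: one_QG[symmetric])

lemma e_zero: "u \<in> Q \<Longrightarrow> e = \<zero>\<^bsub>R\<^esub>"
  using e_Q[of u] e_u by (intro eq_zero_if_eq_minus) auto

end

section \<open>Matrix units in the group ring\<close>

context finite_group begin

lemma power_sum_simps [simp]:
  "power_sum R x 0 = \<zero>\<^bsub>R\<^esub>"
  "x \<in> carrier R \<Longrightarrow> power_sum R x (Suc n) = x [^]\<^bsub>R\<^esub> n \<oplus>\<^bsub>R\<^esub> power_sum R x n"
  by (simp_all add: power_sum_def lessThan_Suc)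

lemma power_sum_shift:
  assumes "x \<in> carrier R"
  shows "x \<otimes>\<^bsub>R\<^esub> power_sum R x n \<oplus>\<^bsub>R\<^esub> \<one>\<^bsub>R\<^esub> = power_sum R x n \<oplus>\<^bsub>R\<^esub> x [^]\<^bsub>R\<^esub> n"
proof (induction n)
  case (Suc n)
  have "x \<otimes>\<^bsub>R\<^esub> x [^]\<^bsub>R\<^esub> n = x [^]\<^bsub>R\<^esub> Suc n" using assms by (simp only: QG.nat_pow_Suc2)
  then have "x \<otimes>\<^bsub>R\<^esub> power_sum R x (Suc n) \<oplus>\<^bsub>R\<^esub> \<one>\<^bsub>R\<^esub> =
      x [^]\<^bsub>R\<^esub> Suc n \<oplus>\<^bsub>R\<^esub> (x \<otimes>\<^bsub>R\<^esub> power_sum R x n \<oplus>\<^bsub>R\<^esub> \<one>\<^bsub>R\<^esub>)"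
    using assms by (simp add: QG.r_distr QG.a_assoc del: QG.nat_pow_Suc)
  also have "\<dots> = power_sum R x (Suc n) \<oplus>\<^bsub>R\<^esub> x [^]\<^bsub>R\<^esub> Suc n"
    unfolding Suc.IH using assms by (simp add: QG.a_ac del: QG.nat_pow_Suc)
  finally show ?case .
qed (use assms in simp)

lemma power_sum_commute:
  assumes "x \<in> carrier R" "y \<in> carrier R" "y \<otimes>\<^bsub>R\<^esub> x = x \<otimes>\<^bsub>R\<^esub> y"
  shows "y \<otimes>\<^bsub>R\<^esub> x [^]\<^bsub>R\<^esub> (n::nat) = x [^]\<^bsub>R\<^esub> n \<otimes>\<^bsub>R\<^esub> y"
    "y \<otimes>\<^bsub>R\<^esub> power_sum R x n = power_sum R x n \<otimes>\<^bsub>R\<^esub> y"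
proof -
  show pow: "y \<otimes>\<^bsub>R\<^esub> x [^]\<^bsub>R\<^esub> n = x [^]\<^bsub>R\<^esub> n \<otimes>\<^bsub>R\<^esub> y" for n :: nat
  proof (induction n)
    case (Suc n)
    have "y \<otimes>\<^bsub>R\<^esub> x [^]\<^bsub>R\<^esub> Suc n = (y \<otimes>\<^bsub>R\<^esub> x [^]\<^bsub>R\<^esub> n) \<otimes>\<^bsub>R\<^esub> x" by (simp add: QG_mult_assoc)
    also have "\<dots> = x [^]\<^bsub>R\<^esub> n \<otimes>\<^bsub>R\<^esub> (x \<otimes>\<^bsub>R\<^esub> y)" using assms(3) by (simp add: Suc QG_mult_assoc)
    finally show ?case by (simp add: QG_mult_assoc)
  qed (use assms in simp)
  show "y \<otimes>\<^bsub>R\<^esub> power_sum R x n = power_sum R x n \<otimes>\<^bsub>R\<^esub> y"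
    using assms by (induction n) (simp_all add: QG.r_distr QG.l_distr pow)
qed

lemma power_sum_fixed:
  assumes "x \<in> carrier R" "y \<in> carrier R" "x \<otimes>\<^bsub>R\<^esub> y = y"
  shows "power_sum R x n \<otimes>\<^bsub>R\<^esub> y = of_nat n \<odot>\<^bsub>R\<^esub> y"
proof -
  have pow: "x [^]\<^bsub>R\<^esub> n \<otimes>\<^bsub>R\<^esub> y = y" for n :: nat
    using assms by (induction n) (simp_all add: QG_mult_assoc)
  show ?thesis
    using assms by (induction n) (simp_all add: QG.l_distr pow add_smult)
qed

text \<open>In the corner of \<open>e\<close> the element \<open>x\<close> has order dividing
  \<open>n\<close>, and \<open>E\<close> averages its powers. By the telescoping relation
  \<open>power_sum_shift\<close>, \<open>x\<close> fixes this average. The statement is for general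
  \<open>x\<close> because both \<open>g\<close> and \<open>-g\<close> are needed.\<close>

lemma average_idempotent:
  assumes x: "x \<in> carrier R" and e: "e \<in> carrier R" "e \<otimes>\<^bsub>R\<^esub> e = e"
    and ex: "e \<otimes>\<^bsub>R\<^esub> x = x \<otimes>\<^bsub>R\<^esub> e" and exn: "e \<otimes>\<^bsub>R\<^esub> x [^]\<^bsub>R\<^esub> n = e" and n: "n > 0"
  defines "E \<equiv> (1 / of_nat n) \<odot>\<^bsub>R\<^esub> (e \<otimes>\<^bsub>R\<^esub> power_sum R x n)"
  shows "E \<in> carrier R" "x \<otimes>\<^bsub>R\<^esub> E = E" "E \<otimes>\<^bsub>R\<^esub> x = E" "e \<otimes>\<^bsub>R\<^esub> E = E" "E \<otimes>\<^bsub>R\<^esub> e = E" "E \<otimes>\<^bsub>R\<^esub> E = E"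
proof -
  let ?P = "power_sum R x n"
  have P: "?P \<in> carrier R" using x by simp
  show E: "E \<in> carrier R" by (simp add: E_def)
  have comm: "x \<otimes>\<^bsub>R\<^esub> ?P = ?P \<otimes>\<^bsub>R\<^esub> x" "e \<otimes>\<^bsub>R\<^esub> ?P = ?P \<otimes>\<^bsub>R\<^esub> e"
    using power_sum_commute x e ex by auto
  show eE: "e \<otimes>\<^bsub>R\<^esub> E = E" using e by (simp add: E_def smult_mult flip: QG_mult_assoc)
  show Ee: "E \<otimes>\<^bsub>R\<^esub> e = E" using e comm by (simp add: E_def smult_mult QG_mult_assoc)
  have xP: "e \<otimes>\<^bsub>R\<^esub> (x \<otimes>\<^bsub>R\<^esub> ?P) = e \<otimes>\<^bsub>R\<^esub> ?P"
  proof -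
    have "e \<otimes>\<^bsub>R\<^esub> (x \<otimes>\<^bsub>R\<^esub> ?P) \<oplus>\<^bsub>R\<^esub> e = e \<otimes>\<^bsub>R\<^esub> (x \<otimes>\<^bsub>R\<^esub> ?P \<oplus>\<^bsub>R\<^esub> \<one>\<^bsub>R\<^esub>)"
      using e by (simp add: QG.r_distr)
    also have "\<dots> = e \<otimes>\<^bsub>R\<^esub> ?P \<oplus>\<^bsub>R\<^esub> e"
      unfolding power_sum_shift[OF x] using x e P exn by (simp add: QG.r_distr)
    finally show ?thesis using e by simp
  qed
  have "x \<otimes>\<^bsub>R\<^esub> (e \<otimes>\<^bsub>R\<^esub> ?P) = e \<otimes>\<^bsub>R\<^esub> ?P"
    using xP ex by (simp flip: QG_mult_assoc)
  then show xE: "x \<otimes>\<^bsub>R\<^esub> E = E" by (simp add: E_def smult_mult)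
  have "(e \<otimes>\<^bsub>R\<^esub> ?P) \<otimes>\<^bsub>R\<^esub> x = e \<otimes>\<^bsub>R\<^esub> ?P"
    using xP comm(1) by (simp add: QG_mult_assoc)
  then show "E \<otimes>\<^bsub>R\<^esub> x = E" by (simp add: E_def smult_mult)
  have "E \<otimes>\<^bsub>R\<^esub> E = (1 / of_nat n) \<odot>\<^bsub>R\<^esub> (e \<otimes>\<^bsub>R\<^esub> (?P \<otimes>\<^bsub>R\<^esub> E))"
    by (subst (1) E_def) (simp add: smult_mult QG_mult_assoc)
  also have "\<dots> = E"
    unfolding power_sum_fixed[OF x E xE] using n E eE by (simp add: smult_mult smult_smult)
  finally show "E \<otimes>\<^bsub>R\<^esub> E = E" .
qed

lemma minus_pow_even:
  assumes "x \<in> carrier R" "even (n::nat)"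
  shows "(\<ominus>\<^bsub>R\<^esub> x) [^]\<^bsub>R\<^esub> n = x [^]\<^bsub>R\<^esub> n"
proof -
  have "(\<ominus>\<^bsub>R\<^esub> x) [^]\<^bsub>R\<^esub> (2 * k) = x [^]\<^bsub>R\<^esub> (2 * k)" for k :: nat
    using assms(1) by (induction k) (simp_all add: QG_mult_assoc QG.l_minus QG.r_minus)
  then show ?thesis using assms(2) by (auto elim!: evenE)
qed

end

text \<open>\<open>F11\<close> and \<open>F22\<close> need not add up to the identity of the ring.
  All units may be zero, so that the degenerate case is an instance; injectivity is stated
  separately for nonzero \<open>F11\<close>.\<close>

locale matrix_units = finite_group +
  fixes F11 F12 F21 F22
  assumes F_closed [simp]: "F11 \<in> carrier (QG G)" "F12 \<in> carrier (QG G)"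
      "F21 \<in> carrier (QG G)" "F22 \<in> carrier (QG G)"
    and F_mult [simp]:
      "F11 \<otimes>\<^bsub>QG G\<^esub> F11 = F11" "F11 \<otimes>\<^bsub>QG G\<^esub> F12 = F12" "F11 \<otimes>\<^bsub>QG G\<^esub> F21 = \<zero>\<^bsub>QG G\<^esub>" "F11 \<otimes>\<^bsub>QG G\<^esub> F22 = \<zero>\<^bsub>QG G\<^esub>"
      "F12 \<otimes>\<^bsub>QG G\<^esub> F11 = \<zero>\<^bsub>QG G\<^esub>" "F12 \<otimes>\<^bsub>QG G\<^esub> F12 = \<zero>\<^bsub>QG G\<^esub>" "F12 \<otimes>\<^bsub>QG G\<^esub> F21 = F11" "F12 \<otimes>\<^bsub>QG G\<^esub> F22 = F12"
      "F21 \<otimes>\<^bsub>QG G\<^esub> F11 = F21" "F21 \<otimes>\<^bsub>QG G\<^esub> F12 = F22" "F21 \<otimes>\<^bsub>QG G\<^esub> F21 = \<zero>\<^bsub>QG G\<^esub>" "F21 \<otimes>\<^bsub>QG G\<^esub> F22 = \<zero>\<^bsub>QG G\<^esub>"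
      "F22 \<otimes>\<^bsub>QG G\<^esub> F11 = \<zero>\<^bsub>QG G\<^esub>" "F22 \<otimes>\<^bsub>QG G\<^esub> F12 = \<zero>\<^bsub>QG G\<^esub>" "F22 \<otimes>\<^bsub>QG G\<^esub> F21 = F21" "F22 \<otimes>\<^bsub>QG G\<^esub> F22 = F22"
begin

definition lincomb :: "rat \<Rightarrow> rat \<Rightarrow> rat \<Rightarrow> rat \<Rightarrow> 'a \<Rightarrow> rat" where
  "lincomb p q r s = p \<odot>\<^bsub>R\<^esub> F11 \<oplus>\<^bsub>R\<^esub> q \<odot>\<^bsub>R\<^esub> F12 \<oplus>\<^bsub>R\<^esub> r \<odot>\<^bsub>R\<^esub> F21 \<oplus>\<^bsub>R\<^esub> s \<odot>\<^bsub>R\<^esub> F22"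

lemma lincomb_closed [simp]: "lincomb p q r s \<in> carrier R"
  by (simp add: lincomb_def)

lemma lincomb_apply:
  "x \<in> carrier G \<Longrightarrow> lincomb p q r s x = p * F11 x + q * F12 x + r * F21 x + s * F22 x"
  by (simp add: lincomb_def QG_apply(2,4))

lemma F_lincomb:
  "F11 \<otimes>\<^bsub>R\<^esub> lincomb p q r s = lincomb p q 0 0" "F12 \<otimes>\<^bsub>R\<^esub> lincomb p q r s = lincomb r s 0 0"
  "F21 \<otimes>\<^bsub>R\<^esub> lincomb p q r s = lincomb 0 0 p q" "F22 \<otimes>\<^bsub>R\<^esub> lincomb p q r s = lincomb 0 0 r s"
  by (simp_all add: lincomb_def QG.r_distr smult_mult)

lemma lincomb_mult:
  "lincomb p q r s \<otimes>\<^bsub>R\<^esub> lincomb p' q' r' s' =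
    lincomb (p * p' + q * r') (p * q' + q * s') (r * p' + s * r') (r * q' + s * s')"
proof -
  have "lincomb p q r s \<otimes>\<^bsub>R\<^esub> lincomb p' q' r' s' =
      p \<odot>\<^bsub>R\<^esub> lincomb p' q' 0 0 \<oplus>\<^bsub>R\<^esub> q \<odot>\<^bsub>R\<^esub> lincomb r' s' 0 0 \<oplus>\<^bsub>R\<^esub> r \<odot>\<^bsub>R\<^esub> lincomb 0 0 p' q' \<oplus>\<^bsub>R\<^esub>
        s \<odot>\<^bsub>R\<^esub> lincomb 0 0 r' s'"
    by (subst (1) lincomb_def) (simp add: QG.l_distr smult_mult F_lincomb)
  also have "\<dots> = lincomb (p * p' + q * r') (p * q' + q * s') (r * p' + s * r') (r * q' + s * s')"
    by (rule QG_eqI) (simp_all add: QG_apply(2,4) lincomb_apply algebra_simps)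
  finally show ?thesis .
qed

text \<open>The matrix acts in the corner cut out by \<open>F11\<close> and \<open>F22\<close> and
  is completed by the identity on the complement. Hence 1 is subtracted on the diagonal and added
  again in the whole ring.\<close>

definition rho :: "rat mat2 \<Rightarrow> 'a \<Rightarrow> rat" where
  "rho = (\<lambda>(a, b, c, d). \<one>\<^bsub>R\<^esub> \<oplus>\<^bsub>R\<^esub> lincomb (a - 1) b c (d - 1))"

lemma rho_closed [simp]: "rho M \<in> carrier R"
  by (simp add: rho_def split: prod.split)

lemma rho_mult: "rho (M \<otimes>\<^bsub>SL2\<^esub> N) = rho M \<otimes>\<^bsub>R\<^esub> rho N"
proof -
  obtain a b c d where M: "M = (a, b, c, d)" by (cases M rule: prod_cases4)
  obtain a' b' c' d' where N: "N = (a', b', c', d')" by (cases N rule: prod_cases4)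
  have "rho M \<otimes>\<^bsub>R\<^esub> rho N = \<one>\<^bsub>R\<^esub> \<oplus>\<^bsub>R\<^esub> lincomb (a' - 1) b' c' (d' - 1) \<oplus>\<^bsub>R\<^esub> (lincomb (a - 1) b c (d - 1) \<oplus>\<^bsub>R\<^esub>
      lincomb (a - 1) b c (d - 1) \<otimes>\<^bsub>R\<^esub> lincomb (a' - 1) b' c' (d' - 1))"
    by (simp add: M N rho_def QG.l_distr QG.r_distr QG.a_ac)
  also have "\<dots> = rho (M \<otimes>\<^bsub>SL2\<^esub> N)"
    unfolding lincomb_mult
    by (rule QG_eqI) (simp_all add: M N mult_SL2 rho_def QG_apply(2) lincomb_apply algebra_simps)
  finally show ?thesis by simp
qed

lemma rho_one: "rho \<one>\<^bsub>SL2\<^esub> = \<one>\<^bsub>R\<^esub>"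
  by (rule QG_eqI) (simp_all add: rho_def one_SL2 QG_apply(2) lincomb_apply)

text \<open>Multiplying by \<open>F11\<close> or \<open>F12\<close> on the left and by
  \<open>F11\<close> or \<open>F21\<close> on the right turns each coefficient into the coefficient
  of \<open>F11\<close>.\<close>

lemma lincomb_eq_zero:
  assumes "F11 \<noteq> \<zero>\<^bsub>R\<^esub>" and zero: "lincomb p q r s = \<zero>\<^bsub>R\<^esub>"
  shows "p = 0 \<and> q = 0 \<and> r = 0 \<and> s = 0"
proof -
  have zero_coeff: "k = 0" if "k \<odot>\<^bsub>R\<^esub> F11 = \<zero>\<^bsub>R\<^esub>" for k
  proof (rule ccontr)
    assume "k \<noteq> 0"
    then have "F11 = (1 / k) \<odot>\<^bsub>R\<^esub> (k \<odot>\<^bsub>R\<^esub> F11)" by (simp add: smult_smult)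
    with that assms(1) show False by simp
  qed
  have F: "F11 \<otimes>\<^bsub>R\<^esub> lincomb p q r s \<otimes>\<^bsub>R\<^esub> F11 = p \<odot>\<^bsub>R\<^esub> F11"
    "F11 \<otimes>\<^bsub>R\<^esub> lincomb p q r s \<otimes>\<^bsub>R\<^esub> F21 = q \<odot>\<^bsub>R\<^esub> F11"
    "F12 \<otimes>\<^bsub>R\<^esub> lincomb p q r s \<otimes>\<^bsub>R\<^esub> F11 = r \<odot>\<^bsub>R\<^esub> F11"
    "F12 \<otimes>\<^bsub>R\<^esub> lincomb p q r s \<otimes>\<^bsub>R\<^esub> F21 = s \<odot>\<^bsub>R\<^esub> F11"
    unfolding F_lincomb by (simp_all add: lincomb_def QG.l_distr smult_mult)
  show ?thesis
    using F zero_coeff[of p] zero_coeff[of q] zero_coeff[of r] zero_coeff[of s]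
    unfolding zero QG.l_null[OF F_closed(1)] QG.r_null[OF F_closed(1)] QG.r_null[OF F_closed(2)] by (simp add: eq_commute[of "\<zero>\<^bsub>R\<^esub>"])
qed

lemma rho_inj:
  assumes "F11 \<noteq> \<zero>\<^bsub>R\<^esub>" "rho M = rho N"
  shows "M = N"
proof -
  obtain a b c d where M: "M = (a, b, c, d)" by (cases M rule: prod_cases4)
  obtain a' b' c' d' where N: "N = (a', b', c', d')" by (cases N rule: prod_cases4)
  have "lincomb (a - a') (b - b') (c - c') (d - d') = \<zero>\<^bsub>R\<^esub>"
  proof (rule QG_eqI)
    fix x assume x: "x \<in> carrier G"
    have "rho M x = rho N x" using assms(2) by simp
    then show "lincomb (a - a') (b - b') (c - c') (d - d') x = \<zero>\<^bsub>R\<^esub> x"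
      using x by (simp add: M N rho_def QG_apply(2,3) lincomb_apply algebra_simps)
  qed auto
  from lincomb_eq_zero[OF assms(1) this] show ?thesis by (simp add: M N)
qed

end

text \<open>Over a field, \<open>SL2\<close> is generated by elementary matrices, and these are commutators.\<close>

lemma SL2_rat_character_trivial:
  fixes f :: "rat mat2 \<Rightarrow> 'b::comm_ring_1"
  assumes mult: "\<And>M N. M \<in> carrier SL2 \<Longrightarrow> N \<in> carrier SL2 \<Longrightarrow> f (M \<otimes>\<^bsub>SL2\<^esub> N) = f M * f N"
    and one: "f \<one>\<^bsub>SL2\<^esub> = 1" and M: "M \<in> carrier SL2"
  shows "f M = 1"
proof -
  have inv: "f N * f (inv\<^bsub>SL2\<^esub> N) = 1" if "N \<in> carrier SL2" for N
    using that group.r_inv[OF group_SL2 that] mult[of N "inv\<^bsub>SL2\<^esub> N"] one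
      group.inv_closed[OF group_SL2 that] by simp
  have comm: "f (A \<otimes>\<^bsub>SL2\<^esub> B \<otimes>\<^bsub>SL2\<^esub> (inv\<^bsub>SL2\<^esub> A \<otimes>\<^bsub>SL2\<^esub> inv\<^bsub>SL2\<^esub> B)) = 1"
    if "A \<in> carrier SL2" "B \<in> carrier SL2" for A B
  proof -
    have ic: "inv\<^bsub>SL2\<^esub> A \<in> carrier SL2" "inv\<^bsub>SL2\<^esub> B \<in> carrier SL2"
      using that by (simp_all add: group.inv_closed[OF group_SL2])
    have "f (A \<otimes>\<^bsub>SL2\<^esub> B \<otimes>\<^bsub>SL2\<^esub> (inv\<^bsub>SL2\<^esub> A \<otimes>\<^bsub>SL2\<^esub> inv\<^bsub>SL2\<^esub> B)) =
        (f A * f (inv\<^bsub>SL2\<^esub> A)) * (f B * f (inv\<^bsub>SL2\<^esub> B))"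
      using that ic by (simp add: mult mult_SL2_closed mult_ac)
    then show ?thesis using inv that by simp
  qed
  let ?D = "(2, 0, 0, 1 / 2) :: rat mat2"
  have D: "?D \<in> carrier SL2" by (simp add: carrier_SL2)
  have upper: "f (1, t, 0, 1) = 1" for t
  proof -
    \<comment> \<open>Conjugation by \<open>?D\<close> multiplies the parameter of the shear by 4,
      so the commutator has parameter \<open>4 * t / 3 - t / 3\<close>, which is
      \<open>t\<close>.\<close>
    have "(1, t, 0, 1) = ?D \<otimes>\<^bsub>SL2\<^esub> (1, t / 3, 0, 1) \<otimes>\<^bsub>SL2\<^esub> (inv\<^bsub>SL2\<^esub> ?D \<otimes>\<^bsub>SL2\<^esub> inv\<^bsub>SL2\<^esub> (1, t / 3, 0, 1))"
      by (simp add: inv_SL2 carrier_SL2 mult_SL2)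
    then show ?thesis using comm[OF D, of "(1, t / 3, 0, 1)"] by (simp add: carrier_SL2)
  qed
  have lower: "f (1, 0, t, 1) = 1" for t
  proof -
    have "(1, 0, t, 1) = (1, 0, - t / 3, 1) \<otimes>\<^bsub>SL2\<^esub> inv\<^bsub>SL2\<^esub> ?D \<otimes>\<^bsub>SL2\<^esub>
        (inv\<^bsub>SL2\<^esub> (1, 0, - t / 3, 1) \<otimes>\<^bsub>SL2\<^esub> inv\<^bsub>SL2\<^esub> (inv\<^bsub>SL2\<^esub> ?D))"
      by (simp add: inv_SL2 carrier_SL2 mult_SL2)
    then show ?thesis using comm[of "(1, 0, - t / 3, 1)" "inv\<^bsub>SL2\<^esub> ?D"] D
      by (simp add: carrier_SL2 group.inv_closed[OF group_SL2])
  qed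
  \<comment> \<open>Elimination with the pivot \<open>c\<close> gives a product of three elementary
    matrices.\<close>
  have main: "f (a, b, c, d) = 1" if "(a, b, c, d) \<in> carrier SL2" "c \<noteq> 0" for a b c d
  proof -
    have b: "b = (a * d - 1) / c" using that by (simp add: carrier_SL2 field_simps)
    have "(a, b, c, d) = (1, (a - 1) / c, 0, 1) \<otimes>\<^bsub>SL2\<^esub> ((1, 0, c, 1) \<otimes>\<^bsub>SL2\<^esub> (1, (d - 1) / c, 0, 1))"
      using that(2) unfolding b by (simp add: mult_SL2 field_simps)
    then show ?thesis by (simp add: mult mult_SL2_closed carrier_SL2 upper lower)
  qed
  obtain a b c d where abcd: "M = (a, b, c, d)" by (cases M rule: prod_cases4)
  show ?thesis
  proof (cases "c = 0")
    case False
    with main M show ?thesis by (simp add: abcd)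
  next
    case True
    then have "a \<noteq> 0" using M by (auto simp: abcd carrier_SL2)
    \<comment> \<open>Adding the top row to the bottom row leads to the case of a nonzero lower left
      entry, because \<open>a\<close> is nonzero.\<close>
    have E: "(1, 0, 1, 1) \<in> carrier (SL2 :: rat mat2 monoid)" by (simp add: carrier_SL2)
    have p: "(1, 0, 1, 1) \<otimes>\<^bsub>SL2\<^esub> M = (a, b, a, b + d)" using True by (simp add: abcd mult_SL2)
    have "f ((1, 0, 1, 1) \<otimes>\<^bsub>SL2\<^esub> M) = 1"
      using main[of a b a "b + d"] mult_SL2_closed[OF E M] \<open>a \<noteq> 0\<close> unfolding p by simp
    then show ?thesis using mult[OF E M] lower[of 1] by simp
  qed
qed

section \<open>The matrix units of a triple\<close>

context unit_triple begin

abbreviation "a \<equiv> elt G g"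
abbreviation "b \<equiv> elt G h"

lemma e_ab: "e \<otimes>\<^bsub>R\<^esub> (a \<otimes>\<^bsub>R\<^esub> b) = e \<otimes>\<^bsub>R\<^esub> (b \<otimes>\<^bsub>R\<^esub> \<ominus>\<^bsub>R\<^esub> a)"
proof -
  have "e \<otimes>\<^bsub>R\<^esub> (a \<otimes>\<^bsub>R\<^esub> b) = e \<otimes>\<^bsub>R\<^esub> elt G (u \<otimes> (h \<otimes> g))"
    unfolding elt_mult[OF g_closed h_closed] using gh_K by (intro e_elt_cong) auto
  also have "\<dots> = (e \<otimes>\<^bsub>R\<^esub> elt G u) \<otimes>\<^bsub>R\<^esub> (b \<otimes>\<^bsub>R\<^esub> a)"
    by (simp add: elt_mult QG_mult_assoc)
  finally show ?thesis by (simp add: e_u QG.l_minus QG.r_minus)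
qed

lemma e_bb: "e \<otimes>\<^bsub>R\<^esub> (b \<otimes>\<^bsub>R\<^esub> b) = e"
  unfolding elt_mult[OF h_closed h_closed]
  using coset_eq_one_iff[of "h \<otimes> h"] hh_K by (intro e_Q) (simp add: coset_mult)

lemma e_comm: "e \<otimes>\<^bsub>R\<^esub> a = a \<otimes>\<^bsub>R\<^esub> e" "e \<otimes>\<^bsub>R\<^esub> b = b \<otimes>\<^bsub>R\<^esub> e"
  "e \<otimes>\<^bsub>R\<^esub> \<ominus>\<^bsub>R\<^esub> a = \<ominus>\<^bsub>R\<^esub> a \<otimes>\<^bsub>R\<^esub> e"
  by (simp_all add: elt_e QG.l_minus QG.r_minus)

lemma e_am: "e \<otimes>\<^bsub>R\<^esub> a [^]\<^bsub>R\<^esub> m = e"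
  by (simp add: elt_pow e_Q g_pow_Q)

text \<open>For odd \<open>m\<close> the sign would be wrong, but then \<open>u\<close> lies in
  \<open>Q\<close> and \<open>e\<close> is zero.\<close>

lemma e_minus_am: "e \<otimes>\<^bsub>R\<^esub> (\<ominus>\<^bsub>R\<^esub> a) [^]\<^bsub>R\<^esub> m = e"
proof (cases "even m")
  case True
  then show ?thesis using e_am by (simp add: minus_pow_even)
next
  case False
  then show ?thesis using e_zero[OF u_odd] by simp
qed

definition A where "A = (1 / of_nat m) \<odot>\<^bsub>R\<^esub> (e \<otimes>\<^bsub>R\<^esub> power_sum R a m)"
definition B where "B = (1 / of_nat m) \<odot>\<^bsub>R\<^esub> (e \<otimes>\<^bsub>R\<^esub> power_sum R (\<ominus>\<^bsub>R\<^esub> a) m)"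

lemmas A_rules = average_idempotent[OF QG_closed(6) e_closed e_e e_comm(1) e_am m_pos, folded A_def]
lemmas B_rules = average_idempotent[OF QG.a_inv_closed[OF QG_closed(6)] e_closed e_e e_comm(3) e_minus_am m_pos,
    folded B_def]

text \<open>Multiplication by \<open>a\<close> fixes \<open>A\<close> and reverses the sign of
  \<open>B\<close>, so inserting \<open>a\<close> between the factors shows that both products equal
  their negatives.\<close>

lemma AB: "A \<otimes>\<^bsub>R\<^esub> B = \<zero>\<^bsub>R\<^esub>" and BA: "B \<otimes>\<^bsub>R\<^esub> A = \<zero>\<^bsub>R\<^esub>"
proof -
  have aB: "a \<otimes>\<^bsub>R\<^esub> B = \<ominus>\<^bsub>R\<^esub> B" "B \<otimes>\<^bsub>R\<^esub> a = \<ominus>\<^bsub>R\<^esub> B"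
    using B_rules(1) arg_cong[OF B_rules(2), of "\<lambda>x. \<ominus>\<^bsub>R\<^esub> x"] arg_cong[OF B_rules(3), of "\<lambda>x. \<ominus>\<^bsub>R\<^esub> x"]
    by (simp_all add: QG.l_minus QG.r_minus)
  have "A \<otimes>\<^bsub>R\<^esub> B = (A \<otimes>\<^bsub>R\<^esub> a) \<otimes>\<^bsub>R\<^esub> B" using A_rules(3) by simp
  also have "\<dots> = \<ominus>\<^bsub>R\<^esub> (A \<otimes>\<^bsub>R\<^esub> B)" using A_rules(1) B_rules(1) by (simp add: QG_mult_assoc aB QG.r_minus)
  finally show "A \<otimes>\<^bsub>R\<^esub> B = \<zero>\<^bsub>R\<^esub>" by (intro eq_zero_if_eq_minus) auto
  have "B \<otimes>\<^bsub>R\<^esub> A = B \<otimes>\<^bsub>R\<^esub> (a \<otimes>\<^bsub>R\<^esub> A)" using A_rules(2) by simp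
  also have "\<dots> = (B \<otimes>\<^bsub>R\<^esub> a) \<otimes>\<^bsub>R\<^esub> A" by (simp add: QG_mult_assoc)
  also have "\<dots> = \<ominus>\<^bsub>R\<^esub> (B \<otimes>\<^bsub>R\<^esub> A)" using A_rules(1) B_rules(1) by (simp add: aB QG.l_minus)
  finally show "B \<otimes>\<^bsub>R\<^esub> A = \<zero>\<^bsub>R\<^esub>" by (intro eq_zero_if_eq_minus) auto
qed

lemma Ab: "A \<otimes>\<^bsub>R\<^esub> b = b \<otimes>\<^bsub>R\<^esub> B"
proof -
  let ?c = "\<ominus>\<^bsub>R\<^esub> a"
  have pow: "e \<otimes>\<^bsub>R\<^esub> (a [^]\<^bsub>R\<^esub> n \<otimes>\<^bsub>R\<^esub> b) = e \<otimes>\<^bsub>R\<^esub> (b \<otimes>\<^bsub>R\<^esub> ?c [^]\<^bsub>R\<^esub> n)" for n :: nat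
  proof (induction n)
    case (Suc n)
    have en: "e \<otimes>\<^bsub>R\<^esub> a [^]\<^bsub>R\<^esub> n = a [^]\<^bsub>R\<^esub> n \<otimes>\<^bsub>R\<^esub> e" using power_sum_commute e_comm by simp
    have "e \<otimes>\<^bsub>R\<^esub> (a [^]\<^bsub>R\<^esub> Suc n \<otimes>\<^bsub>R\<^esub> b) = (e \<otimes>\<^bsub>R\<^esub> a [^]\<^bsub>R\<^esub> n) \<otimes>\<^bsub>R\<^esub> (a \<otimes>\<^bsub>R\<^esub> b)"
      by (simp add: QG_mult_assoc)
    also have "\<dots> = a [^]\<^bsub>R\<^esub> n \<otimes>\<^bsub>R\<^esub> (e \<otimes>\<^bsub>R\<^esub> (b \<otimes>\<^bsub>R\<^esub> ?c))"
      unfolding en QG_mult_assoc e_ab ..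
    also have "\<dots> = (a [^]\<^bsub>R\<^esub> n \<otimes>\<^bsub>R\<^esub> e) \<otimes>\<^bsub>R\<^esub> (b \<otimes>\<^bsub>R\<^esub> ?c)"
      by (simp only: QG_mult_assoc)
    also have "\<dots> = (e \<otimes>\<^bsub>R\<^esub> (a [^]\<^bsub>R\<^esub> n \<otimes>\<^bsub>R\<^esub> b)) \<otimes>\<^bsub>R\<^esub> ?c"
      unfolding en[symmetric] by (simp only: QG_mult_assoc)
    also have "\<dots> = e \<otimes>\<^bsub>R\<^esub> (b \<otimes>\<^bsub>R\<^esub> ?c [^]\<^bsub>R\<^esub> Suc n)"
      unfolding Suc.IH by (simp only: QG_mult_assoc QG.nat_pow_Suc)
    finally show ?case .
  qed simp
  have "e \<otimes>\<^bsub>R\<^esub> (power_sum R a n \<otimes>\<^bsub>R\<^esub> b) = e \<otimes>\<^bsub>R\<^esub> (b \<otimes>\<^bsub>R\<^esub> power_sum R ?c n)" for n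
    by (induction n) (simp_all add: QG.l_distr QG.r_distr pow)
  then have "A \<otimes>\<^bsub>R\<^esub> b = (1 / of_nat m) \<odot>\<^bsub>R\<^esub> ((e \<otimes>\<^bsub>R\<^esub> b) \<otimes>\<^bsub>R\<^esub> power_sum R ?c m)"
    by (simp add: A_def smult_mult QG_mult_assoc)
  then show ?thesis by (simp only: e_comm B_def smult_mult QG_mult_assoc)
qed

lemma bb_cancel: "x \<in> carrier R \<Longrightarrow> e \<otimes>\<^bsub>R\<^esub> x = x \<Longrightarrow> b \<otimes>\<^bsub>R\<^esub> (b \<otimes>\<^bsub>R\<^esub> x) = x"
proof -
  assume x: "x \<in> carrier R" "e \<otimes>\<^bsub>R\<^esub> x = x"
  have bbe: "b \<otimes>\<^bsub>R\<^esub> (b \<otimes>\<^bsub>R\<^esub> e) = e" using e_bb e_comm(2) by (metis QG_mult_assoc)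
  have "b \<otimes>\<^bsub>R\<^esub> (b \<otimes>\<^bsub>R\<^esub> x) = (b \<otimes>\<^bsub>R\<^esub> (b \<otimes>\<^bsub>R\<^esub> e)) \<otimes>\<^bsub>R\<^esub> x"
    by (simp only: QG_mult_assoc x(2))
  then show ?thesis unfolding bbe x(2) .
qed

lemma bA: "b \<otimes>\<^bsub>R\<^esub> A = B \<otimes>\<^bsub>R\<^esub> b"
proof -
  have "A = A \<otimes>\<^bsub>R\<^esub> (e \<otimes>\<^bsub>R\<^esub> (b \<otimes>\<^bsub>R\<^esub> b))" unfolding e_bb A_rules(5) ..
  also have "\<dots> = (A \<otimes>\<^bsub>R\<^esub> b) \<otimes>\<^bsub>R\<^esub> b" by (simp only: QG_mult_assoc[symmetric] A_rules(5))
  finally have "b \<otimes>\<^bsub>R\<^esub> A = (b \<otimes>\<^bsub>R\<^esub> (b \<otimes>\<^bsub>R\<^esub> B)) \<otimes>\<^bsub>R\<^esub> b" by (simp only: Ab QG_mult_assoc)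
  then show ?thesis unfolding bb_cancel[OF B_rules(1,4)] .
qed

lemma bb_A: "b \<otimes>\<^bsub>R\<^esub> (b \<otimes>\<^bsub>R\<^esub> A) = A" "b \<otimes>\<^bsub>R\<^esub> (b \<otimes>\<^bsub>R\<^esub> B) = B"
  using bb_cancel A_rules B_rules by auto

lemma AbX: "A \<otimes>\<^bsub>R\<^esub> (b \<otimes>\<^bsub>R\<^esub> x) = b \<otimes>\<^bsub>R\<^esub> (B \<otimes>\<^bsub>R\<^esub> x)" "B \<otimes>\<^bsub>R\<^esub> (b \<otimes>\<^bsub>R\<^esub> x) = b \<otimes>\<^bsub>R\<^esub> (A \<otimes>\<^bsub>R\<^esub> x)"
  using Ab bA by (metis QG_mult_assoc)+

text \<open>As \<open>b\<close> moves past \<open>A\<close> and \<open>B\<close> by exchanging them,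
  and cancels against itself on both, the sixteen products reduce to those of \<open>A\<close> and
  \<open>B\<close> among themselves.\<close>

sublocale MU: matrix_units G B "b \<otimes>\<^bsub>R\<^esub> A" "b \<otimes>\<^bsub>R\<^esub> B" A
  by unfold_locales
    (simp_all add: A_rules(1,6) B_rules(1,6) QG_mult_assoc AbX AB BA bb_A)

text \<open>The factor \<open>m\<close> in the entries arises because \<open>v_elt\<close> contains
  sums of \<open>m\<close> powers, whereas \<open>A\<close> and \<open>B\<close> are the
  averages.\<close>

lemma v_elt_eq:
  "v_elt G g h Q (x1, x2, y1, y2) = MU.rho (1 + of_nat m * of_int y1, of_nat m * of_int x2,
     of_nat m * of_int x1, 1 + of_nat m * of_int y2)"
proof -
  have scale: "e \<otimes>\<^bsub>R\<^esub> power_sum R a m = of_nat m \<odot>\<^bsub>R\<^esub> A"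
    "e \<otimes>\<^bsub>R\<^esub> power_sum R (\<ominus>\<^bsub>R\<^esub> a) m = of_nat m \<odot>\<^bsub>R\<^esub> B"
    using m_pos by (simp_all add: A_def B_def smult_smult)
  have eb: "e \<otimes>\<^bsub>R\<^esub> (b \<otimes>\<^bsub>R\<^esub> x) = b \<otimes>\<^bsub>R\<^esub> (e \<otimes>\<^bsub>R\<^esub> x)" for x
    using e_comm(2) by (metis QG_mult_assoc)
  have "v_elt G g h Q (x1, x2, y1, y2) = \<one>\<^bsub>R\<^esub> \<oplus>\<^bsub>R\<^esub> e \<otimes>\<^bsub>R\<^esub>
      (b \<otimes>\<^bsub>R\<^esub> (of_int x1 \<odot>\<^bsub>R\<^esub> power_sum R (\<ominus>\<^bsub>R\<^esub> a) m \<oplus>\<^bsub>R\<^esub> of_int x2 \<odot>\<^bsub>R\<^esub> power_sum R a m) \<oplus>\<^bsub>R\<^esub>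
       of_int y1 \<odot>\<^bsub>R\<^esub> power_sum R (\<ominus>\<^bsub>R\<^esub> a) m \<oplus>\<^bsub>R\<^esub> of_int y2 \<odot>\<^bsub>R\<^esub> power_sum R a m)"
    by (simp add: v_elt_def Let_def e_def sQ_def smult_mult)
  also have "\<dots> = \<one>\<^bsub>R\<^esub> \<oplus>\<^bsub>R\<^esub> MU.lincomb (of_nat m * of_int y1) (of_nat m * of_int x2) (of_nat m * of_int x1) (of_nat m * of_int y2)"
    unfolding MU.lincomb_def
    by (simp add: QG.r_distr smult_mult eb scale smult_smult QG.a_ac mult.commute)
  finally show ?thesis by (simp add: MU.rho_def)
qed

text \<open>Modulo \<open>Q\<close> the commutator is a power of \<open>g\<close>, which fixes
  \<open>A\<close>. But the commutator acts as -1 in the corner of \<open>e\<close>, so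
  \<open>A\<close> equals its negative, and \<open>h\<close> carries this over to
  \<open>B\<close>.\<close>

lemma degenerate:
  assumes "u \<in> generate G {g} <#> Q"
  shows "A = \<zero>\<^bsub>R\<^esub>" "B = \<zero>\<^bsub>R\<^esub>"
proof -
  obtain x q where x: "x \<in> generate G {g}" and q: "q \<in> Q" and u: "u = x \<otimes> q"
    using assms by (auto simp: set_mult_def)
  obtain k :: nat where k: "x = g [^] k"
    using x generate_pow_on_finite_carrier[OF finite_carrier g_closed] by auto
  have aA: "a [^]\<^bsub>R\<^esub> n \<otimes>\<^bsub>R\<^esub> A = A" for n :: nat
    using A_rules(1,2) by (induction n) (simp_all add: QG_mult_assoc)
  have "q \<in> T" "x \<in> T" "x \<in> carrier G" using q k by auto
  have "Q #> (x \<otimes> q) = Q #> x"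
    using \<open>q \<in> T\<close> \<open>x \<in> T\<close> coset_eq_one_iff[of q] q group.is_monoid[OF group_K] coset_closed
    by (simp add: coset_mult monoid.r_one)
  then have "e \<otimes>\<^bsub>R\<^esub> elt G u = e \<otimes>\<^bsub>R\<^esub> a [^]\<^bsub>R\<^esub> k"
    unfolding u elt_pow[OF g_closed] k[symmetric]
    using \<open>q \<in> T\<close> \<open>x \<in> T\<close> by (intro e_elt_cong) auto
  then have "\<ominus>\<^bsub>R\<^esub> e \<otimes>\<^bsub>R\<^esub> A = e \<otimes>\<^bsub>R\<^esub> (a [^]\<^bsub>R\<^esub> k \<otimes>\<^bsub>R\<^esub> A)" by (simp add: e_u QG_mult_assoc)
  then have "A = \<ominus>\<^bsub>R\<^esub> A" unfolding aA using A_rules(1,4) by (simp add: QG.l_minus)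
  then show A: "A = \<zero>\<^bsub>R\<^esub>" using eq_zero_if_eq_minus A_rules(1) by blast
  have "B = b \<otimes>\<^bsub>R\<^esub> (A \<otimes>\<^bsub>R\<^esub> b)" unfolding Ab bb_A(2) ..
  then show "B = \<zero>\<^bsub>R\<^esub>" using A by simp
qed

text \<open>The coefficient of \<open>A\<close> at the identity is computed. No
  \<open>u \<otimes> g [^] i\<close> lies in \<open>Q\<close>, and \<open>g [^] i\<close> with
  \<open>i < m\<close> does so only for \<open>i = 0\<close>, so a single term
  \<open>1 / (2 * of_nat (card Q))\<close> survives, to be divided by \<open>m\<close>.\<close>

lemma nondegenerate:
  assumes u: "u \<notin> generate G {g} <#> Q"
  shows "A \<noteq> \<zero>\<^bsub>R\<^esub>" "B \<noteq> \<zero>\<^bsub>R\<^esub>" "even m"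
proof -
  have one: "\<one> \<in> generate G {g}" by (rule generate.one)
  have notin: "u \<otimes> g [^] i \<notin> Q" for i :: nat
  proof
    assume q: "u \<otimes> g [^] i \<in> Q"
    have t: "inv (g [^] i) \<in> T" "g [^] i \<in> T" by simp_all
    have "inv (g [^] i) \<in> generate G {g}"
      using generate_m_inv_closed[of "{g}" "g [^] i"] generate_pow_on_finite_carrier[OF finite_carrier g_closed] by auto
    moreover have "inv (inv (g [^] i)) \<otimes> (u \<otimes> g [^] i) \<otimes> inv (g [^] i) \<in> Q"
      using normal.inv_op_closed1[OF normal_TG, of "inv (g [^] i)"] q t by (simp add: inv_TG)
    then have "g [^] i \<otimes> u \<in> Q" by (simp add: m_assoc)
    ultimately have "inv (g [^] i) \<otimes> (g [^] i \<otimes> u) \<in> generate G {g} <#> Q"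
      unfolding set_mult_def by blast
    then show False using u by (simp add: m_assoc[symmetric])
  qed
  have "u \<notin> Q"
  proof
    assume "u \<in> Q"
    then have "\<one> \<otimes> u \<in> generate G {g} <#> Q" using one unfolding set_mult_def by blast
    with u show False by simp
  qed
  then show "even m" using u_odd by blast
  have qh: "qh x = (if x \<in> Q then 1 / of_nat (card Q) else 0)" if "x \<in> carrier G" for x
    using that by (simp add: qh_def QG_apply(4) sQ_apply)
  have ce: "coset_elt x \<one> = (if x \<in> Q then 1 / of_nat (card Q) else 0)" if x: "x \<in> T" for x
  proof -
    have "inv x \<in> Q \<longleftrightarrow> x \<in> Q"
      using x subgroup.m_inv_closed[OF subgroup_Q, of x] subgroup.m_inv_closed[OF subgroup_Q, of "inv x"] by auto
    then show ?thesis using x by (simp add: coset_elt_def mult_elt_apply qh)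
  qed
  have "(e \<otimes>\<^bsub>R\<^esub> power_sum R a m) = (\<Oplus>\<^bsub>R\<^esub>i\<in>{..<m}. e \<otimes>\<^bsub>R\<^esub> elt G (g [^] i))"
    unfolding power_sum_def by (subst QG.finsum_rdistr) (auto simp: elt_pow)
  then have "(e \<otimes>\<^bsub>R\<^esub> power_sum R a m) \<one> = (\<Sum>i<m. (e \<otimes>\<^bsub>R\<^esub> elt G (g [^] i)) \<one>)"
    by (simp add: finsum_apply)
  also have "\<dots> = (\<Sum>i<m. if i = 0 then 1 / (2 * of_nat (card Q)) else 0)"
  proof (rule sum.cong[OF refl])
    fix i assume "i \<in> {..<m}"
    then have "g [^] i \<in> Q \<longleftrightarrow> i = 0" using g_pow_Q[of i] by (auto dest: dvd_imp_le)
    then show "(e \<otimes>\<^bsub>R\<^esub> elt G (g [^] i)) \<one> = (if i = 0 then 1 / (2 * of_nat (card Q)) else 0)"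
      using notin[of i] by (simp add: e_elt QG_apply(2,4) QG.minus_eq QG_minus_apply ce)
  qed
  also have "\<dots> = 1 / (2 * of_nat (card Q))" using m_pos by (simp add: sum.delta)
  finally have "A \<one> \<noteq> 0"
    using m_pos subgroup.one_closed[OF subgroup_Q] by (auto simp: A_def QG_apply(4))
  then show A: "A \<noteq> \<zero>\<^bsub>R\<^esub>" by (metis QG_apply(3) one_closed)
  have "A = b \<otimes>\<^bsub>R\<^esub> (B \<otimes>\<^bsub>R\<^esub> b)" unfolding bA[symmetric] bb_A(1) ..
  then show "B \<noteq> \<zero>\<^bsub>R\<^esub>" using A by auto
qed

end

section \<open>The group of units\<close>

lemma generate_carrier_update:
  assumes S: "S \<subseteq> H" and inv: "\<And>x. x \<in> S \<Longrightarrow> inv\<^bsub>M\<^esub> x = inv\<^bsub>M\<lparr>carrier := H\<rparr>\<^esub> x"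
  shows "generate M S = generate (M\<lparr>carrier := H\<rparr>) S"
proof (intro equalityI subsetI)
  fix x assume "x \<in> generate M S"
  then show "x \<in> generate (M\<lparr>carrier := H\<rparr>) S"
  proof (induction rule: generate.induct)
    case one
    show ?case using generate.one[of "M\<lparr>carrier := H\<rparr>"] by simp
  next
    case (inv x)
    then show ?case using generate.inv[of x S "M\<lparr>carrier := H\<rparr>"] assms(2) by simp
  next
    case (eng x y)
    then show ?case using generate.eng[of x "M\<lparr>carrier := H\<rparr>" S y] by simp
  qed (rule generate.incl)
next
  fix x assume "x \<in> generate (M\<lparr>carrier := H\<rparr>) S"
  then show "x \<in> generate M S"
  proof (induction rule: generate.induct)
    case one
    show ?case using generate.one[of M] by simp
  next
    case (inv x)
    then show ?case using generate.inv[of x S M] assms(2) by simp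
  next
    case (eng x y)
    then show ?case using generate.eng[of x M S y] by simp
  qed (rule generate.incl)
qed

lemma finitely_generated_iso:
  assumes "group K" "group L" "K \<cong> L" "finitely_generated K (carrier K)"
  shows "finitely_generated L (carrier L)"
proof -
  obtain f where f: "f \<in> iso K L" using assms(3) by (auto simp: is_iso_def)
  obtain S where S: "finite S" "S \<subseteq> carrier K" "generate K S = carrier K"
    using assms(4) by (auto simp: finitely_generated_def)
  interpret f: group_hom K L f
    using f assms(1,2) by (simp add: group_hom_def group_hom_axioms_def iso_def)
  have "generate L (f ` S) = f ` carrier K"
    using f.generate_img[OF S(2)] S(3) by simp
  also have "\<dots> = carrier L" using f by (simp add: iso_def bij_betw_def)
  finally show ?thesis
    unfolding finitely_generated_def using S by (intro exI[of _ "f ` S"]) auto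
qed

lemma finitely_generated_free_group: "finitely_generated (free_group n) (carrier (free_group n))"
proof -
  let ?S = "(\<lambda>i. [(True, i)]) ` {..<n}"
  have S: "?S \<subseteq> carrier (free_group n)" by (auto simp: letter_in_free_group)
  have "w \<in> generate (free_group n) ?S" if "w \<in> carrier (free_group n)" for w
    using that
  proof (induction w)
    case Nil
    then show ?case using generate.one[of "free_group n"] by (simp add: one_free_group)
  next
    case (Cons a w)
    note a = Cons_in_free_groupD[OF Cons.prems]
    obtain s i where si: "a = (s, i)" by (cases a)
    have mem: "[(True, i)] \<in> ?S" using a(1) si by auto
    have "[a] \<in> generate (free_group n) ?S"
    proof (cases s)
      case True
      with mem si show ?thesis by (auto intro: generate.incl)
    next
      case False
      then have "[a] = inv\<^bsub>free_group n\<^esub> [(True, i)]"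
        using a(1) by (simp add: si inv_letter_free_group inv_letter_def)
      then show ?thesis using generate.inv[OF mem, of "free_group n"] by simp
    qed
    then show ?case using a Cons.IH generate.eng by metis
  qed
  moreover have "generate (free_group n) ?S \<subseteq> carrier (free_group n)"
    using group.generate_incl[OF group_free_group S] .
  ultimately show ?thesis
    unfolding finitely_generated_def using S by (intro exI[of _ ?S]) auto
qed

lemma finitely_generated_DirProd:
  assumes "group K" "group L" "finitely_generated K (carrier K)" "finitely_generated L (carrier L)"
  shows "finitely_generated (K \<times>\<times> L) (carrier (K \<times>\<times> L))"
proof -
  interpret K: group K by fact
  interpret L: group L by fact
  obtain S where S: "finite S" "S \<subseteq> carrier K" "generate K S = carrier K"
    using assms(3) by (auto simp: finitely_generated_def)
  obtain S' where S': "finite S'" "S' \<subseteq> carrier L" "generate L S' = carrier L"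
    using assms(4) by (auto simp: finitely_generated_def)
  let ?U = "S \<times> {\<one>\<^bsub>L\<^esub>} \<union> {\<one>\<^bsub>K\<^esub>} \<times> S'"
  have U: "?U \<subseteq> carrier (K \<times>\<times> L)" using S S' by auto
  have inv: "inv\<^bsub>K \<times>\<times> L\<^esub> (x, y) = (inv\<^bsub>K\<^esub> x, inv\<^bsub>L\<^esub> y)" if "x \<in> carrier K" "y \<in> carrier L" for x y
    using inv_DirProd[OF assms(1,2) that] .
  have 1: "(x, \<one>\<^bsub>L\<^esub>) \<in> generate (K \<times>\<times> L) ?U" if "x \<in> generate K S" for x
    using that
  proof (induction rule: generate.induct)
    case one then show ?case using generate.one[of "K \<times>\<times> L" ?U] by simp
  next
    case (incl x) then show ?case by (intro generate.incl) auto
  next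
    case (inv x)
    then have "inv\<^bsub>K \<times>\<times> L\<^esub> (x, \<one>\<^bsub>L\<^esub>) \<in> generate (K \<times>\<times> L) ?U" by (intro generate.inv) auto
    then show ?case using inv S(2) inv_DirProd[OF assms(1,2), of x "\<one>\<^bsub>L\<^esub>"] by auto
  next
    case (eng x y) then show ?case using generate.eng[OF eng.IH] by simp
  qed
  have 2: "(\<one>\<^bsub>K\<^esub>, y) \<in> generate (K \<times>\<times> L) ?U" if "y \<in> generate L S'" for y
    using that
  proof (induction rule: generate.induct)
    case one then show ?case using generate.one[of "K \<times>\<times> L" ?U] by simp
  next
    case (incl y) then show ?case by (intro generate.incl) auto
  next
    case (inv y)
    then have "inv\<^bsub>K \<times>\<times> L\<^esub> (\<one>\<^bsub>K\<^esub>, y) \<in> generate (K \<times>\<times> L) ?U" by (intro generate.inv) auto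
    then show ?case using inv S'(2) inv_DirProd[OF assms(1,2), of "\<one>\<^bsub>K\<^esub>" y] by auto
  next
    case (eng x y) then show ?case using generate.eng[OF eng.IH] by simp
  qed
  have "carrier (K \<times>\<times> L) \<subseteq> generate (K \<times>\<times> L) ?U"
  proof
    fix p assume "p \<in> carrier (K \<times>\<times> L)"
    then obtain x y where p: "p = (x, y)" "x \<in> carrier K" "y \<in> carrier L" by auto
    have "(x, \<one>\<^bsub>L\<^esub>) \<otimes>\<^bsub>K \<times>\<times> L\<^esub> (\<one>\<^bsub>K\<^esub>, y) \<in> generate (K \<times>\<times> L) ?U"
      using 1[of x] 2[of y] p S(3) S'(3) by (intro generate.eng) auto
    then show "p \<in> generate (K \<times>\<times> L) ?U" using p by simp
  qed
  moreover have "generate (K \<times>\<times> L) ?U \<subseteq> carrier (K \<times>\<times> L)"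
    using group.generate_incl[OF DirProd_group[OF assms(1,2)] U] .
  ultimately show ?thesis
    unfolding finitely_generated_def using S(1) S'(1) U by (intro exI[of _ ?U]) auto
qed

lemma finitely_generated_finite:
  assumes "group K" "finite (carrier K)"
  shows "finitely_generated K (carrier K)"
  unfolding finitely_generated_def
  using assms group.generate_incl[OF assms(1), of "carrier K"] generate.incl[of _ "carrier K" K]
  by (intro exI[of _ "carrier K"]) blast

section \<open>Integral units and their reduced norms\<close>

context finite_group begin

lemma carrier_ZG: "a \<in> carrier (ZG G) \<longleftrightarrow> a \<in> carrier R \<and> (\<forall>x\<in>carrier G. a x \<in> \<int>)"
  by (auto simp: ZG_def carrier_QG PiE_iff)

lemma ZG_simps [simp]: "monoid.mult (ZG G) = monoid.mult R" "one (ZG G) = \<one>\<^bsub>R\<^esub>"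
  by (simp_all add: ZG_def)

lemma ZG_closed:
  "x \<in> carrier (ZG G) \<Longrightarrow> y \<in> carrier (ZG G) \<Longrightarrow> x \<otimes>\<^bsub>R\<^esub> y \<in> carrier (ZG G)"
  "x \<in> carrier (ZG G) \<Longrightarrow> y \<in> carrier (ZG G) \<Longrightarrow> x \<oplus>\<^bsub>R\<^esub> y \<in> carrier (ZG G)"
  "x \<in> carrier (ZG G) \<Longrightarrow> y \<in> carrier (ZG G) \<Longrightarrow> x \<ominus>\<^bsub>R\<^esub> y \<in> carrier (ZG G)"
  "elt G z \<in> carrier (ZG G)" "\<one>\<^bsub>R\<^esub> \<in> carrier (ZG G)"
  by (auto simp: carrier_ZG QG_apply QG.minus_eq QG_minus_apply)

lemma SL1_simps [simp]: "monoid.mult (SL1_ZG G) = monoid.mult R" "one (SL1_ZG G) = \<one>\<^bsub>R\<^esub>"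
  by (simp_all add: SL1_ZG_def units_of_def)

lemma SL1_carrier: "x \<in> carrier (SL1_ZG G) \<Longrightarrow> x \<in> carrier R"
  by (auto simp: SL1_ZG_def Units_def carrier_ZG)

text \<open>The description that defines \<open>inv\<close> is resolved by the uniqueness of
  two-sided inverses in the associative ring \<open>R\<close>, without group axioms for
  \<open>SL1_ZG G\<close>.\<close>

lemma inv_SL1:
  assumes "x \<in> carrier R" "y \<in> carrier (SL1_ZG G)" "x \<otimes>\<^bsub>R\<^esub> y = \<one>\<^bsub>R\<^esub>" "y \<otimes>\<^bsub>R\<^esub> x = \<one>\<^bsub>R\<^esub>"
  shows "inv\<^bsub>SL1_ZG G\<^esub> x = y"
  unfolding m_inv_def
proof (rule the_equality)
  fix z assume z: "z \<in> carrier (SL1_ZG G) \<and> x \<otimes>\<^bsub>SL1_ZG G\<^esub> z = \<one>\<^bsub>SL1_ZG G\<^esub> \<and> z \<otimes>\<^bsub>SL1_ZG G\<^esub> x = \<one>\<^bsub>SL1_ZG G\<^esub>"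
  then have "z = z \<otimes>\<^bsub>R\<^esub> (x \<otimes>\<^bsub>R\<^esub> y)" using assms(3) SL1_carrier by simp
  also have "\<dots> = (z \<otimes>\<^bsub>R\<^esub> x) \<otimes>\<^bsub>R\<^esub> y" by (simp add: QG_mult_assoc)
  also have "\<dots> = y" using z assms(2) SL1_carrier by simp
  finally show "z = y" .
qed (use assms in simp)

end

context matrix_units begin

text \<open>As \<open>f\<close> is a central idempotent, multiplying by \<open>f\<close>, applying
  any splitting and taking the determinant gives a multiplicative function of rational matrices
  \<open>M\<close>. By \<open>SL2_rat_character_trivial\<close> it is constantly 1 on
  \<open>SL2\<close>, whatever the component is.\<close>

lemma rho_reduced_norm:
  assumes M: "M \<in> carrier SL2" and f: "f \<in> primitive_central_idempotents R"
  shows "is_reduced_norm (component R f) (rho M \<otimes>\<^bsub>R\<^esub> f) (\<one>\<^bsub>component R f\<^esub>)"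
proof -
  have central: "f \<in> center R" and ff: "f \<otimes>\<^bsub>R\<^esub> f = f"
    using f unfolding primitive_central_idempotents_def by blast+
  have fR: "f \<in> carrier R" using central unfolding center_def by blast
  have fc: "f \<otimes>\<^bsub>R\<^esub> x = x \<otimes>\<^bsub>R\<^esub> f" if "x \<in> carrier R" for x
    using central that unfolding center_def by blast
  have C: "one (component R f) = f" "monoid.mult (component R f) = monoid.mult R"
    "carrier (component R f) = (\<lambda>x. x \<otimes>\<^bsub>R\<^esub> f) ` carrier R"
    by (simp_all add: component_def)
  have Cin: "x \<otimes>\<^bsub>R\<^esub> f \<in> carrier (component R f)" if "x \<in> carrier R" for x
    using that C by blast
  have "f = \<one>\<^bsub>R\<^esub> \<otimes>\<^bsub>R\<^esub> f" using fR by simp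
  then have "f \<in> carrier (component R f)" using Cin[of "\<one>\<^bsub>R\<^esub>"] by simp
  moreover have "f \<otimes>\<^bsub>R\<^esub> y = y \<otimes>\<^bsub>R\<^esub> f" if "y \<in> carrier (component R f)" for y
  proof -
    have "y \<in> carrier R" using that QG_closed(1) unfolding C by blast
    then show ?thesis by (rule fc)
  qed
  ultimately have cen: "f \<in> center (component R f)"
    unfolding center_def C(2) by blast
  have "\<phi> f = det (\<phi> (rho M \<otimes>\<^bsub>R\<^esub> f)) \<cdot>\<^sub>m 1\<^sub>m n" if spl: "splitting (component R f) n \<phi>" for n \<phi>
  proof -
    have hom: "\<phi> \<in> Ring.ring_hom (component R f) (ring_mat TYPE(complex) n ())"
      using spl by (simp add: splitting_def)
    have one: "\<phi> f = 1\<^sub>m n" using ring_hom_one[OF hom] by (simp add: C ring_mat_simps)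
    have dim: "\<phi> (x \<otimes>\<^bsub>R\<^esub> f) \<in> carrier_mat n n" if "x \<in> carrier R" for x
      using ring_hom_closed[OF hom Cin[OF that]] by (simp add: ring_mat_simps)
    have mult: "\<phi> ((x \<otimes>\<^bsub>R\<^esub> y) \<otimes>\<^bsub>R\<^esub> f) = \<phi> (x \<otimes>\<^bsub>R\<^esub> f) * \<phi> (y \<otimes>\<^bsub>R\<^esub> f)"
      if x: "x \<in> carrier R" and y: "y \<in> carrier R" for x y
    proof -
      have "(x \<otimes>\<^bsub>R\<^esub> f) \<otimes>\<^bsub>R\<^esub> (y \<otimes>\<^bsub>R\<^esub> f) = x \<otimes>\<^bsub>R\<^esub> (f \<otimes>\<^bsub>R\<^esub> y) \<otimes>\<^bsub>R\<^esub> f" by (simp add: QG_mult_assoc)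
      also have "\<dots> = x \<otimes>\<^bsub>R\<^esub> y \<otimes>\<^bsub>R\<^esub> (f \<otimes>\<^bsub>R\<^esub> f)" unfolding fc[OF y] by (simp add: QG_mult_assoc)
      finally have "(x \<otimes>\<^bsub>R\<^esub> f) \<otimes>\<^bsub>R\<^esub> (y \<otimes>\<^bsub>R\<^esub> f) = (x \<otimes>\<^bsub>R\<^esub> y) \<otimes>\<^bsub>R\<^esub> f" by (simp add: ff)
      then show ?thesis
        using ring_hom_mult[OF hom Cin[OF x] Cin[OF y]] by (simp add: C ring_mat_simps)
    qed
    have "det (\<phi> (rho M \<otimes>\<^bsub>R\<^esub> f)) = 1"
    proof (rule SL2_rat_character_trivial[OF _ _ M])
      show "det (\<phi> (rho (M \<otimes>\<^bsub>SL2\<^esub> N) \<otimes>\<^bsub>R\<^esub> f)) = det (\<phi> (rho M \<otimes>\<^bsub>R\<^esub> f)) * det (\<phi> (rho N \<otimes>\<^bsub>R\<^esub> f))" for M N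
        unfolding rho_mult using mult[of "rho M" "rho N"] det_mult[OF dim dim, of "rho M" "rho N"] by simp
      show "det (\<phi> (rho \<one>\<^bsub>SL2\<^esub> \<otimes>\<^bsub>R\<^esub> f)) = 1"
        unfolding rho_one using fR one by simp
    qed
    then show ?thesis unfolding one by (intro eq_matI) auto
  qed
  with cen show ?thesis by (simp add: is_reduced_norm_def C)
qed

end

definition of_int_mat2 :: "int mat2 \<Rightarrow> rat mat2" where
  "of_int_mat2 = (\<lambda>(p, q, r, s). (of_int p, of_int q, of_int r, of_int s))"

lemma of_int_mat2_mult: "of_int_mat2 (x \<otimes>\<^bsub>SL2\<^esub> y) = of_int_mat2 x \<otimes>\<^bsub>SL2\<^esub> of_int_mat2 y"
  by (cases x rule: prod_cases4, cases y rule: prod_cases4) (simp add: of_int_mat2_def mult_SL2)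

lemma of_int_mat2_one: "of_int_mat2 \<one>\<^bsub>SL2\<^esub> = \<one>\<^bsub>SL2\<^esub>"
  by (simp add: of_int_mat2_def one_SL2)

lemma of_int_mat2_closed:
  assumes "x \<in> carrier SL2"
  shows "of_int_mat2 x \<in> carrier SL2"
proof -
  obtain p q r s where x: "x = (p, q, r, s)" by (cases x rule: prod_cases4)
  have "of_int (p * s - q * r) = (1 :: rat)" using assms by (simp add: x carrier_SL2)
  then show ?thesis by (simp add: x of_int_mat2_def carrier_SL2)
qed

lemma inj_of_int_mat2: "inj of_int_mat2"
  by (rule injI) (auto simp: of_int_mat2_def split: prod.splits)

section \<open>Admissible quadruples as integer matrices\<close>

context unit_triple begin

definition matrix_of :: "int \<times> int \<times> int \<times> int \<Rightarrow> int mat2" where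
  "matrix_of = (\<lambda>(x1, x2, y1, y2). (1 + int m * y1, int m * x2, int m * x1, 1 + int m * y2))"

definition rho_int :: "int mat2 \<Rightarrow> 'a \<Rightarrow> rat" where
  "rho_int x = MU.rho (of_int_mat2 x)"

lemma rho_int_mult: "rho_int (x \<otimes>\<^bsub>SL2\<^esub> y) = rho_int x \<otimes>\<^bsub>R\<^esub> rho_int y"
  by (simp add: rho_int_def of_int_mat2_mult MU.rho_mult)

lemma rho_int_one: "rho_int \<one>\<^bsub>SL2\<^esub> = \<one>\<^bsub>R\<^esub>"
  by (simp add: rho_int_def of_int_mat2_one MU.rho_one)

lemma v_elt_rho: "v_elt G g h Q t = rho_int (matrix_of t)"
proof -
  obtain x1 x2 y1 y2 where t: "t = (x1, x2, y1, y2)" by (cases t rule: prod_cases4)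
  show ?thesis by (simp add: t v_elt_eq rho_int_def of_int_mat2_def matrix_of_def)
qed

abbreviation "inverse_param \<equiv> (\<lambda>(x1, x2, y1, y2). (- x1, - x2, y2, y1)) :: int \<times> int \<times> int \<times> int \<Rightarrow> _"

lemma admissible_iff:
  "admissible G g h Q (x1, x2, y1, y2) \<longleftrightarrow> y1 + y2 + int m * y1 * y2 = int m * x1 * x2 \<and>
     2 * int (card Q) dvd x2 + x1 \<and> 2 * int (card Q) dvd x2 - x1 \<and>
     2 * int (card Q) dvd y2 + y1 \<and> 2 * int (card Q) dvd y2 - y1"
  by (simp add: admissible_def Let_def cong_0_iff)

lemma admissible_inverse: "admissible G g h Q t \<Longrightarrow> admissible G g h Q (inverse_param t)"
proof -
  assume t: "admissible G g h Q t"
  obtain x1 x2 y1 y2 where e: "t = (x1, x2, y1, y2)" by (cases t rule: prod_cases4)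
  have "- x2 + - x1 = - (x2 + x1)" "- x2 - - x1 = - (x2 - x1)" "y1 + y2 = y2 + y1" "y1 - y2 = - (y2 - y1)"
    by simp_all
  then show ?thesis using t unfolding e prod.case admissible_iff
    by (simp only: dvd_minus_iff) (simp add: mult_ac add.commute)
qed

text \<open>The determinant minus 1 is \<open>m\<close> times the difference of the two sides of the
  admissibility equation.\<close>

lemma det_matrix_of: "matrix_of (x1, x2, y1, y2) \<in> carrier SL2 \<longleftrightarrow>
    y1 + y2 + int m * y1 * y2 = int m * x1 * x2"
proof -
  have "(1 + int m * y1) * (1 + int m * y2) - int m * x2 * (int m * x1) - 1 =
      int m * (y1 + y2 + int m * y1 * y2 - int m * x1 * x2)"
    by (simp add: algebra_simps)
  then have "(1 + int m * y1) * (1 + int m * y2) - int m * x2 * (int m * x1) = 1 \<longleftrightarrow>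
      int m * (y1 + y2 + int m * y1 * y2 - int m * x1 * x2) = 0" by linarith
  then show ?thesis using m_pos by (simp add: matrix_of_def carrier_SL2)
qed

lemma admissible_SL2: "admissible G g h Q t \<Longrightarrow> matrix_of t \<in> carrier SL2"
  by (cases t rule: prod_cases4) (simp add: det_matrix_of admissible_iff)

lemma matrix_of_inverse:
  "admissible G g h Q t \<Longrightarrow> matrix_of (inverse_param t) = inv\<^bsub>SL2\<^esub> (matrix_of t)"
  using admissible_SL2[of t] by (cases t rule: prod_cases4) (simp add: matrix_of_def inv_SL2)

lemma v_elt_inverse:
  assumes "admissible G g h Q t"
  shows "v_elt G g h Q t \<otimes>\<^bsub>R\<^esub> v_elt G g h Q (inverse_param t) = \<one>\<^bsub>R\<^esub>"
    "v_elt G g h Q (inverse_param t) \<otimes>\<^bsub>R\<^esub> v_elt G g h Q t = \<one>\<^bsub>R\<^esub>"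
  unfolding v_elt_rho matrix_of_inverse[OF assms] rho_int_mult[symmetric]
  using group.r_inv[OF group_SL2 admissible_SL2[OF assms]] group.l_inv[OF group_SL2 admissible_SL2[OF assms]]
  by (simp_all add: rho_int_one)

lemma minus_a_pow: "(\<ominus>\<^bsub>R\<^esub> elt G g) [^]\<^bsub>R\<^esub> (n::nat) = (- 1) ^ n \<odot>\<^bsub>R\<^esub> elt G (g [^] n)"
  by (induction n) (simp_all add: one_QG QG_minus smult_mult smult_smult elt_mult)

text \<open>The two congruences make all coefficients of \<open>x1 (-g)~ + x2 g~\<close> divisible by \<open>2|Q|\<close>.\<close>

lemma integral_combination:
  assumes "2 * int (card Q) dvd x2 + x1" "2 * int (card Q) dvd x2 - x1"
  shows "\<exists>Z\<in>carrier (ZG G). of_int x1 \<odot>\<^bsub>R\<^esub> power_sum R (\<ominus>\<^bsub>R\<^esub> elt G g) m \<oplus>\<^bsub>R\<^esub> of_int x2 \<odot>\<^bsub>R\<^esub> power_sum R (elt G g) m =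
    (2 * of_nat (card Q)) \<odot>\<^bsub>R\<^esub> Z"
proof -
  let ?k = "2 * int (card Q)" and ?l = "2 * of_nat (card Q) :: rat"
  let ?c = "\<lambda>i::nat. (- 1) ^ i * x1 + x2"
  let ?X = "of_int x1 \<odot>\<^bsub>R\<^esub> power_sum R (\<ominus>\<^bsub>R\<^esub> elt G g) m \<oplus>\<^bsub>R\<^esub> of_int x2 \<odot>\<^bsub>R\<^esub> power_sum R (elt G g) m"
  let ?Z = "(1 / ?l) \<odot>\<^bsub>R\<^esub> ?X"
  have X: "?X z = (\<Sum>i<m. of_int (?c i) * elt G (g [^] i) z)" if z: "z \<in> carrier G" for z
  proof -
    have "?X z = (\<Sum>i<m. of_int x1 * (\<ominus>\<^bsub>R\<^esub> elt G g [^]\<^bsub>R\<^esub> i) z) + (\<Sum>i<m. of_int x2 * (elt G g [^]\<^bsub>R\<^esub> i) z)"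
      using z by (simp add: QG_apply(2,4) power_sum_def finsum_apply sum_distrib_left)
    then show ?thesis
      using z by (simp add: minus_a_pow elt_pow QG_apply(4) sum.distrib[symmetric] algebra_simps)
  qed
  \<comment> \<open>The coefficient is \<open>x2 + x1\<close> for even \<open>i\<close> and
    \<open>x2 - x1\<close> for odd \<open>i\<close>, so each congruence serves one parity.\<close>
  have c: "?k dvd ?c i" for i
    using assms by (cases "even i") (simp_all add: add.commute)
  have "?Z z \<in> \<int>" if z: "z \<in> carrier G" for z
  proof -
    have "?Z z = (\<Sum>i<m. of_int (?c i div ?k) * elt G (g [^] i) z)"
    proof -
      have "of_int (?c i) = ?l * of_int (?c i div ?k)" for i
      proof -
        have "?c i = ?k * (?c i div ?k)" using c[of i] by simp
        then have "of_int (?c i) = (of_int (?k * (?c i div ?k)) :: rat)" by (rule arg_cong)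
        then show ?thesis by simp
      qed
      then show ?thesis using z card_Q_pos
        unfolding QG_apply(4)[OF z] X[OF z] by (simp add: sum_distrib_left mult.assoc)
    qed
    also have "\<dots> \<in> \<int>" using z by (intro Ints_sum Ints_mult) (auto simp: QG_apply(6))
    finally show ?thesis .
  qed
  then have "?Z \<in> carrier (ZG G)" by (simp add: carrier_ZG)
  moreover have "?X = ?l \<odot>\<^bsub>R\<^esub> ?Z" using card_Q_pos by (simp add: smult_smult)
  ultimately show ?thesis by blast
qed

lemma sQ_ZG: "sQ \<in> carrier (ZG G)"
  by (simp add: carrier_ZG sQ_apply)

lemma v_elt_ZG:
  assumes "admissible G g h Q t"
  shows "v_elt G g h Q t \<in> carrier (ZG G)"
proof -
  obtain x1 x2 y1 y2 where t: "t = (x1, x2, y1, y2)" by (cases t rule: prod_cases4)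
  let ?M = "power_sum R (\<ominus>\<^bsub>R\<^esub> elt G g) m" and ?P = "power_sum R (elt G g) m"
  let ?l = "2 * of_nat (card Q) :: rat" and ?w = "sQ \<otimes>\<^bsub>R\<^esub> (\<one>\<^bsub>R\<^esub> \<ominus>\<^bsub>R\<^esub> elt G u)"
  have adm: "2 * int (card Q) dvd x2 + x1" "2 * int (card Q) dvd x2 - x1"
    "2 * int (card Q) dvd y2 + y1" "2 * int (card Q) dvd y2 - y1"
    using assms by (simp_all add: t admissible_iff)
  obtain Z1 where Z1: "Z1 \<in> carrier (ZG G)"
    "of_int x1 \<odot>\<^bsub>R\<^esub> ?M \<oplus>\<^bsub>R\<^esub> of_int x2 \<odot>\<^bsub>R\<^esub> ?P = ?l \<odot>\<^bsub>R\<^esub> Z1"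
    using integral_combination[OF adm(1,2)] by blast
  obtain Z2 where Z2: "Z2 \<in> carrier (ZG G)"
    "of_int y1 \<odot>\<^bsub>R\<^esub> ?M \<oplus>\<^bsub>R\<^esub> of_int y2 \<odot>\<^bsub>R\<^esub> ?P = ?l \<odot>\<^bsub>R\<^esub> Z2"
    using integral_combination[OF adm(3,4)] by blast
  have "v_elt G g h Q t = \<one>\<^bsub>R\<^esub> \<oplus>\<^bsub>R\<^esub> (1 / ?l) \<odot>\<^bsub>R\<^esub> (?w \<otimes>\<^bsub>R\<^esub>
      (elt G h \<otimes>\<^bsub>R\<^esub> (of_int x1 \<odot>\<^bsub>R\<^esub> ?M \<oplus>\<^bsub>R\<^esub> of_int x2 \<odot>\<^bsub>R\<^esub> ?P) \<oplus>\<^bsub>R\<^esub>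
        (of_int y1 \<odot>\<^bsub>R\<^esub> ?M \<oplus>\<^bsub>R\<^esub> of_int y2 \<odot>\<^bsub>R\<^esub> ?P)))"
    by (simp add: t v_elt_def Let_def sQ_def QG.a_assoc)
  also have "\<dots> = \<one>\<^bsub>R\<^esub> \<oplus>\<^bsub>R\<^esub> ?w \<otimes>\<^bsub>R\<^esub> (elt G h \<otimes>\<^bsub>R\<^esub> Z1 \<oplus>\<^bsub>R\<^esub> Z2)"
    unfolding Z1(2) Z2(2) using card_Q_pos Z2(1)
    by (simp add: smult_mult smult_add[symmetric] smult_smult)
  also have "\<dots> \<in> carrier (ZG G)"
    using Z1(1) Z2(1) sQ_ZG by (intro ZG_closed)
  finally show ?thesis .
qed

lemma v_elt_SL1:
  assumes "admissible G g h Q t"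
  shows "v_elt G g h Q t \<in> carrier (SL1_ZG G)"
proof -
  have "v_elt G g h Q t \<in> Units (ZG G)"
    unfolding Units_def
    using v_elt_ZG[OF assms] v_elt_ZG[OF admissible_inverse[OF assms]] v_elt_inverse[OF assms] by auto
  then show ?thesis
    using MU.rho_reduced_norm[OF of_int_mat2_closed[OF admissible_SL2[OF assms]]]
    by (simp add: SL1_ZG_def v_elt_rho rho_int_def)
qed

lemma inv_v_elt:
  assumes "admissible G g h Q t"
  shows "inv\<^bsub>SL1_ZG G\<^esub> (v_elt G g h Q t) = v_elt G g h Q (inverse_param t)"
  using v_elt_SL1[OF assms] v_elt_SL1[OF admissible_inverse[OF assms]] v_elt_inverse[OF assms] SL1_carrier
  by (intro inv_SL1) auto

lemma admissible_zero: "admissible G g h Q (0, 0, 0, 0)"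
  by (simp add: admissible_iff)

lemma v_elt_zero: "v_elt G g h Q (0, 0, 0, 0) = \<one>\<^bsub>R\<^esub>"
  unfolding v_elt_rho by (simp add: matrix_of_def rho_int_one[symmetric] one_SL2)

section \<open>The group \<open>HH G g h Q\<close>\<close>

lemma HH_degenerate:
  assumes "u \<in> generate G {g} <#> Q"
  shows "HH G g h Q = {\<one>\<^bsub>R\<^esub>}"
proof -
  have "MU.rho x = \<one>\<^bsub>R\<^esub>" for x
    by (cases x rule: prod_cases4, simp only: MU.rho_def MU.lincomb_def prod.case)
      (simp add: degenerate[OF assms])
  then show ?thesis using admissible_zero unfolding HH_def v_elt_rho rho_int_def by auto
qed

lemma rho_int_inj:
  assumes "u \<notin> generate G {g} <#> Q" "rho_int x = rho_int y"
  shows "x = y"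
  using MU.rho_inj[OF nondegenerate(2)[OF assms(1)]] assms(2) inj_of_int_mat2
  unfolding rho_int_def inj_def by blast

text \<open>\<open>Gamma\<close> asks only that the parameters be divisible by \<open>card Q\<close>
  and that \<open>x2 - x1\<close> be divisible by twice that number. The other congruences follow:
  for the \<open>x\<close> by adding \<open>2 * x1\<close>, for the \<open>y\<close> from the
  determinant. Conversely, sums and differences divisible by \<open>2 * card Q\<close> make each
  parameter divisible by \<open>card Q\<close>.\<close>

lemma matrix_of_Gamma:
  assumes "even m"
  shows "matrix_of t \<in> Gamma (int (m * card Q)) \<longleftrightarrow> admissible G g h Q t"
proof -
  obtain x1 x2 y1 y2 where t: "t = (x1, x2, y1, y2)" by (cases t rule: prod_cases4)
  let ?k = "int (card Q)"
  have dvd: "int (m * card Q) dvd int m * x \<longleftrightarrow> ?k dvd x" "2 * int (m * card Q) dvd int m * x \<longleftrightarrow> 2 * ?k dvd x" for x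
  proof -
    show "int (m * card Q) dvd int m * x \<longleftrightarrow> ?k dvd x" using m_pos by simp
    have "2 * int (m * card Q) = int m * (2 * ?k)" by simp
    then show "2 * int (m * card Q) dvd int m * x \<longleftrightarrow> 2 * ?k dvd x" using m_pos by (simp only:) simp
  qed
  have "matrix_of t \<in> Gamma (int (m * card Q)) \<longleftrightarrow> matrix_of t \<in> carrier SL2 \<and>
      ?k dvd y1 \<and> ?k dvd x2 \<and> ?k dvd x1 \<and> ?k dvd y2 \<and> 2 * ?k dvd x2 - x1"
    using dvd(1)[of y1] dvd(1)[of x2] dvd(1)[of x1] dvd(1)[of y2] dvd(2)[of "x2 - x1"]
    by (simp only: t matrix_of_def Gamma_def carrier_SL2 prod.case mem_Collect_eq right_diff_distrib add_diff_cancel_left')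
  also have "\<dots> \<longleftrightarrow> admissible G g h Q t"
  proof
    assume h: "matrix_of t \<in> carrier SL2 \<and>
      ?k dvd y1 \<and> ?k dvd x2 \<and> ?k dvd x1 \<and> ?k dvd y2 \<and> 2 * ?k dvd x2 - x1"
    then have eq: "y1 + y2 + int m * y1 * y2 = int m * x1 * x2" by (simp add: t det_matrix_of)
    have two: "2 * ?k dvd 2 * x" if "?k dvd x" for x using that by simp
    have em: "2 * ?k dvd int m * x" if "?k dvd x" for x
      using that assms by (intro mult_dvd_mono) auto
    have "x2 + x1 = (x2 - x1) + 2 * x1" by simp
    then have 1: "2 * ?k dvd x2 + x1" using h two[of x1] by (metis dvd_add)
    \<comment> \<open>The even factor \<open>m\<close> on the right supplies the missing factor
      2.\<close>
    have "y2 + y1 = int m * x1 * x2 - int m * y1 * y2" using eq by simp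
    then have 2: "2 * ?k dvd y2 + y1" using h em[of x1] em[of y1] by (metis dvd_diff dvd_mult2)
    have "y2 - y1 = (y2 + y1) - 2 * y1" by simp
    then have 3: "2 * ?k dvd y2 - y1" using 2 h two[of y1] by (metis dvd_diff)
    show "admissible G g h Q t" using h eq 1 2 3 by (simp add: t admissible_iff)
  next
    assume h: "admissible G g h Q t"
    have half: "?k dvd x \<and> ?k dvd y" if "2 * ?k dvd y + x" "2 * ?k dvd y - x" for x y
    proof -
      have "2 * ?k dvd (y + x) - (y - x)" "2 * ?k dvd (y + x) + (y - x)" using that by (blast intro: dvd_diff dvd_add)+
      then have "2 * ?k dvd 2 * x" "2 * ?k dvd 2 * y" by simp_all
      then show ?thesis by simp
    qed
    show "matrix_of t \<in> carrier SL2 \<and>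
      ?k dvd y1 \<and> ?k dvd x2 \<and> ?k dvd x1 \<and> ?k dvd y2 \<and> 2 * ?k dvd x2 - x1"
      using h admissible_SL2[OF h] half[of x2 x1] half[of y2 y1] by (simp add: t admissible_iff)
  qed
  finally show ?thesis .
qed

lemma Gamma_matrix_of:
  assumes "x \<in> Gamma (int (m * card Q))"
  shows "\<exists>t. x = matrix_of t"
proof -
  obtain p q r s where x: "x = (p, q, r, s)" by (cases x rule: prod_cases4)
  have "int m dvd int (m * card Q)" by simp
  then have "int m dvd p - 1" "int m dvd q" "int m dvd r" "int m dvd s - 1"
    using assms dvd_trans unfolding x Gamma_def by blast+
  then obtain y1 x2 x1 y2 where "p - 1 = int m * y1" "q = int m * x2" "r = int m * x1" "s - 1 = int m * y2"
    by (auto elim!: dvdE)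
  then have "x = matrix_of (x1, x2, y1, y2)" by (simp add: x matrix_of_def algebra_simps)
  then show ?thesis by blast
qed

lemma HH_Gamma:
  assumes "u \<notin> generate G {g} <#> Q"
  shows "HH G g h Q = rho_int ` Gamma (int (m * card Q))"
  using matrix_of_Gamma[OF nondegenerate(3)[OF assms]] Gamma_matrix_of
  unfolding HH_def v_elt_rho by blast

lemma HH_iso:
  assumes "u \<notin> generate G {g} <#> Q"
  shows "rho_int \<in> iso (SL2\<lparr>carrier := Gamma (int (m * card Q))\<rparr>) (HH_group G g h Q)"
proof -
  have "inj_on rho_int (Gamma (int (m * card Q)))"
    using rho_int_inj[OF assms] by (auto intro!: inj_onI)
  then show ?thesis
    by (auto simp: iso_def hom_def bij_betw_def HH_group_def HH_Gamma[OF assms] rho_int_mult)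
qed

text \<open>In the degenerate case \<open>m * card Q\<close> need not be even, as
  \<open>subgroup_Gamma\<close> requires, but there the identity is the only element.\<close>

lemma HH_mult:
  assumes "x \<in> HH G g h Q" "y \<in> HH G g h Q"
  shows "x \<otimes>\<^bsub>R\<^esub> y \<in> HH G g h Q"
proof (cases "u \<in> generate G {g} <#> Q")
  case True
  then show ?thesis using assms HH_degenerate by simp
next
  case False
  have "even (int (m * card Q))" using nondegenerate(3)[OF False] by simp
  then show ?thesis
    using assms subgroup.m_closed[OF subgroup_Gamma] rho_int_mult
    unfolding HH_Gamma[OF False] by (smt (verit) imageE imageI)
qed

lemma subgroup_HH: "subgroup (HH G g h Q) (SL1_ZG G)"
proof
  show "HH G g h Q \<subseteq> carrier (SL1_ZG G)" unfolding HH_def using v_elt_SL1 by blast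
  show "x \<otimes>\<^bsub>SL1_ZG G\<^esub> y \<in> HH G g h Q" if "x \<in> HH G g h Q" "y \<in> HH G g h Q" for x y
    using HH_mult[OF that] by simp
  have "\<one>\<^bsub>R\<^esub> \<in> HH G g h Q"
    unfolding HH_def using admissible_zero v_elt_zero by (metis (mono_tags, lifting) mem_Collect_eq)
  then show "\<one>\<^bsub>SL1_ZG G\<^esub> \<in> HH G g h Q" by simp
  show "inv\<^bsub>SL1_ZG G\<^esub> x \<in> HH G g h Q" if "x \<in> HH G g h Q" for x
    using that inv_v_elt admissible_inverse unfolding HH_def by (smt (verit) mem_Collect_eq)
qed

lemma HH_trivial_iff: "HH G g h Q = {\<one>\<^bsub>R\<^esub>} \<longleftrightarrow> u \<in> generate G {g} <#> Q"
proof
  assume triv: "HH G g h Q = {\<one>\<^bsub>R\<^esub>}"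
  show "u \<in> generate G {g} <#> Q"
  proof (rule ccontr)
    assume nd: "u \<notin> generate G {g} <#> Q"
    \<comment> \<open>With only \<open>x2\<close> nonzero, both sides of the quadratic equation
      vanish, and the matrix is a nontrivial shear.\<close>
    let ?t = "(0, 2 * int (card Q), 0, 0)"
    have "admissible G g h Q ?t" by (simp add: admissible_iff)
    then have "v_elt G g h Q ?t \<in> HH G g h Q"
      unfolding HH_def by blast
    then have "rho_int (matrix_of ?t) = rho_int \<one>\<^bsub>SL2\<^esub>"
      using triv by (simp add: v_elt_rho rho_int_one)
    then have "matrix_of ?t = \<one>\<^bsub>SL2\<^esub>" by (rule rho_int_inj[OF nd])
    then show False using m_pos card_Q_pos by (simp add: matrix_of_def one_SL2)
  qed
qed (rule HH_degenerate)

lemma HH_nontrivial_structure: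
  assumes "u \<notin> generate G {g} <#> Q"
  defines "N \<equiv> m * card Q"
  shows "N = 2 \<Longrightarrow> HH_group G g h Q \<cong> free_group 3 \<times>\<times> integer_mod_group 2"
    "N > 2 \<Longrightarrow> \<exists>n. real n = 1 + real N ^ 3 / 6 * (\<Prod>p\<in>prime_factors N. 1 - 1 / real p ^ 2) \<and>
       HH_group G g h Q \<cong> free_group n"
    "N \<ge> 2"
proof -
  have N: "even N" "N > 0" using nondegenerate(3)[OF assms(1)] m_pos card_Q_pos by (simp_all add: N_def)
  then show "N \<ge> 2" by presburger
  have "group (SL2\<lparr>carrier := Gamma (int N)\<rparr>)"
    using subgroup.subgroup_is_group[OF subgroup_Gamma group_SL2] N by simp
  moreover have "SL2\<lparr>carrier := Gamma (int N)\<rparr> \<cong> HH_group G g h Q"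
    using HH_iso[OF assms(1)] unfolding is_iso_def N_def by blast
  ultimately have iso: "HH_group G g h Q \<cong> SL2\<lparr>carrier := Gamma (int N)\<rparr>"
    by (rule group.iso_sym)
  show "HH_group G g h Q \<cong> free_group 3 \<times>\<times> integer_mod_group 2" if "N = 2"
    using iso_trans[OF iso Gamma_2[OF N that]] .
  show "\<exists>n. real n = 1 + real N ^ 3 / 6 * (\<Prod>p\<in>prime_factors N. 1 - 1 / real p ^ 2) \<and>
       HH_group G g h Q \<cong> free_group n" if "N > 2"
    using Gamma_free[OF N that] iso_trans[OF iso] by blast
qed

lemma HH_group_simps: "carrier (HH_group G g h Q) = HH G g h Q"
  "monoid.mult (HH_group G g h Q) = monoid.mult R" "one (HH_group G g h Q) = \<one>\<^bsub>R\<^esub>"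
  by (simp_all add: HH_group_def)

lemma HH_carrier: "x \<in> HH G g h Q \<Longrightarrow> x \<in> carrier R"
  using subgroup.subset[OF subgroup_HH] SL1_carrier by blast

lemma HH_inverse:
  assumes "x \<in> HH G g h Q"
  shows "inv\<^bsub>SL1_ZG G\<^esub> x \<in> HH G g h Q" "x \<otimes>\<^bsub>R\<^esub> inv\<^bsub>SL1_ZG G\<^esub> x = \<one>\<^bsub>R\<^esub>" "inv\<^bsub>SL1_ZG G\<^esub> x \<otimes>\<^bsub>R\<^esub> x = \<one>\<^bsub>R\<^esub>"
proof -
  obtain t where t: "admissible G g h Q t" "x = v_elt G g h Q t" using assms by (auto simp: HH_def)
  show "inv\<^bsub>SL1_ZG G\<^esub> x \<in> HH G g h Q" using assms subgroup.m_inv_closed[OF subgroup_HH] by blast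
  show "x \<otimes>\<^bsub>R\<^esub> inv\<^bsub>SL1_ZG G\<^esub> x = \<one>\<^bsub>R\<^esub>" "inv\<^bsub>SL1_ZG G\<^esub> x \<otimes>\<^bsub>R\<^esub> x = \<one>\<^bsub>R\<^esub>"
    unfolding t(2) inv_v_elt[OF t(1)] using v_elt_inverse[OF t(1)] by auto
qed

lemma group_HH: "group (HH_group G g h Q)"
proof (rule groupI)
  fix x assume "x \<in> carrier (HH_group G g h Q)"
  then show "\<exists>y\<in>carrier (HH_group G g h Q). y \<otimes>\<^bsub>HH_group G g h Q\<^esub> x = \<one>\<^bsub>HH_group G g h Q\<^esub>"
    using HH_inverse unfolding HH_group_simps by blast
qed (use HH_mult HH_carrier subgroup.one_closed[OF subgroup_HH] in \<open>simp_all add: HH_group_simps QG_mult_assoc\<close>)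

lemma inv_HH_group: "x \<in> HH G g h Q \<Longrightarrow> inv\<^bsub>HH_group G g h Q\<^esub> x = inv\<^bsub>SL1_ZG G\<^esub> x"
  using HH_inverse by (intro group.inv_equality[OF group_HH]) (simp_all add: HH_group_simps)

lemma finitely_generated_HH: "finitely_generated (SL1_ZG G) (HH G g h Q)"
proof -
  have "finitely_generated (HH_group G g h Q) (carrier (HH_group G g h Q))"
  proof (cases "u \<in> generate G {g} <#> Q")
    case True
    then show ?thesis
      using HH_degenerate by (intro finitely_generated_finite group_HH) (simp add: HH_group_simps)
  next
    case False
    have tr: ?thesis if "HH_group G g h Q \<cong> L" "group L" "finitely_generated L (carrier L)" for L :: "'c monoid"
      using finitely_generated_iso[OF that(2) group_HH group.iso_sym[OF group_HH that(1)] that(3)] .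
    show ?thesis
    proof (cases "m * card Q = 2")
      case True
      have "group (free_group 3 \<times>\<times> integer_mod_group 2)" by (intro DirProd_group) auto
      moreover have "finitely_generated (integer_mod_group 2) (carrier (integer_mod_group 2))"
        by (rule finitely_generated_finite) (simp_all add: carrier_integer_mod_group)
      then have "finitely_generated (free_group 3 \<times>\<times> integer_mod_group 2) (carrier (free_group 3 \<times>\<times> integer_mod_group 2))"
        by (intro finitely_generated_DirProd finitely_generated_free_group) auto
      ultimately show ?thesis
        using HH_nontrivial_structure(1)[OF False True] finitely_generated_iso[OF _ group_HH]
          group.iso_sym[OF group_HH] by blast
    next
      case nt: False
      then have "m * card Q > 2" using HH_nontrivial_structure(3)[OF False] by simp
      then obtain n where "HH_group G g h Q \<cong> free_group n"
        using HH_nontrivial_structure(2)[OF False] by blast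
      then show ?thesis
        using finitely_generated_iso[OF group_free_group group_HH] finitely_generated_free_group
          group.iso_sym[OF group_HH] by blast
    qed
  qed
  then obtain S where S: "finite S" "S \<subseteq> HH G g h Q" "generate (HH_group G g h Q) S = HH G g h Q"
    by (auto simp: finitely_generated_def HH_group_simps)
  \<comment> \<open>\<open>generate\<close> depends on the carrier only through \<open>inv\<close>,
    and inverses in the two structures agree on \<open>HH G g h Q\<close>.\<close>
  have "generate (SL1_ZG G) S = generate (HH_group G g h Q) S"
    unfolding HH_group_def using S(2) inv_HH_group
    by (intro generate_carrier_update[OF S(2)]) (auto simp: HH_group_def)
  then show ?thesis
    unfolding finitely_generated_def
    using S subgroup.subset[OF subgroup_HH] by (intro exI[of _ S]) auto
qed

end

theorem theorem1:
  fixes G :: "('g, 'm) monoid_scheme" and g h :: 'g and Q :: "'g set"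
  assumes "group G" and "finite (carrier G)"
    and "g \<in> carrier G" and "h \<in> carrier G" and "subgroup Q G"
    and "Q \<lhd> triple_group G g h Q"
    and "Q #>\<^bsub>G\<^esub> commutator G g h \<in> center (triple_group G g h Q Mod Q)"
    and "coset_order G g h Q h = 2"
  shows
    "(subgroup (HH G g h Q) (SL1_ZG G) \<and> finitely_generated (SL1_ZG G) (HH G g h Q) \<and>
       (\<forall>x1 x2 y1 y2. admissible G g h Q (x1, x2, y1, y2) \<longrightarrow>
          inv\<^bsub>SL1_ZG G\<^esub> (v_elt G g h Q (x1, x2, y1, y2)) = v_elt G g h Q (- x1, - x2, y2, y1))) \<and>
     (HH G g h Q \<noteq> {\<one>\<^bsub>SL1_ZG G\<^esub>} \<longleftrightarrow> commutator G g h \<notin> generate G {g} <#>\<^bsub>G\<^esub> Q) \<and>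
     (HH G g h Q \<noteq> {\<one>\<^bsub>SL1_ZG G\<^esub>} \<longrightarrow>
       (let N = coset_order G g h Q g * card Q in
         (N = 2 \<longrightarrow> HH_group G g h Q \<cong> free_group 3 \<times>\<times> integer_mod_group 2) \<and>
         (N > 2 \<longrightarrow> (\<exists>n. real n = 1 + real N ^ 3 / 6 * (\<Prod>p\<in>prime_factors N. 1 - 1 / real p ^ 2) \<and>
            HH_group G g h Q \<cong> free_group n))))"
proof -
  have "finite_group G"
    using assms(1,2) by (simp add: finite_group_def finite_group_axioms_def)
  then interpret unit_triple G g h Q
    using assms(3-8) by (intro unit_triple.intro unit_triple_axioms.intro)
  show ?thesis
    using subgroup_HH finitely_generated_HH inv_v_elt HH_trivial_iff HH_nontrivial_structure(1,2)
    unfolding Let_def by simp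
qed

end
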